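(* Let $X$ be a compact connected smooth manifold of positive dimension, let $G=\mathrm{Diff}\,X$ be the group of all $C^\infty$ diffeomorphisms of $X$ equipped with the $C^\infty$-topology, let $p\in X$, and let $H=\{f\in G: f(p)=p\}$ with the subspace topology. Then the inclusion $H\to G$ is not an epimorphism in the category of Hausdorff topological groups; that is, there exist a Hausdorff topological group $K$ and two distinct continuous homomorphisms $\varphi,\psi:G\to K$ that agree on $H$.
   Context: The $C^\infty$-topology on $\mathrm{Diff}\,X$ is the topology of uniform convergence of all derivatives; it makes $\mathrm{Diff}\,X$ a topological group. Morphisms in the category of Hausdorff topological groups are continuous homomorphisms. A morphism $f:A\to B$ in a category is an epimorphism if for any object $Z$ and any morphisms $g_1,g_2:B\to Z$, the equality $g_1f=g_2f$ implies $g_1=g_2$. *)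

theory Defs
  imports "HOL-Analysis.Analysis" "HOL-Algebra.Bij"
begin

section \<open>Smooth maps between Euclidean spaces\<close>

text \<open>\<open>iter_deriv [v\<^sub>1, \<dots>, v\<^sub>k] f\<close> is the iterated directional derivative
  of \<open>f\<close> along \<open>v\<^sub>1, \<dots>, v\<^sub>k\<close>; for basis vectors these are the iterated partial derivatives.
  Its values are meaningful only where the derivatives involved exist.\<close>

primrec iter_deriv ::
  "'a::euclidean_space list \<Rightarrow> ('a \<Rightarrow> 'b::euclidean_space) \<Rightarrow> 'a \<Rightarrow> 'b" where
  "iter_deriv [] f = f"
| "iter_deriv (v # vs) f = (\<lambda>x. frechet_derivative (iter_deriv vs f) (at x) v)"

text \<open>Used only for open \<open>S\<close>, where it is the class of \<open>C\<^sup>\<infinity>\<close> maps on \<open>S\<close>; the values of \<open>f\<close>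
  outside \<open>S\<close> do not matter then.\<close>

definition smooth_on ::
  "'a::euclidean_space set \<Rightarrow> ('a \<Rightarrow> 'b::euclidean_space) \<Rightarrow> bool" where
  "smooth_on S f \<longleftrightarrow> (\<forall>vs. \<forall>x\<in>S. iter_deriv vs f differentiable (at x))"

section \<open>Smooth manifolds\<close>

text \<open>A chart is a pair \<open>(U, \<phi>)\<close>. Since functions are total, \<open>\<phi>\<close> has irrelevant values outside
  \<open>U\<close>; its inverse is \<open>inv_into U \<phi>\<close>. The model space \<open>'e\<close> is of class \<open>euclidean_space\<close>, hence
  of positive dimension, and charts map onto open subsets of it, so there is no boundary.\<close>

type_synonym ('a, 'e) chart = "'a set \<times> ('a \<Rightarrow> 'e)"

definition charts_of :: "'a topology \<Rightarrow> ('a, 'e::euclidean_space) chart set" where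
  "charts_of X = {(U, \<phi>). openin X U \<and> open (\<phi> ` U) \<and>
     homeomorphic_map (subtopology X U) (top_of_set (\<phi> ` U)) \<phi>}"

definition smoothly_compatible ::
  "('a, 'e::euclidean_space) chart \<Rightarrow> ('a, 'e) chart \<Rightarrow> bool" where
  "smoothly_compatible c d \<longleftrightarrow> (case (c, d) of ((U, \<phi>), (V, \<psi>)) \<Rightarrow>
     smooth_on (\<phi> ` (U \<inter> V)) (\<psi> \<circ> inv_into U \<phi>) \<and>
     smooth_on (\<psi> ` (U \<inter> V)) (\<phi> \<circ> inv_into V \<psi>))"

text \<open>The smooth structure \<open>\<A>\<close> is a maximal smooth atlas.\<close>

definition smooth_manifold ::
  "'a topology \<Rightarrow> ('a, 'e::euclidean_space) chart set \<Rightarrow> bool" where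
  "smooth_manifold X \<A> \<longleftrightarrow>
     Hausdorff_space X \<and> second_countable X \<and>
     \<A> \<subseteq> charts_of X \<and> (\<Union>(U, \<phi>)\<in>\<A>. U) = topspace X \<and>
     (\<forall>c\<in>\<A>. \<forall>d\<in>\<A>. smoothly_compatible c d) \<and>
     (\<forall>c\<in>charts_of X. (\<forall>d\<in>\<A>. smoothly_compatible c d) \<longrightarrow> c \<in> \<A>)"

definition smooth_map ::
  "'a topology \<Rightarrow> ('a, 'e::euclidean_space) chart set \<Rightarrow>
   'b topology \<Rightarrow> ('b, 'f::euclidean_space) chart set \<Rightarrow> ('a \<Rightarrow> 'b) \<Rightarrow> bool" where
  "smooth_map X \<A> Y \<B> f \<longleftrightarrow> continuous_map X Y f \<and>
     (\<forall>(U, \<phi>)\<in>\<A>. \<forall>(V, \<psi>)\<in>\<B>. smooth_on (\<phi> ` (U \<inter> f -` V)) (\<psi> \<circ> f \<circ> inv_into U \<phi>))"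

section \<open>The diffeomorphism group and its \<open>C\<^sup>\<infinity>\<close>-topology\<close>

text \<open>As in \<^const>\<open>BijGroup\<close>, a self-map of the manifold is represented by the function that
  is \<^const>\<open>undefined\<close> outside \<open>topspace X\<close>; the product \<open>g \<otimes> f\<close> is \<open>g\<close> after \<open>f\<close>.\<close>

definition diffeos ::
  "'a topology \<Rightarrow> ('a, 'e::euclidean_space) chart set \<Rightarrow> ('a \<Rightarrow> 'a) set" where
  "diffeos X \<A> = {f \<in> Bij (topspace X).
     smooth_map X \<A> X \<A> f \<and> smooth_map X \<A> X \<A> (inv_into (topspace X) f)}"

definition Diff ::
  "'a topology \<Rightarrow> ('a, 'e::euclidean_space) chart set \<Rightarrow> ('a \<Rightarrow> 'a) monoid" where
  "Diff X \<A> = (BijGroup (topspace X))\<lparr>carrier := diffeos X \<A>\<rparr>"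

definition stabilizer ::
  "'a topology \<Rightarrow> ('a, 'e::euclidean_space) chart set \<Rightarrow> 'a \<Rightarrow> ('a \<Rightarrow> 'a) monoid" where
  "stabilizer X \<A> p = (Diff X \<A>)\<lparr>carrier := {f \<in> diffeos X \<A>. f p = p}\<rparr>"

text \<open>The diffeomorphisms \<open>g\<close> that map \<open>K\<close> into the domain of the chart \<open>d\<close> and whose derivative
  along \<open>vs\<close>, read in the charts \<open>c\<close> and \<open>d\<close>, is \<open>\<epsilon>\<close>-close to that of \<open>f\<close> on \<open>K\<close>.\<close>

definition Cinf_nbhd ::
  "'a topology \<Rightarrow> ('a, 'e::euclidean_space) chart set \<Rightarrow> ('a \<Rightarrow> 'a) \<Rightarrow>
   ('a, 'e) chart \<Rightarrow> ('a, 'e) chart \<Rightarrow> 'a set \<Rightarrow> 'e list \<Rightarrow> real \<Rightarrow> ('a \<Rightarrow> 'a) set" where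
  "Cinf_nbhd X \<A> f c d K vs \<epsilon> = (case (c, d) of ((U, \<phi>), (V, \<psi>)) \<Rightarrow>
     {g \<in> diffeos X \<A>. g ` K \<subseteq> V \<and>
        (\<forall>x\<in>K. dist (iter_deriv vs (\<psi> \<circ> g \<circ> inv_into U \<phi>) (\<phi> x))
                    (iter_deriv vs (\<psi> \<circ> f \<circ> inv_into U \<phi>) (\<phi> x)) < \<epsilon>)})"

text \<open>The topology of uniform convergence of all derivatives (on compact subsets of charts).
  Finitely many derivatives are controlled at once by intersecting subbasic sets.\<close>

definition Cinf_topology ::
  "'a topology \<Rightarrow> ('a, 'e::euclidean_space) chart set \<Rightarrow> ('a \<Rightarrow> 'a) topology" where
  "Cinf_topology X \<A> = topology_generated_by
     {Cinf_nbhd X \<A> f c d K vs \<epsilon> | f c d K vs \<epsilon>.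
        f \<in> diffeos X \<A> \<and> c \<in> \<A> \<and> d \<in> \<A> \<and> compactin X K \<and>
        K \<subseteq> fst c \<and> f ` K \<subseteq> fst d \<and> 0 < \<epsilon>}"

section \<open>Hausdorff topological groups and epimorphisms\<close>

definition Hausdorff_group :: "('g, 'm) monoid_scheme \<Rightarrow> 'g topology \<Rightarrow> bool" where
  "Hausdorff_group G T \<longleftrightarrow> group G \<and> topspace T = carrier G \<and> Hausdorff_space T \<and>
     continuous_map (prod_topology T T) T (\<lambda>(x, y). x \<otimes>\<^bsub>G\<^esub> y) \<and>
     continuous_map T T (\<lambda>x. inv\<^bsub>G\<^esub> x)"

definition continuous_hom ::
  "('g, 'm) monoid_scheme \<Rightarrow> 'g topology \<Rightarrow> ('h, 'n) monoid_scheme \<Rightarrow> 'h topology \<Rightarrow>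
   ('g \<Rightarrow> 'h) \<Rightarrow> bool" where
  "continuous_hom G S H T f \<longleftrightarrow> f \<in> hom G H \<and> continuous_map S T f"

text \<open>HOL cannot quantify over all types, so the test objects \<open>Z\<close> range over the Hausdorff
  topological groups with elements in a given type \<open>'z\<close>. This is no restriction if \<open>'z\<close> is
  infinite and \<open>B\<close> injects into it: for \<open>g\<^sub>1, g\<^sub>2\<close> into an arbitrary \<open>Z\<close>, only the subgroup of \<open>Z\<close>
  generated by both images matters, and it has at most \<open>max \<bar>B\<bar> \<aleph>\<^sub>0\<close> elements.

  Maps are compared on carriers only. That \<open>f\<close> is itself a morphism is not part of the definition,
  so that the negation really asserts that \<open>g\<^sub>1\<close> and \<open>g\<^sub>2\<close> exist.\<close>

definition epimorphism ::
  "'z itself \<Rightarrow> ('a, 'm) monoid_scheme \<Rightarrow> ('b, 'n) monoid_scheme \<Rightarrow> 'b topology \<Rightarrow>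
   ('a \<Rightarrow> 'b) \<Rightarrow> bool" where
  "epimorphism (_ :: 'z itself) A B T f \<longleftrightarrow>
     (\<forall>(Z :: 'z monoid) S g\<^sub>1 g\<^sub>2.
        Hausdorff_group Z S \<and> continuous_hom B T Z S g\<^sub>1 \<and> continuous_hom B T Z S g\<^sub>2 \<and>
        (\<forall>a\<in>carrier A. g\<^sub>1 (f a) = g\<^sub>2 (f a)) \<longrightarrow>
        (\<forall>b\<in>carrier B. g\<^sub>1 b = g\<^sub>2 b))"

end

theory Submission
  imports Defs
begin

text \<open>
  Let \<open>A\<close> be the space of finitely supported functions on \<open>X\<close>. For \<open>g \<in> G\<close> the element
  \<open>b(g) = \<delta>\<^bsub>g p\<^esub> - \<delta>\<^bsub>p\<^esub>\<close> of \<open>A\<close> is a cocycle that vanishes exactly on \<open>H\<close>, so \<open>g \<mapsto> (g, 0)\<close> and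
  \<open>g \<mapsto> (g, b(g))\<close> are distinct homomorphisms into \<open>G \<ltimes> A\<close> that agree on \<open>H\<close>; it remains to
  find a Hausdorff group topology that makes both continuous.

  Take a metric \<open>d\<close> on \<open>X\<close> that is locally bi-Lipschitz to the charts, and let \<open>\<parallel>a\<parallel>\<close> be the supremum
  of \<open>\<bar>\<langle>f, a\<rangle>\<bar>\<close> over the functions \<open>\<bar>f\<bar> \<le> 1\<close> with modulus of continuity \<open>1 / ln (2 + 1/d)\<close>. A
  bi-Lipschitz map \<open>u\<close> changes \<open>ln (2 + 1/d)\<close> only by a bounded amount. Hence, if \<open>u\<close> is moreover
  uniformly close to the identity, it changes \<open>\<parallel>\<cdot>\<parallel>\<close> by a factor close to 1. A diffeomorphism that is
  \<open>C\<^sup>1\<close>-close to a given one has a controlled bi-Lipschitz constant, and no more than this is used of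
  the \<open>C\<^sup>\<infinity>\<close>-topology. So \<open>G\<close> may be replaced by the group \<open>B\<close> of all bi-Lipschitz bijections. The
  group \<open>B \<ltimes> A\<close> acts on \<open>A\<close> by affine maps; call \<open>z\<close> close to \<open>w\<close> if, for each of finitely many
  elements \<open>k\<close>, the function \<open>v \<mapsto> ln (1 + \<parallel>v\<parallel>)\<close> takes uniformly close values at \<open>k z v\<close> and
  \<open>k w v\<close>. Such a topology is a group topology for any function in place of \<open>ln (1 + \<parallel>v\<parallel>)\<close>.
\<close>

section \<open>Smooth functions\<close>

text \<open>Why a logarithmic modulus: comparing the images of \<open>v\<close> under
  \<open>k z\<close> and \<open>k w\<close>, where \<open>k\<close> has linear part
  \<open>h\<close>, leads to the conjugate by \<open>h\<close> of a map near the identity. In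
  \<open>B\<close> such a conjugation can destroy closeness of the Lipschitz constant to 1, so the
  dual norm of plain Lipschitz functions is of no use. What survives is a bound on the constant
  together with uniform closeness to the identity. Why a logarithm of the norm: closeness must be
  uniform over all \<open>v\<close> in the unbounded space \<open>A\<close>, because products and
  inverses evaluate at vectors that move with the group element. A relative error of the norm is
  unbounded in \<open>v\<close>; the logarithm turns it into a bounded one, and the 1 inside absorbs
  translations by short vectors. Why the elements \<open>k\<close>: precomposition with a group
  element only permutes the vectors \<open>v\<close>, so right translations are harmless, but left
  translations must be built into the topology. They also give separation: a translation moves a
  chosen vector to the origin, the only vector that its norm determines.\<close>

lemma frechet_derivative_eqI:
  "(f has_derivative f') (at x) \<Longrightarrow> frechet_derivative f (at x) = f'"
  by (rule frechet_derivative_at[symmetric])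

lemma differentiable_cong_open:
  assumes "open S" "x \<in> S" "\<And>y. y \<in> S \<Longrightarrow> f y = g y" "f differentiable at x"
  shows "g differentiable at x"
proof -
  have "(f has_derivative frechet_derivative f (at x)) (at x)"
    using assms(4) by (simp add: frechet_derivative_works)
  then have "(g has_derivative frechet_derivative f (at x)) (at x)"
    using has_derivative_transform_within_open assms(1-3) by blast
  then show ?thesis by (rule differentiableI)
qed

lemma frechet_derivative_cong_open:
  assumes "open S" "x \<in> S" "\<And>y. y \<in> S \<Longrightarrow> f y = g y"
  shows "frechet_derivative f (at x) = frechet_derivative g (at x)"
proof -
  have "(f has_derivative D) (at x) \<longleftrightarrow> (g has_derivative D) (at x)" for D
    using assms has_derivative_transform_within_open[of f D x UNIV S g]
      has_derivative_transform_within_open[of g D x UNIV S f] by auto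
  then show ?thesis
    by (simp add: frechet_derivative_def)
qed

text \<open>Differentiability of order \<open>k + 1\<close>.\<close>

primrec ck_on :: "nat \<Rightarrow> 'a::euclidean_space set \<Rightarrow> ('a \<Rightarrow> 'b::euclidean_space) \<Rightarrow> bool" where
  "ck_on 0 S f \<longleftrightarrow> (\<forall>x\<in>S. f differentiable (at x))"
| "ck_on (Suc k) S f \<longleftrightarrow> (\<forall>x\<in>S. f differentiable (at x)) \<and>
     (\<forall>v. ck_on k S (\<lambda>x. frechet_derivative f (at x) v))"

lemma iter_deriv_append:
  "iter_deriv (vs @ ws) f = iter_deriv vs (iter_deriv ws f)"
  by (induction vs) auto

text \<open>The two recursions run in opposite directions: \<open>iter_deriv\<close> adds the
  outermost derivative at the head of the list, whereas \<open>ck_on\<close> differentiates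
  \<open>f\<close> itself first. Hence lists are split at their last entry.\<close>

lemma ck_on_iff:
  "ck_on k S f \<longleftrightarrow> (\<forall>vs. length vs \<le> k \<longrightarrow> (\<forall>x\<in>S. iter_deriv vs f differentiable (at x)))"
proof (induction k arbitrary: f)
  case (Suc k)
  show ?case
  proof
    assume L: "ck_on (Suc k) S f"
    show "\<forall>vs. length vs \<le> Suc k \<longrightarrow> (\<forall>x\<in>S. iter_deriv vs f differentiable (at x))"
    proof (intro allI impI)
      fix vs :: "'a list"
      assume l: "length vs \<le> Suc k"
      show "\<forall>x\<in>S. iter_deriv vs f differentiable (at x)"
      proof (cases vs rule: rev_cases)
        case Nil
        then show ?thesis using L by simp
      next
        case (snoc ws v)
        have "iter_deriv vs f = iter_deriv ws (\<lambda>x. frechet_derivative f (at x) v)"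
          by (simp add: snoc iter_deriv_append)
        then show ?thesis using L l Suc.IH by (auto simp: snoc)
      qed
    qed
  next
    assume R: "\<forall>vs. length vs \<le> Suc k \<longrightarrow> (\<forall>x\<in>S. iter_deriv vs f differentiable (at x))"
    have "ck_on k S (\<lambda>x. frechet_derivative f (at x) v)" for v
      unfolding Suc.IH
    proof (intro allI impI)
      fix vs :: "'a list" assume "length vs \<le> k"
      then have "\<forall>x\<in>S. iter_deriv (vs @ [v]) f differentiable (at x)" using R by simp
      then show "\<forall>x\<in>S. iter_deriv vs (\<lambda>x. frechet_derivative f (at x) v) differentiable at x"
        by (simp add: iter_deriv_append)
    qed
    moreover have "\<forall>x\<in>S. f differentiable (at x)"
      using R[rule_format, of "[]"] by simp
    ultimately show "ck_on (Suc k) S f" by simp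
  qed
qed auto

lemma smooth_on_iff_ck_on: "smooth_on S f \<longleftrightarrow> (\<forall>k. ck_on k S f)"
  unfolding smooth_on_def ck_on_iff by blast

lemma ck_on_differentiable: "ck_on k S f \<Longrightarrow> x \<in> S \<Longrightarrow> f differentiable (at x)"
  by (cases k) auto

lemma ck_on_Suc: "ck_on (Suc k) S f \<Longrightarrow> ck_on k S f"
  unfolding ck_on_iff by auto

lemma ck_on_deriv: "ck_on (Suc k) S f \<Longrightarrow> ck_on k S (\<lambda>x. frechet_derivative f (at x) v)"
  by simp

lemma ck_on_cong:
  assumes "open S" "\<And>x. x \<in> S \<Longrightarrow> f x = g x" "ck_on k S f"
  shows "ck_on k S g"
  using assms(2,3)
proof (induction k arbitrary: f g)
  case 0
  then show ?case
    using differentiable_cong_open[OF assms(1), of _ f g] by auto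
next
  case (Suc k)
  have "ck_on k S (\<lambda>x. frechet_derivative g (at x) v)" for v
    by (rule Suc.IH[of "\<lambda>x. frechet_derivative f (at x) v"])
      (use Suc.prems frechet_derivative_cong_open[OF assms(1), of _ f g] in auto)
  moreover have "g differentiable at x" if "x \<in> S" for x
    using differentiable_cong_open[OF assms(1) that, of f g] Suc.prems that by auto
  ultimately show ?case by simp
qed

text \<open>The tool behind the inductions below: an explicit derivative \<open>D\<close>, known
  only on \<open>S\<close>, replaces \<open>frechet_derivative\<close>. Openness of \<open>S\<close>
  lets the two be exchanged under further differentiation.\<close>

lemma ck_onI_Suc:
  assumes "open S"
    and "\<And>x. x \<in> S \<Longrightarrow> (f has_derivative D x) (at x)"
    and "\<And>v. ck_on k S (\<lambda>x. D x v)"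
  shows "ck_on (Suc k) S f"
proof -
  have "ck_on k S (\<lambda>x. frechet_derivative f (at x) v)" for v
    by (rule ck_on_cong[OF assms(1) _ assms(3)[of v]]) (metis assms(2) frechet_derivative_eqI)
  moreover have "f differentiable at x" if "x \<in> S" for x
    using assms(2)[OF that] by (auto simp: differentiable_def)
  ultimately show ?thesis by simp
qed

lemma ck_on_has_derivative:
  "ck_on k S f \<Longrightarrow> x \<in> S \<Longrightarrow> (f has_derivative frechet_derivative f (at x)) (at x)"
  using ck_on_differentiable[of k S f x] by (simp flip: frechet_derivative_works)

lemma ck_on_const: "open S \<Longrightarrow> ck_on k S (\<lambda>x. c)"
proof (induction k arbitrary: c)
  case (Suc k)
  show ?case
    by (rule ck_onI_Suc[where D = "\<lambda>x v. 0"]) (auto simp: Suc)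
qed auto

lemma ck_on_linear:
  assumes "open S" "bounded_linear L" "ck_on k S f"
  shows "ck_on k S (\<lambda>x. L (f x))"
  using assms(3)
proof (induction k arbitrary: f)
  case 0
  then show ?case
    using differentiable_compose[of L, OF bounded_linear_imp_differentiable[OF assms(2)]] by auto
next
  case (Suc k)
  show ?case
  proof (rule ck_onI_Suc[where D = "\<lambda>x v. L (frechet_derivative f (at x) v)"])
    show "((\<lambda>x. L (f x)) has_derivative (\<lambda>v. L (frechet_derivative f (at x) v))) (at x)"
      if "x \<in> S" for x
      using bounded_linear.has_derivative[OF assms(2)] ck_on_has_derivative[OF Suc.prems that] .
  qed (use assms Suc in auto)
qed

lemma ck_on_ident: "open S \<Longrightarrow> ck_on k S (\<lambda>x. x)"
proof (cases k)
  case (Suc j)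
  assume "open S"
  then show ?thesis unfolding Suc
    by (intro ck_onI_Suc[where D = "\<lambda>x v. v"]) (auto simp: ck_on_const)
qed auto

lemma ck_on_add:
  assumes "open S" "ck_on k S f" "ck_on k S g"
  shows "ck_on k S (\<lambda>x. f x + g x)"
  using assms(2,3)
proof (induction k arbitrary: f g)
  case (Suc k)
  show ?case
  proof (rule ck_onI_Suc[where D = "\<lambda>x v. frechet_derivative f (at x) v + frechet_derivative g (at x) v"])
    show "((\<lambda>x. f x + g x) has_derivative
        (\<lambda>v. frechet_derivative f (at x) v + frechet_derivative g (at x) v)) (at x)" if "x \<in> S" for x
      using has_derivative_add[OF ck_on_has_derivative[OF Suc.prems(1) that]
          ck_on_has_derivative[OF Suc.prems(2) that]] .
  qed (use assms Suc in simp_all)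
qed auto

lemma ck_on_sum:
  assumes "open S" "\<And>i. i \<in> I \<Longrightarrow> ck_on k S (f i)"
  shows "ck_on k S (\<lambda>x. \<Sum>i\<in>I. f i x)"
  using assms(2)
proof (induction I rule: infinite_finite_induct)
  case (insert i I)
  then show ?case
    by (simp add: ck_on_add[OF assms(1)])
qed (simp_all add: ck_on_const assms(1))

lemma ck_on_scaleR:
  fixes f :: "'a::euclidean_space \<Rightarrow> real" and g :: "'a \<Rightarrow> 'b::euclidean_space"
  assumes "open S" "ck_on k S f" "ck_on k S g"
  shows "ck_on k S (\<lambda>x. f x *\<^sub>R g x)"
  using assms(2,3)
proof (induction k arbitrary: f g)
  case 0
  then show ?case by (auto intro!: differentiable_scaleR)
next
  case (Suc k)
  let ?D = "\<lambda>x v. f x *\<^sub>R frechet_derivative g (at x) v + frechet_derivative f (at x) v *\<^sub>R g x"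
  show ?case
  proof (rule ck_onI_Suc[where D = ?D])
    show "((\<lambda>x. f x *\<^sub>R g x) has_derivative ?D x) (at x)" if "x \<in> S" for x
      using has_derivative_scaleR[OF ck_on_has_derivative[OF Suc.prems(1) that]
          ck_on_has_derivative[OF Suc.prems(2) that]] .
    show "ck_on k S (\<lambda>x. ?D x v)" for v
      by (intro ck_on_add[OF assms(1)] Suc.IH ck_on_Suc[OF Suc.prems(1)] ck_on_Suc[OF Suc.prems(2)]
          ck_on_deriv Suc.prems)
  qed (fact assms)
qed

lemma linear_sum_Basis:
  fixes f :: "'a::euclidean_space \<Rightarrow> 'b::real_vector"
  assumes "linear f"
  shows "(\<Sum>b\<in>Basis. (v \<bullet> b) *\<^sub>R f b) = f v"
proof -
  have "f (\<Sum>b\<in>Basis. (v \<bullet> b) *\<^sub>R b) = (\<Sum>b\<in>Basis. f ((v \<bullet> b) *\<^sub>R b))"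
    by (rule linear_sum[OF assms])
  then show ?thesis
    unfolding euclidean_representation linear_cmul[OF assms] by (rule sym)
qed

lemma ck_on_compose:
  fixes g :: "'a::euclidean_space \<Rightarrow> 'b::euclidean_space" and f :: "'b \<Rightarrow> 'c::euclidean_space"
  assumes "open S" "g ` S \<subseteq> T" "ck_on k T f" "ck_on k S g"
  shows "ck_on k S (\<lambda>x. f (g x))"
  using assms(3,4)
proof (induction k arbitrary: f)
  case 0
  have "(\<lambda>x. f (g x)) differentiable at x" if "x \<in> S" for x
    using differentiable_chain_at[of g x f] 0 that assms(2) by (simp add: o_def image_subset_iff)
  then show ?case by simp
next
  case (Suc k)
  let ?f = "\<lambda>y. frechet_derivative f (at y)" and ?g = "\<lambda>x. frechet_derivative g (at x)"
  have gT: "g x \<in> T" if "x \<in> S" for x using that assms(2) by auto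
  show ?case
  proof (rule ck_onI_Suc[where D = "\<lambda>x v. ?f (g x) (?g x v)"])
    show "((\<lambda>x. f (g x)) has_derivative (\<lambda>v. ?f (g x) (?g x v))) (at x)" if "x \<in> S" for x
      using has_derivative_compose[OF ck_on_has_derivative[OF Suc.prems(2) that]
          ck_on_has_derivative[OF Suc.prems(1) gT[OF that]]] .
    fix v
    \<comment> \<open>In the chain rule the direction \<open>?g x v\<close> varies with
      \<open>x\<close>, while the induction hypothesis handles fixed directions only. Expanding it
      in the basis leaves scalar coefficients times derivatives along constant vectors.\<close>
    have "ck_on k S (\<lambda>x. \<Sum>b\<in>Basis. (?g x v \<bullet> b) *\<^sub>R ?f (g x) b)"
    proof (rule ck_on_sum[OF assms(1) ck_on_scaleR[OF assms(1)]])
      show "ck_on k S (\<lambda>x. ?g x v \<bullet> b)" for b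
        using ck_on_linear[OF assms(1) bounded_linear_inner_left ck_on_deriv[OF Suc.prems(2)]] .
      show "ck_on k S (\<lambda>x. ?f (g x) b)" for b
        by (rule Suc.IH[OF ck_on_deriv[OF Suc.prems(1)] ck_on_Suc[OF Suc.prems(2)]])
    qed
    then show "ck_on k S (\<lambda>x. ?f (g x) (?g x v))"
    proof (rule ck_on_cong[OF assms(1), rotated])
      fix x assume "x \<in> S"
      have lin: "linear (?f (g x))"
        using has_derivative_linear[OF ck_on_has_derivative[OF Suc.prems(1) gT[OF \<open>x \<in> S\<close>]]] .
      show "(\<Sum>b\<in>Basis. (?g x v \<bullet> b) *\<^sub>R ?f (g x) b) = ?f (g x) (?g x v)"
        by (rule linear_sum_Basis[OF lin])
    qed
  qed (fact assms)
qed

text \<open>The derivative of the scalar inverse is a product of inverses, so the order of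
  differentiability raises itself by induction; the general case is a composition.\<close>

lemma ck_on_inverse:
  fixes f :: "'a::euclidean_space \<Rightarrow> real"
  assumes "open S" "ck_on k S f" "\<And>x. x \<in> S \<Longrightarrow> f x \<noteq> 0"
  shows "ck_on k S (\<lambda>x. inverse (f x))"
proof -
  have o: "open (- {0::real})"
    by (rule open_Compl) simp
  have "ck_on k (- {0}) (inverse :: real \<Rightarrow> real)"
  proof (induction k)
    case 0
    show ?case
      unfolding ck_on.simps
    proof
      fix x :: real assume "x \<in> - {0}"
      then have "x \<noteq> 0" by simp
      then show "inverse differentiable at x"
        by (rule differentiableI[OF has_derivative_inverse'])
    qed
  next
    case (Suc k)
    show ?case
    proof (rule ck_onI_Suc[where D = "\<lambda>x v. inverse x *\<^sub>R (inverse x *\<^sub>R (- v))", OF o])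
      show "(inverse has_derivative (\<lambda>v. inverse x *\<^sub>R inverse x *\<^sub>R - v)) (at x)"
        if "x \<in> - {0::real}" for x
        using has_derivative_inverse'[of x UNIV] that by (simp add: ac_simps)
      show "ck_on k (- {0}) (\<lambda>x. inverse x *\<^sub>R inverse x *\<^sub>R - v)" for v :: real
        by (rule ck_on_scaleR[OF o Suc ck_on_scaleR[OF o Suc ck_on_const[OF o]]])
    qed
  qed
  moreover have "f ` S \<subseteq> - {0}" using assms(3) by auto
  ultimately show ?thesis
    by (intro ck_on_compose[OF assms(1) _ _ assms(2)])
qed

lemma smooth_on_cong:
  "open S \<Longrightarrow> (\<And>x. x \<in> S \<Longrightarrow> f x = g x) \<Longrightarrow> smooth_on S f \<Longrightarrow> smooth_on S g"
  unfolding smooth_on_iff_ck_on using ck_on_cong[of S f g] by simp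

lemma smooth_on_compose:
  assumes "open S" "g ` S \<subseteq> T" "smooth_on T f" "smooth_on S g"
  shows "smooth_on S (f \<circ> g)"
  using assms(3,4) ck_on_compose[OF assms(1,2), of _ f] unfolding smooth_on_iff_ck_on o_def by simp

lemma smooth_on_subset: "smooth_on T f \<Longrightarrow> S \<subseteq> T \<Longrightarrow> smooth_on S f"
  unfolding smooth_on_def by blast

lemma smooth_on_pointwise: "(\<And>x. x \<in> S \<Longrightarrow> \<exists>W. x \<in> W \<and> smooth_on W f) \<Longrightarrow> smooth_on S f"
  unfolding smooth_on_def by blast

section \<open>Lipschitz bounds\<close>

lemma linear_norm_bound_Basis:
  fixes f :: "'a::euclidean_space \<Rightarrow> 'b::euclidean_space" and M :: real
  assumes "linear f" "\<And>b. b \<in> Basis \<Longrightarrow> norm (f b) \<le> M"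
  shows "norm (f v) \<le> DIM('a) * M * norm v"
proof -
  have "norm (f v) = norm (\<Sum>b\<in>Basis. (v \<bullet> b) *\<^sub>R f b)"
    by (simp add: linear_sum_Basis[OF assms(1)])
  also have "\<dots> \<le> (\<Sum>b\<in>(Basis::'a set). norm v * M)"
    by (rule order_trans[OF norm_sum sum_mono])
      (use assms(2) Basis_le_norm in \<open>auto intro!: mult_mono\<close>)
  finally show ?thesis by (simp add: algebra_simps)
qed

lemma lipschitz_of_partial_bounds:
  fixes f :: "'a::euclidean_space \<Rightarrow> 'b::euclidean_space" and M :: real
  assumes "convex K" "\<And>x. x \<in> K \<Longrightarrow> f differentiable (at x)"
    and "\<And>x b. x \<in> K \<Longrightarrow> b \<in> Basis \<Longrightarrow> norm (frechet_derivative f (at x) b) \<le> M"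
    and "x \<in> K" "y \<in> K"
  shows "norm (f x - f y) \<le> DIM('a) * M * norm (x - y)"
proof (rule differentiable_bound[OF assms(1) _ _ assms(4,5)])
  fix z assume z: "z \<in> K"
  have D: "(f has_derivative frechet_derivative f (at z)) (at z)"
    using assms(2)[OF z] by (simp add: frechet_derivative_works)
  then show "(f has_derivative frechet_derivative f (at z)) (at z within K)"
    by (rule has_derivative_at_withinI)
  show "onorm (frechet_derivative f (at z)) \<le> DIM('a) * M"
    by (rule onorm_le)
      (rule linear_norm_bound_Basis[OF has_derivative_linear[OF D] assms(3)[OF z]])
qed

lemma smooth_on_locally_lipschitz:
  fixes f :: "'a::euclidean_space \<Rightarrow> 'b::euclidean_space"
  assumes "open S" "smooth_on S f" "x \<in> S"
  obtains r L where "r > 0" "L > 0" "cball x r \<subseteq> S"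
    "\<And>y z. y \<in> cball x r \<Longrightarrow> z \<in> cball x r \<Longrightarrow> norm (f y - f z) \<le> L * norm (y - z)"
proof -
  \<comment> \<open>The sum dominates every partial derivative at \<open>x\<close>; the summand 1
    makes the bound strict, so that it persists near \<open>x\<close>.\<close>
  let ?M = "(\<Sum>b\<in>(Basis::'a set). norm (frechet_derivative f (at x) b)) + 1"
  \<comment> \<open>Index 1 stands for two orders of differentiability: the partial derivatives are
    differentiable, hence continuous.\<close>
  have ck: "ck_on 1 S f" using assms(2) smooth_on_iff_ck_on by blast
  have "\<forall>\<^sub>F y in at x. norm (frechet_derivative f (at y) b) < ?M" if "b \<in> Basis" for b
  proof -
    have "(\<lambda>y. frechet_derivative f (at y) b) differentiable at x"
      using ck assms(3) by auto
    then have "isCont (\<lambda>y. norm (frechet_derivative f (at y) b)) x"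
      by (intro continuous_norm differentiable_imp_continuous_within)
    moreover have "norm (frechet_derivative f (at x) b) < ?M"
      using member_le_sum[of b Basis "\<lambda>b. norm (frechet_derivative f (at x) b)"] that by force
    ultimately show ?thesis
      using order_tendstoD(2) isCont_def by blast
  qed
  then have "\<forall>\<^sub>F y in at x. \<forall>b\<in>Basis. norm (frechet_derivative f (at y) b) < ?M"
    by (simp add: eventually_ball_finite)
  then obtain r1 where r1: "r1 > 0" "\<And>y. y \<noteq> x \<Longrightarrow> dist y x < r1 \<Longrightarrow>
      \<forall>b\<in>Basis. norm (frechet_derivative f (at y) b) < ?M"
    unfolding eventually_at by auto
  obtain r2 where r2: "r2 > 0" "cball x r2 \<subseteq> S"
    using assms open_contains_cball by blast
  define r where "r = min (r1 / 2) r2"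
  have M: "?M > 0"
    by (simp add: add_nonneg_pos sum_nonneg)
  show ?thesis
  proof (rule that[of r "DIM('a) * ?M"])
    show "r > 0" "DIM('a) * ?M > 0" using r1 r2 M by (auto simp: r_def)
    show sub: "cball x r \<subseteq> S" using r2 by (auto simp: r_def)
    fix y z assume yz: "y \<in> cball x r" "z \<in> cball x r"
    show "norm (f y - f z) \<le> DIM('a) * ?M * norm (y - z)"
    proof (rule lipschitz_of_partial_bounds[of "cball x r"])
      show "f differentiable at w" if "w \<in> cball x r" for w
        using ck_on_differentiable[OF ck] that sub by blast
      fix w b assume w: "w \<in> cball x r" and b: "b \<in> (Basis::'a set)"
      show "norm (frechet_derivative f (at w) b) \<le> ?M"
      proof (cases "w = x")
        case True
        then show ?thesis
          using member_le_sum[of b Basis "\<lambda>b. norm (frechet_derivative f (at x) b)"] b by force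
      next
        case False
        then show ?thesis
          using r1(2)[OF False] r1(1) w b by (auto simp: r_def dist_commute less_imp_le)
      qed
    qed (use yz in auto)
  qed
qed

section \<open>A diffeomorphism with support in a ball\<close>

text \<open>The classical smooth function \<open>exp (- (1 / t))\<close>, extended by 0, with a
  polynomial factor in \<open>1 / t\<close> that makes the family closed under
  differentiation.\<close>

definition flat :: "real poly \<Rightarrow> real \<Rightarrow> real" where
  "flat Q t = (if 0 < t then poly Q (1 / t) * exp (- (1 / t)) else 0)"

text \<open>With \<open>s = 1 / t\<close> one has ds/dt = -s^2, so the derivative of Q(s) exp(-s) in
  \<open>t\<close> is s^2 (Q(s) - Q'(s)) exp(-s); \<open>[:0, 0, 1:]\<close> is s^2.\<close>

definition flat_deriv :: "real poly \<Rightarrow> real poly" where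
  "flat_deriv Q = [:0, 0, 1:] * (Q - pderiv Q)"

lemma poly_times_exp_tendsto_0: "((\<lambda>s. s ^ k * poly Q s * exp (- s)) \<longlongrightarrow> (0::real)) at_top"
proof (induction Q arbitrary: k)
  case 0
  show ?case by simp
next
  case (pCons a Q)
  have "((\<lambda>s. a * (s ^ k / exp s) + s ^ Suc k * poly Q s * exp (- s)) \<longlongrightarrow> a * 0 + 0) at_top"
    by (intro tendsto_add tendsto_mult_left tendsto_power_div_exp_0 pCons.IH)
  then show ?case
    by (rule tendsto_eq_rhs[OF Lim_transform_eventually])
      (auto intro!: always_eventually simp: exp_minus field_simps)
qed

lemma DERIV_flat: "(flat Q has_real_derivative flat (flat_deriv Q) t) (at t)"
proof -
  consider "t > 0" | "t < 0" | "t = 0" by linarith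
  then show ?thesis
  proof cases
    case 1
    have "((\<lambda>t. poly Q (1 / t) * exp (- (1 / t))) has_real_derivative
        poly (pderiv Q) (1 / t) * (- 1 / t\<^sup>2) * exp (- (1 / t)) + exp (- (1 / t)) * (1 / t\<^sup>2) * poly Q (1 / t)) (at t)"
      using 1 by (auto intro!: derivative_eq_intros DERIV_chain'[of "\<lambda>t. 1 / t", OF _ poly_DERIV]
        simp: power2_eq_square)
    moreover have "poly (pderiv Q) (1 / t) * (- 1 / t\<^sup>2) * exp (- (1 / t)) + exp (- (1 / t)) * (1 / t\<^sup>2) * poly Q (1 / t)
        = flat (flat_deriv Q) t"
      using 1 by (simp add: flat_def flat_deriv_def algebra_simps power2_eq_square)
    ultimately have "((\<lambda>t. poly Q (1 / t) * exp (- (1 / t))) has_real_derivative flat (flat_deriv Q) t) (at t)"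
      by simp
    then show ?thesis
      by (rule has_field_derivative_transform_within_open[of _ _ _ "{0<..}"])
        (use 1 in \<open>auto simp: flat_def\<close>)
  next
    case 2
    have "((\<lambda>t. 0) has_real_derivative 0) (at t)" by simp
    then have "(flat Q has_real_derivative 0) (at t)"
      by (rule has_field_derivative_transform_within_open[of _ _ _ "{..<0}"])
        (use 2 in \<open>auto simp: flat_def\<close>)
    then show ?thesis using 2 by (simp add: flat_def)
  next
    case 3
    have "((\<lambda>h. (flat Q (0 + h) - flat Q 0) / h) \<longlongrightarrow> 0) (at 0)"
    proof (subst filterlim_at_split, intro conjI)
      have "((\<lambda>h. (flat Q (0 + h) - flat Q 0) / h) \<longlongrightarrow> 0) (at_left 0) \<longleftrightarrow> ((\<lambda>h::real. 0::real) \<longlongrightarrow> 0) (at_left 0)"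
        by (rule tendsto_cong) (auto simp: flat_def eventually_at_left_field intro!: exI[of _ "-1"])
      then show "((\<lambda>h. (flat Q (0 + h) - flat Q 0) / h) \<longlongrightarrow> 0) (at_left 0)" by simp
      \<comment> \<open>At 0 the right-hand difference quotient is s Q(s) exp(-s) with
        \<open>s = 1 / h\<close> tending to infinity; dividing by \<open>h\<close> accounts for the
        power 1.\<close>
      have "((\<lambda>h. (1 / h) ^ 1 * poly Q (1 / h) * exp (- (1 / h))) \<longlongrightarrow> (0::real)) (at_right 0)"
        using filterlim_compose[OF poly_times_exp_tendsto_0[of 1 Q] filterlim_inverse_at_top_right]
        by (simp add: inverse_eq_divide)
      moreover have "((\<lambda>h. (flat Q (0 + h) - flat Q 0) / h) \<longlongrightarrow> 0) (at_right 0) \<longleftrightarrow>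
          ((\<lambda>h. (1 / h) ^ 1 * poly Q (1 / h) * exp (- (1 / h))) \<longlongrightarrow> (0::real)) (at_right 0)"
        by (rule tendsto_cong) (auto simp: flat_def eventually_at_right_field intro!: exI[of _ "1"])
      ultimately show "((\<lambda>h. (flat Q (0 + h) - flat Q 0) / h) \<longlongrightarrow> 0) (at_right 0)" by simp
    qed
    then show ?thesis unfolding 3 by (simp add: DERIV_def flat_def)
  qed
qed

lemma ck_on_flat: "ck_on k UNIV (flat Q)"
proof (induction k arbitrary: Q)
  case 0
  show ?case
    using DERIV_flat by (auto simp: differentiable_def has_field_derivative_def)
next
  case (Suc k)
  show ?case
  proof (rule ck_onI_Suc[where D = "\<lambda>t v. flat (flat_deriv Q) t *\<^sub>R v"])
    show "(flat Q has_derivative (\<lambda>v. flat (flat_deriv Q) t *\<^sub>R v)) (at t)" for t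
      using DERIV_flat[of Q t] by (simp add: has_field_derivative_def)
    show "ck_on k UNIV (\<lambda>t. flat (flat_deriv Q) t *\<^sub>R v)" for v :: real
      by (rule ck_on_scaleR[OF open_UNIV Suc ck_on_const[OF open_UNIV]])
  qed simp
qed

text \<open>For the constant polynomial 1 the derivative is s^2 exp(-s), and exp(s) is at least s^2
  / 2 for s \<ge> 0.\<close>

lemma flat_deriv_one_bound: "\<bar>flat (flat_deriv 1) t\<bar> \<le> 2"
proof (cases "t > 0")
  case True
  define s where "s = 1 / t"
  have s: "s \<ge> 0" using True by (simp add: s_def)
  have "s\<^sup>2 \<le> 2 * exp s" using exp_lower_Taylor_quadratic[OF s] s by simp
  then have "s\<^sup>2 * exp (- s) \<le> 2" by (simp add: exp_minus field_simps)
  then show ?thesis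
    using True by (simp add: flat_def flat_deriv_def s_def power2_eq_square)
qed (simp add: flat_def)

text \<open>The factor \<open>1 / (8 r)\<close> makes the Lipschitz constant at most \<open>1/2\<close>.\<close>

definition bump :: "'a::euclidean_space \<Rightarrow> real \<Rightarrow> 'a \<Rightarrow> real" where
  "bump c r x = flat 1 (r\<^sup>2 - (x - c) \<bullet> (x - c)) / (8 * r)"

definition bump_deriv :: "'a::euclidean_space \<Rightarrow> real \<Rightarrow> 'a \<Rightarrow> 'a \<Rightarrow> real" where
  "bump_deriv c r x v = - (2 * ((x - c) \<bullet> v)) * flat (flat_deriv 1) (r\<^sup>2 - (x - c) \<bullet> (x - c)) / (8 * r)"

lemma has_derivative_bump: "(bump c r has_derivative bump_deriv c r x) (at x)"
proof -
  have "((\<lambda>x. r\<^sup>2 - (x - c) \<bullet> (x - c)) has_derivative (\<lambda>v. - (2 * ((x - c) \<bullet> v)))) (at x)"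
    by (auto intro!: derivative_eq_intros simp: inner_commute)
  moreover have "(flat 1 has_derivative (\<lambda>h. flat (flat_deriv 1) (r\<^sup>2 - (x - c) \<bullet> (x - c)) * h))
      (at (r\<^sup>2 - (x - c) \<bullet> (x - c)))"
    using DERIV_flat[of 1 "r\<^sup>2 - (x - c) \<bullet> (x - c)"] by (simp add: has_field_derivative_def)
  ultimately have "((\<lambda>x. flat 1 (r\<^sup>2 - (x - c) \<bullet> (x - c))) has_derivative
      (\<lambda>v. flat (flat_deriv 1) (r\<^sup>2 - (x - c) \<bullet> (x - c)) * - (2 * ((x - c) \<bullet> v)))) (at x)"
    by (rule has_derivative_compose)
  from bounded_linear.has_derivative[OF bounded_linear_divide this, of "8 * r"]
  show ?thesis
    unfolding bump_def[abs_def] bump_deriv_def[abs_def] by (simp add: mult.commute)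
qed

text \<open>Inside the ball Cauchy-Schwarz contributes \<open>2 * (r * norm v)\<close> and the flat
  function at most 2; division by \<open>8 * r\<close> leaves \<open>norm v / 2\<close>. Outside the
  ball the derivative vanishes.\<close>

lemma bump_deriv_bound:
  assumes "r > 0"
  shows "\<bar>bump_deriv c r x v\<bar> \<le> norm v / 2"
proof (cases "norm (x - c) < r")
  case True
  have "\<bar>(x - c) \<bullet> v\<bar> \<le> r * norm v"
    using Cauchy_Schwarz_ineq2[of "x - c" v] mult_right_mono[OF less_imp_le[OF True], of "norm v"] by simp
  then have "\<bar>2 * ((x - c) \<bullet> v)\<bar> * \<bar>flat (flat_deriv 1) (r\<^sup>2 - (x - c) \<bullet> (x - c))\<bar> \<le> (2 * (r * norm v)) * 2"
    using flat_deriv_one_bound assms by (intro mult_mono) auto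
  then show ?thesis
    using assms by (simp add: bump_deriv_def abs_mult field_simps)
next
  case False
  then have "r\<^sup>2 \<le> (x - c) \<bullet> (x - c)"
    using assms by (simp add: power_mono flip: power2_norm_eq_inner)
  then show ?thesis by (simp add: bump_deriv_def flat_def)
qed

lemma bump_lipschitz: "r > 0 \<Longrightarrow> \<bar>bump c r x - bump c r y\<bar> \<le> (1 / 2) * norm (x - y)"
  unfolding real_norm_def[symmetric]
proof (rule differentiable_bound[OF convex_UNIV, where f' = "bump_deriv c r"])
  assume r: "r > 0"
  show "onorm (bump_deriv c r z) \<le> 1 / 2" for z
    by (rule onorm_le) (use bump_deriv_bound[OF r, of c z] in simp)
qed (simp_all add: has_derivative_bump)

lemma bump_eq_0: "r > 0 \<Longrightarrow> r \<le> dist x c \<Longrightarrow> bump c r x = 0"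
  using power_mono[of r "norm (x - c)" 2]
  by (auto simp: bump_def flat_def dist_norm not_less simp flip: power2_norm_eq_inner)

lemma bump_center: "r > 0 \<Longrightarrow> bump c r c > 0"
  by (simp add: bump_def flat_def)

lemma ck_on_bump: "ck_on k UNIV (bump c r)"
proof -
  have *: "ck_on k UNIV (\<lambda>x. (x - c) \<bullet> b)" for b
  proof -
    have "ck_on k UNIV (\<lambda>x. x - c)"
      using ck_on_add[OF open_UNIV ck_on_ident[OF open_UNIV] ck_on_const[OF open_UNIV], of k "- c"]
      by simp
    then show ?thesis
      by (rule ck_on_linear[OF open_UNIV bounded_linear_inner_left])
  qed
  have "ck_on k UNIV (\<lambda>x. \<Sum>b\<in>Basis. ((x - c) \<bullet> b) *\<^sub>R ((x - c) \<bullet> b))"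
    by (rule ck_on_sum[OF open_UNIV ck_on_scaleR[OF open_UNIV * *]])
  moreover have "(\<Sum>b\<in>Basis. ((x - c) \<bullet> b) *\<^sub>R ((x - c) \<bullet> b)) = (x - c) \<bullet> (x - c)" for x
    unfolding real_scaleR_def by (rule euclidean_inner[symmetric])
  ultimately have "ck_on k UNIV (\<lambda>x. (x - c) \<bullet> (x - c))"
    by (simp only:)
  then have "ck_on k UNIV (\<lambda>x. - ((x - c) \<bullet> (x - c)))"
    by (rule ck_on_linear[OF open_UNIV bounded_linear_minus[OF bounded_linear_ident]])
  from ck_on_add[OF open_UNIV ck_on_const[OF open_UNIV] this, of "r\<^sup>2"]
  have "ck_on k UNIV (\<lambda>x. r\<^sup>2 - (x - c) \<bullet> (x - c))" by simp
  from ck_on_compose[OF open_UNIV _ ck_on_flat this, of 1]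
  have "ck_on k UNIV (\<lambda>x. flat 1 (r\<^sup>2 - (x - c) \<bullet> (x - c)))" by simp
  from ck_on_linear[OF open_UNIV bounded_linear_divide this]
  show ?thesis unfolding bump_def[abs_def] .
qed

text \<open>\<open>G\<close> shifts each point in one fixed direction \<open>e\<close> by the bump.
  As the bump is a contraction, solving \<open>G x = y\<close> is a fixed point problem with exactly
  one solution, so \<open>G\<close> is a global bijection; smoothness of its inverse needs a
  separate argument.\<close>

lemma ball_diffeo:
  fixes c :: "'a::euclidean_space"
  assumes r: "r > 0"
  obtains G h :: "'a \<Rightarrow> 'a" where "smooth_on UNIV G" "smooth_on UNIV h"
    "\<And>x. h (G x) = x" "\<And>x. G (h x) = x" "\<And>x. r \<le> dist x c \<Longrightarrow> G x = x" "G c \<noteq> c"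
proof -
  obtain e :: 'a where e: "e \<in> Basis" using nonempty_Basis by blast
  define G where "G = (\<lambda>x. x + bump c r x *\<^sub>R e)"
  have fixpoint: "\<exists>!x. y - bump c r x *\<^sub>R e = x" for y
  proof (rule banach_fix_type[of "1/2"])
    show "\<forall>u v. dist (y - bump c r u *\<^sub>R e) (y - bump c r v *\<^sub>R e) \<le> 1 / 2 * dist u v"
    proof (intro allI)
      fix u v
      have "dist (y - bump c r u *\<^sub>R e) (y - bump c r v *\<^sub>R e) = norm ((bump c r v - bump c r u) *\<^sub>R e)"
        by (simp add: dist_norm algebra_simps)
      also have "\<dots> \<le> 1 / 2 * dist u v"
        using bump_lipschitz[OF r, of c v u] e by (simp add: dist_norm norm_minus_commute)
      finally show "dist (y - bump c r u *\<^sub>R e) (y - bump c r v *\<^sub>R e) \<le> 1 / 2 * dist u v" .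
    qed
  qed auto
  have "y - bump c r x *\<^sub>R e = x \<longleftrightarrow> G x = y" for x y
    by (auto simp: G_def algebra_simps)
  then have ex: "\<exists>!x. G x = y" for y
    using fixpoint[of y] by simp
  define h where "h = (\<lambda>y. THE x. G x = y)"
  have Gh: "G (h y) = y" for y unfolding h_def using theI'[OF ex] .
  have hG: "h (G x) = x" for x using ex[of "G x"] Gh[of "G x"] by blast
  \<comment> \<open>The bump difference is at most half of \<open>norm (h x - h y)\<close>;
    absorbing it on the left gives the factor 2. This provides the continuity of \<open>h\<close>
    that the derivative rule for inverses asks for.\<close>
  have lip: "norm (h x - h y) \<le> 2 * norm (x - y)" for x y
  proof -
    have "h x - h y = (x - y) - (bump c r (h x) - bump c r (h y)) *\<^sub>R e"
      using Gh[of x] Gh[of y] by (simp add: G_def algebra_simps)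
    then have "norm (h x - h y) \<le> norm (x - y) + \<bar>bump c r (h x) - bump c r (h y)\<bar>"
      using norm_triangle_ineq4[of "x - y" "(bump c r (h x) - bump c r (h y)) *\<^sub>R e"] e by simp
    then show ?thesis using bump_lipschitz[OF r, of c "h x" "h y"] by simp
  qed
  have cont: "continuous (at y) h" for y
  proof -
    have "2-lipschitz_on UNIV h"
      by (rule lipschitz_onI) (auto simp: dist_norm lip)
    then show ?thesis
      using lipschitz_on_continuous_on continuous_on_eq_continuous_at by blast
  qed
  have nz: "1 + bump_deriv c r x e \<noteq> 0" for x
    using bump_deriv_bound[OF r, of c x e] e by auto
  \<comment> \<open>\<open>Q x\<close> inverts the derivative of \<open>G\<close> at
    \<open>x\<close>, a rank-one perturbation of the identity (Sherman-Morrison formula). The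
    denominator is nonzero because the bump derivative along the unit vector \<open>e\<close> is at
    most 1/2 in absolute value.\<close>
  define Q where "Q = (\<lambda>x w. w - (bump_deriv c r x w * inverse (1 + bump_deriv c r x e)) *\<^sub>R e)"
  have lin: "linear (bump_deriv c r x)" for x
    using has_derivative_linear[OF has_derivative_bump] .
  have dG: "(G has_derivative (\<lambda>v. v + bump_deriv c r x v *\<^sub>R e)) (at x)" for x
    unfolding G_def by (auto intro!: derivative_eq_intros has_derivative_bump)
  have dh: "(h has_derivative Q (h y)) (at y)" for y
  proof (rule has_derivative_inverse_basic[OF dG _ _ cont open_UNIV])
    show "bounded_linear (Q (h y))"
      unfolding Q_def
      by (intro linear_conv_bounded_linear[THEN iffD1] linearI)
        (simp_all add: linear_add[OF lin] linear_cmul[OF lin] algebra_simps)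
    show "Q (h y) \<circ> (\<lambda>v. v + bump_deriv c r (h y) v *\<^sub>R e) = id"
    proof
      fix v
      let ?B = "bump_deriv c r (h y)"
      have "?B (v + ?B v *\<^sub>R e) * inverse (1 + ?B e) = ?B v"
        using nz[of "h y"] by (simp add: linear_add[OF lin] linear_cmul[OF lin] field_simps)
      then show "(Q (h y) \<circ> (\<lambda>v. v + ?B v *\<^sub>R e)) v = id v"
        by (simp add: Q_def)
    qed
  qed (auto simp: Gh)
  have ckB: "ck_on k UNIV (\<lambda>x. bump_deriv c r x v)" for k v
    using ck_on_deriv[OF ck_on_bump[of "Suc k" c r], of v]
    by (simp add: frechet_derivative_eqI[OF has_derivative_bump])
  have ckQ: "ck_on k UNIV (\<lambda>x. Q x v)" for k v
  proof -
    have "ck_on k UNIV (\<lambda>x. inverse (1 + bump_deriv c r x e))"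
      by (intro ck_on_inverse ck_on_add ck_on_const ckB nz open_UNIV)
    from ck_on_scaleR[OF open_UNIV ckB this, of v]
    have "ck_on k UNIV (\<lambda>x. (bump_deriv c r x v * inverse (1 + bump_deriv c r x e)) *\<^sub>R (- e))"
      by (intro ck_on_scaleR open_UNIV ck_on_const) simp
    from ck_on_add[OF open_UNIV ck_on_const[OF open_UNIV] this, of v]
    show ?thesis by (simp add: Q_def)
  qed
  \<comment> \<open>Since \<open>h' = Q \<circ> h\<close> with \<open>Q\<close> smooth, each order of differentiability gives the next.\<close>
  have ckh: "ck_on k UNIV h" for k
  proof (induction k)
    case 0
    show ?case using dh by (auto simp: differentiable_def)
  next
    case (Suc k)
    show ?case
      by (rule ck_onI_Suc[where D = "\<lambda>y. Q (h y)"])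
        (use dh ck_on_compose[OF open_UNIV _ ckQ Suc] in auto)
  qed
  have ckG: "ck_on k UNIV G" for k
    unfolding G_def by (intro ck_on_add ck_on_ident ck_on_scaleR ck_on_bump ck_on_const open_UNIV)
  show ?thesis
  proof (rule that[of G h])
    show "smooth_on UNIV G" "smooth_on UNIV h"
      using ckG ckh by (auto simp: smooth_on_iff_ck_on)
    show "G x = x" if "r \<le> dist x c" for x
      using bump_eq_0[OF r that] by (simp add: G_def)
    show "G c \<noteq> c" using bump_center[OF r, of c] e by (auto simp: G_def)
  qed (auto simp: Gh hG)
qed

section \<open>Group topologies from a function on a set with an action\<close>

locale function_on_action =
  fixes G :: "'g monoid" (structure) and V :: "'v set" and act :: "'g \<Rightarrow> 'v \<Rightarrow> 'v" and N :: "'v \<Rightarrow> real"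
  assumes grp: "group G"
    and act_closed: "g \<in> carrier G \<Longrightarrow> v \<in> V \<Longrightarrow> act g v \<in> V"
    and act_mult: "g \<in> carrier G \<Longrightarrow> h \<in> carrier G \<Longrightarrow> v \<in> V \<Longrightarrow> act (g \<otimes> h) v = act g (act h v)"
    and act_one: "v \<in> V \<Longrightarrow> act \<one> v = v"
begin

text \<open>Supremum distance below \<epsilon>, phrased without a supremum because the differences
  may be unbounded over \<open>V\<close>. The strict bound \<delta> < \<epsilon> leaves the slack
  that openness arguments use.\<close>

definition near :: "real \<Rightarrow> 'g \<Rightarrow> 'g \<Rightarrow> bool" where
  "near \<epsilon> z w \<longleftrightarrow> (\<exists>\<delta><\<epsilon>. \<forall>v\<in>V. \<bar>N (act z v) - N (act w v)\<bar> \<le> \<delta>)"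

text \<open>The preimage under left translation by \<open>k\<close> of the ball around
  \<open>y\<close>; the centre \<open>y\<close> is arbitrary, so these sets form a subbasis without
  further closure.\<close>

definition near_set :: "'g \<Rightarrow> 'g \<Rightarrow> real \<Rightarrow> 'g set" where
  "near_set k y \<epsilon> = {w \<in> carrier G. near \<epsilon> (k \<otimes> w) y}"

definition action_topology :: "'g topology" where
  "action_topology = topology_generated_by
     {near_set k y \<epsilon> | k y \<epsilon>. k \<in> carrier G \<and> y \<in> carrier G \<and> 0 < \<epsilon>}"

lemma near_refl: "0 < \<epsilon> \<Longrightarrow> near \<epsilon> z z"
  unfolding near_def by (intro exI[of _ 0]) auto

lemma nearE:
  assumes "near \<epsilon> z w"
  obtains \<eta> where "0 < \<eta>" "\<And>v. v \<in> V \<Longrightarrow> \<bar>N (act z v) - N (act w v)\<bar> \<le> \<epsilon> - 3 * \<eta>"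
proof -
  obtain \<delta> where "\<delta> < \<epsilon>" "\<forall>v\<in>V. \<bar>N (act z v) - N (act w v)\<bar> \<le> \<delta>"
    using assms unfolding near_def by blast
  then show ?thesis
    by (intro that[of "(\<epsilon> - \<delta>) / 3"]) (auto simp: field_simps)
qed

lemma nearI:
  "\<eta> > 0 \<Longrightarrow> (\<And>v. v \<in> V \<Longrightarrow> \<bar>N (act z v) - N (act w v)\<bar> \<le> \<epsilon> - \<eta>) \<Longrightarrow> near \<epsilon> z w"
  unfolding near_def by (intro exI[of _ "\<epsilon> - \<eta>"]) auto

lemma nearD: "near \<epsilon> z w \<Longrightarrow> v \<in> V \<Longrightarrow> \<bar>N (act z v) - N (act w v)\<bar> \<le> \<epsilon>"
  unfolding near_def by (meson less_imp_le order_trans)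

lemma openin_near_set:
  "k \<in> carrier G \<Longrightarrow> y \<in> carrier G \<Longrightarrow> 0 < \<epsilon> \<Longrightarrow> openin action_topology (near_set k y \<epsilon>)"
  unfolding action_topology_def by (rule topology_generated_by_Basis) blast

lemma near_set_self: "k \<in> carrier G \<Longrightarrow> w \<in> carrier G \<Longrightarrow> 0 < \<epsilon> \<Longrightarrow> w \<in> near_set k (k \<otimes> w) \<epsilon>"
  unfolding near_set_def using near_refl by auto

lemma topspace_action_topology: "topspace action_topology = carrier G"
proof
  show "topspace action_topology \<subseteq> carrier G"
    unfolding action_topology_def topology_generated_by_topspace near_set_def by auto
  show "carrier G \<subseteq> topspace action_topology"
  proof
    interpret group G by (fact grp)
    fix w assume w: "w \<in> carrier G"
    then show "w \<in> topspace action_topology"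
      using openin_subset[OF openin_near_set[OF one_closed _ zero_less_one]]
        near_set_self[OF one_closed w zero_less_one] by auto
  qed
qed

text \<open>It suffices to compare \<open>f x'\<close> with \<open>f x\<close>, and with a
  non-strict bound: the slack in \<open>near\<close> pays for the triangle inequality that passes to
  an arbitrary centre \<open>y\<close>.\<close>

lemma continuous_map_into_action_topology:
  assumes "f \<in> topspace T \<rightarrow> carrier G"
    and "\<And>x k \<epsilon>. x \<in> topspace T \<Longrightarrow> k \<in> carrier G \<Longrightarrow> 0 < \<epsilon> \<Longrightarrow>
      \<exists>U. openin T U \<and> x \<in> U \<and> (\<forall>x'\<in>U. \<forall>v\<in>V. \<bar>N (act (k \<otimes> f x') v) - N (act (k \<otimes> f x) v)\<bar> \<le> \<epsilon>)"
  shows "continuous_map T action_topology f"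
  unfolding action_topology_def
proof (rule continuous_on_generated_topo)
  show "f ` topspace T \<subseteq> \<Union> {near_set k y \<epsilon> |k y \<epsilon>. k \<in> carrier G \<and> y \<in> carrier G \<and> 0 < \<epsilon>}"
    using assms(1) topspace_action_topology
    unfolding action_topology_def topology_generated_by_topspace by auto
next
  fix B assume "B \<in> {near_set k y \<epsilon> |k y \<epsilon>. k \<in> carrier G \<and> y \<in> carrier G \<and> 0 < \<epsilon>}"
  then obtain k y \<epsilon> where B: "B = near_set k y \<epsilon>" "k \<in> carrier G" "y \<in> carrier G" "0 < \<epsilon>" by blast
  show "openin T (f -` B \<inter> topspace T)"
  proof (subst openin_subopen, intro ballI)
    fix x assume x: "x \<in> f -` B \<inter> topspace T"
    then have "near \<epsilon> (k \<otimes> f x) y" by (auto simp: B near_set_def)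
    then obtain \<eta> where \<eta>: "0 < \<eta>"
      "\<And>v. v \<in> V \<Longrightarrow> \<bar>N (act (k \<otimes> f x) v) - N (act y v)\<bar> \<le> \<epsilon> - 3 * \<eta>"
      by (metis nearE)
    obtain U where U: "openin T U" "x \<in> U"
      "\<And>x' v. x' \<in> U \<Longrightarrow> v \<in> V \<Longrightarrow> \<bar>N (act (k \<otimes> f x') v) - N (act (k \<otimes> f x) v)\<bar> \<le> \<eta>"
      using assms(2)[of x k \<eta>] x \<eta>(1) B by blast
    have "U \<subseteq> f -` B \<inter> topspace T"
    proof
      fix x' assume x': "x' \<in> U"
      have "near \<epsilon> (k \<otimes> f x') y"
        by (rule nearI[OF \<eta>(1)]) (use U(3)[OF x'] \<eta> in fastforce)
      then show "x' \<in> f -` B \<inter> topspace T"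
        using x' openin_subset[OF U(1)] assms(1) by (auto simp: B near_set_def)
    qed
    then show "\<exists>U. openin T U \<and> x \<in> U \<and> U \<subseteq> f -` B \<inter> topspace T" using U by blast
  qed
qed

lemma Hausdorff_group_action_topology:
  assumes sep: "\<And>g h. g \<in> carrier G \<Longrightarrow> h \<in> carrier G \<Longrightarrow> g \<noteq> h \<Longrightarrow>
    \<exists>k\<in>carrier G. \<exists>v\<in>V. N (act (k \<otimes> g) v) \<noteq> N (act (k \<otimes> h) v)"
  shows "Hausdorff_group G action_topology"
  unfolding Hausdorff_group_def
proof (intro conjI grp topspace_action_topology)
  interpret group G by (fact grp)
  show "Hausdorff_space action_topology"
    unfolding Hausdorff_space_def topspace_action_topology
  proof (intro allI impI, elim conjE)
    fix g h assume gh: "g \<in> carrier G" "h \<in> carrier G" "g \<noteq> h"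
    obtain k v where kv: "k \<in> carrier G" "v \<in> V" "N (act (k \<otimes> g) v) \<noteq> N (act (k \<otimes> h) v)"
      using sep[OF gh] by blast
    define \<epsilon> where "\<epsilon> = \<bar>N (act (k \<otimes> g) v) - N (act (k \<otimes> h) v)\<bar> / 3"
    have \<epsilon>: "\<epsilon> > 0" using kv by (simp add: \<epsilon>_def)
    have "disjnt (near_set k (k \<otimes> g) \<epsilon>) (near_set k (k \<otimes> h) \<epsilon>)"
    proof -
      have False if "w \<in> near_set k (k \<otimes> g) \<epsilon>" "w \<in> near_set k (k \<otimes> h) \<epsilon>" for w
      proof -
        have "\<bar>N (act (k \<otimes> w) v) - N (act (k \<otimes> g) v)\<bar> \<le> \<epsilon>"
          "\<bar>N (act (k \<otimes> w) v) - N (act (k \<otimes> h) v)\<bar> \<le> \<epsilon>"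
          using that nearD kv(2) by (auto simp: near_set_def)
        moreover have "3 * \<epsilon> = \<bar>N (act (k \<otimes> g) v) - N (act (k \<otimes> h) v)\<bar>"
          by (simp add: \<epsilon>_def)
        ultimately show False using \<epsilon> by linarith
      qed
      then show ?thesis by (auto simp: disjnt_def)
    qed
    then show "\<exists>U W. openin action_topology U \<and> openin action_topology W \<and> g \<in> U \<and> h \<in> W \<and> disjnt U W"
      using openin_near_set[OF kv(1) _ \<epsilon>] near_set_self[OF kv(1) _ \<epsilon>] gh kv(1) m_closed by meson
  qed
  show "continuous_map (prod_topology action_topology action_topology) action_topology (\<lambda>(x, y). x \<otimes> y)"
  proof (rule continuous_map_into_action_topology)
    fix zw k and \<epsilon> :: real
    assume *: "zw \<in> topspace (prod_topology action_topology action_topology)" "k \<in> carrier G" "0 < \<epsilon>"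
    obtain z w where zw: "zw = (z, w)" "z \<in> carrier G" "w \<in> carrier G"
      using *(1) by (auto simp: topspace_action_topology)
    \<comment> \<open>\<open>z'\<close> is replaced by \<open>z\<close> at the vector
      \<open>act w' v\<close>, where uniformity over \<open>V\<close> makes the unknown
      \<open>w'\<close> harmless; then \<open>w'\<close> is replaced by \<open>w\<close> behind the
      left factor \<open>k \<otimes> z\<close>.\<close>
    define U where "U = near_set k (k \<otimes> z) (\<epsilon>/2) \<times> near_set (k \<otimes> z) (k \<otimes> z \<otimes> w) (\<epsilon>/2)"
    have "openin (prod_topology action_topology action_topology) U"
      unfolding U_def openin_prod_Times_iff using openin_near_set zw * by auto
    moreover have "zw \<in> U"
      unfolding U_def zw using near_set_self zw * by auto
    moreover have "\<bar>N (act (k \<otimes> (z' \<otimes> w')) v) - N (act (k \<otimes> (z \<otimes> w)) v)\<bar> \<le> \<epsilon>"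
      if "(z', w') \<in> U" "v \<in> V" for z' w' v
    proof -
      have c: "z' \<in> carrier G" "w' \<in> carrier G" using that by (auto simp: U_def near_set_def)
      have "\<bar>N (act (k \<otimes> z') (act w' v)) - N (act (k \<otimes> z) (act w' v))\<bar> \<le> \<epsilon>/2"
        using that c act_closed by (intro nearD) (auto simp: U_def near_set_def)
      moreover have "\<bar>N (act (k \<otimes> z \<otimes> w') v) - N (act (k \<otimes> z \<otimes> w) v)\<bar> \<le> \<epsilon>/2"
        using that by (intro nearD) (auto simp: U_def near_set_def)
      moreover have "act (k \<otimes> (z' \<otimes> w')) v = act (k \<otimes> z') (act w' v)"
        "act (k \<otimes> z \<otimes> w') v = act (k \<otimes> z) (act w' v)" "k \<otimes> (z \<otimes> w) = k \<otimes> z \<otimes> w"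
        using c zw * that by (simp_all add: act_mult act_closed m_assoc)
      ultimately show ?thesis by (smt (verit) field_sum_of_halves)
    qed
    ultimately show "\<exists>U. openin (prod_topology action_topology action_topology) U \<and> zw \<in> U \<and>
      (\<forall>x'\<in>U. \<forall>v\<in>V. \<bar>N (act (k \<otimes> (case x' of (x, y) \<Rightarrow> x \<otimes> y)) v) -
          N (act (k \<otimes> (case zw of (x, y) \<Rightarrow> x \<otimes> y)) v)\<bar> \<le> \<epsilon>)"
      by (intro exI[of _ U]) (auto simp: zw)
  qed (auto simp: topspace_action_topology)
  show "continuous_map action_topology action_topology (\<lambda>x. inv x)"
  proof (rule continuous_map_into_action_topology)
    fix z k and \<epsilon> :: real
    assume *: "z \<in> topspace action_topology" "k \<in> carrier G" "0 < \<epsilon>"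
    then have z: "z \<in> carrier G" by (simp add: topspace_action_topology)
    \<comment> \<open>The substitution \<open>v' = act (inv z') v\<close> turns the values at
      \<open>k \<otimes> inv z'\<close> and \<open>k \<otimes> inv z\<close> into those of
      \<open>k \<otimes> inv z \<otimes> z\<close> and \<open>k \<otimes> inv z \<otimes> z'\<close>
      at the single vector \<open>v'\<close>.\<close>
    define U where "U = near_set (k \<otimes> inv z) (k \<otimes> inv z \<otimes> z) \<epsilon>"
    have "\<bar>N (act (k \<otimes> inv z') v) - N (act (k \<otimes> inv z) v)\<bar> \<le> \<epsilon>" if "z' \<in> U" "v \<in> V" for z' v
    proof -
      have c: "z' \<in> carrier G" using that by (auto simp: U_def near_set_def)
      define v' where "v' = act (inv z') v"
      have v': "v' \<in> V" "act z' v' = v"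
        using c that act_mult[of z' "inv z'" v] act_one by (auto simp: v'_def act_closed)
      have "\<bar>N (act (k \<otimes> inv z \<otimes> z') v') - N (act (k \<otimes> inv z \<otimes> z) v')\<bar> \<le> \<epsilon>"
        using that v' by (intro nearD) (auto simp: U_def near_set_def)
      moreover have "act (k \<otimes> inv z \<otimes> z) v' = act (k \<otimes> inv z') v"
        using z * c that by (simp add: m_assoc v'_def act_mult)
      moreover have "act (k \<otimes> inv z \<otimes> z') v' = act (k \<otimes> inv z) v"
        using z * c v' by (simp add: act_mult)
      ultimately show ?thesis by (simp add: abs_minus_commute)
    qed
    then show "\<exists>U. openin action_topology U \<and> z \<in> U \<and>
      (\<forall>x'\<in>U. \<forall>v\<in>V. \<bar>N (act (k \<otimes> inv x') v) - N (act (k \<otimes> inv z) v)\<bar> \<le> \<epsilon>)"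
      using openin_near_set[of "k \<otimes> inv z" "k \<otimes> inv z \<otimes> z" \<epsilon>]
        near_set_self[of "k \<otimes> inv z" z \<epsilon>] z * by (intro exI[of _ U]) (auto simp: U_def)
  qed (auto simp: topspace_action_topology)
qed

end

section \<open>Finitely supported functions and a norm that ignores Lipschitz constants\<close>

definition fin_supp :: "'a set \<Rightarrow> ('a \<Rightarrow> real) set" where
  "fin_supp S = {a. finite {x. a x \<noteq> 0} \<and> {x. a x \<noteq> 0} \<subseteq> S}"

text \<open>The integral of \<open>f\<close> against \<open>a\<close>, read as a finitely supported
  signed measure.\<close>

definition pairing :: "('a \<Rightarrow> real) \<Rightarrow> ('a \<Rightarrow> real) \<Rightarrow> real" where
  "pairing f a = (\<Sum>x | a x \<noteq> 0. a x * f x)"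

text \<open>The image of the measure \<open>a\<close> under \<open>g\<close>; the point mass at
  \<open>x\<close> goes to the point mass at \<open>g x\<close>.\<close>

definition push :: "'a set \<Rightarrow> ('a \<Rightarrow> 'a) \<Rightarrow> ('a \<Rightarrow> real) \<Rightarrow> 'a \<Rightarrow> real" where
  "push S g a = (\<lambda>y. if y \<in> S then a (inv_into S g y) else 0)"

definition point_mass :: "'a \<Rightarrow> 'a \<Rightarrow> real" where
  "point_mass x = (\<lambda>y. if y = x then 1 else 0)"

lemma pairing_superset:
  assumes "finite F" "{x. a x \<noteq> 0} \<subseteq> F"
  shows "pairing f a = (\<Sum>x\<in>F. a x * f x)"
  unfolding pairing_def by (rule sum.mono_neutral_left) (use assms in auto)

lemma fin_supp_add:
  assumes "a \<in> fin_supp S" "b \<in> fin_supp S"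
  shows "(\<lambda>x. a x + b x) \<in> fin_supp S" "pairing f (\<lambda>x. a x + b x) = pairing f a + pairing f b"
proof -
  let ?F = "{x. a x \<noteq> 0} \<union> {x. b x \<noteq> 0}"
  have F: "finite ?F" "?F \<subseteq> S" "{x. a x + b x \<noteq> 0} \<subseteq> ?F"
    using assms by (auto simp: fin_supp_def)
  then show "(\<lambda>x. a x + b x) \<in> fin_supp S"
    unfolding fin_supp_def using finite_subset by blast
  show "pairing f (\<lambda>x. a x + b x) = pairing f a + pairing f b"
    using pairing_superset[OF F(1), of _ f] F(3)
    by (simp add: sum.distrib distrib_right)
qed

lemma fin_supp_scale:
  assumes "a \<in> fin_supp S"
  shows "(\<lambda>x. c * a x) \<in> fin_supp S" "pairing f (\<lambda>x. c * a x) = c * pairing f a"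
proof -
  have F: "finite {x. a x \<noteq> 0}" "{x. c * a x \<noteq> 0} \<subseteq> {x. a x \<noteq> 0}"
    using assms by (auto simp: fin_supp_def)
  then show "(\<lambda>x. c * a x) \<in> fin_supp S"
    using assms unfolding fin_supp_def using finite_subset by blast
  show "pairing f (\<lambda>x. c * a x) = c * pairing f a"
    by (simp add: pairing_superset[OF F] pairing_def sum_distrib_left mult_ac)
qed

lemma fin_supp_diff:
  assumes "a \<in> fin_supp S" "b \<in> fin_supp S"
  shows "(\<lambda>x. a x - b x) \<in> fin_supp S" "pairing f (\<lambda>x. a x - b x) = pairing f a - pairing f b"
  using fin_supp_add[OF assms(1) fin_supp_scale(1)[OF assms(2), of "-1"]]
    fin_supp_scale(2)[OF assms(2), of f "-1"] by auto

lemma fin_supp_zero: "(\<lambda>x. 0) \<in> fin_supp S"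
  by (simp add: fin_supp_def)

lemma fin_supp_point_mass: "x \<in> S \<Longrightarrow> point_mass x \<in> fin_supp S"
  by (auto simp: fin_supp_def point_mass_def)

lemma push_apply: "g \<in> Bij S \<Longrightarrow> x \<in> S \<Longrightarrow> push S g a (g x) = a x"
  unfolding push_def Bij_def bij_betw_def by auto

lemma Bij_surjE:
  assumes "g \<in> Bij S" "y \<in> S"
  obtains x where "x \<in> S" "y = g x"
  using assms unfolding Bij_def bij_betw_def by auto

lemma Bij_in: "g \<in> Bij S \<Longrightarrow> x \<in> S \<Longrightarrow> g x \<in> S"
  unfolding Bij_def bij_betw_def by auto

lemma push_outside: "y \<notin> S \<Longrightarrow> push S g a y = 0"
  by (simp add: push_def)

lemma push_eqI:
  assumes "g \<in> Bij S" "\<And>x. x \<in> S \<Longrightarrow> b (g x) = a x" "\<And>y. y \<notin> S \<Longrightarrow> b y = 0"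
  shows "push S g a = b"
proof
  fix y
  show "push S g a y = b y"
  proof (cases "y \<in> S")
    case True
    then obtain x where "x \<in> S" "y = g x" by (rule Bij_surjE[OF assms(1)])
    then show ?thesis using push_apply[OF assms(1)] assms(2) by simp
  qed (simp add: assms(3) push_outside)
qed

lemma support_push:
  assumes g: "g \<in> Bij S" and a: "a \<in> fin_supp S"
  shows "{x. push S g a x \<noteq> 0} = g ` {x. a x \<noteq> 0}"
proof (intro equalityI subsetI)
  fix y assume y: "y \<in> {x. push S g a x \<noteq> 0}"
  have "y \<in> S" using y push_outside by fastforce
  then obtain x where "x \<in> S" "y = g x" using Bij_surjE[OF g] by blast
  then show "y \<in> g ` {x. a x \<noteq> 0}" using y push_apply[OF g] by auto
qed (use push_apply[OF g, of _ a] a in \<open>auto simp: fin_supp_def\<close>)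

lemma fin_supp_push: "g \<in> Bij S \<Longrightarrow> a \<in> fin_supp S \<Longrightarrow> push S g a \<in> fin_supp S"
  unfolding fin_supp_def using support_push[of g S a] Bij_in[of g S]
  by (auto simp: fin_supp_def)

lemma pairing_push:
  assumes "g \<in> Bij S" "a \<in> fin_supp S"
  shows "pairing f (push S g a) = pairing (f \<circ> g) a"
proof -
  have sub: "{x. a x \<noteq> 0} \<subseteq> S" using assms(2) by (auto simp: fin_supp_def)
  have "inj_on g {x. a x \<noteq> 0}"
    using assms(1) sub unfolding Bij_def bij_betw_def by (auto intro: inj_on_subset)
  then show ?thesis
    unfolding pairing_def support_push[OF assms] using sub push_apply[OF assms(1)]
    by (subst sum.reindex) (auto intro!: sum.cong)
qed

lemma push_add: "push S g (\<lambda>x. a x + b x) = (\<lambda>x. push S g a x + push S g b x)"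
  by (auto simp: push_def)

lemma push_diff: "push S g (\<lambda>x. a x - b x) = (\<lambda>x. push S g a x - push S g b x)"
  by (auto simp: push_def)

lemma push_scale: "push S g (\<lambda>x. c * a x) = (\<lambda>x. c * push S g a x)"
  by (auto simp: push_def)

lemma push_compose:
  assumes "g \<in> Bij S" "h \<in> Bij S"
  shows "push S (compose S g h) a = push S g (push S h a)"
  by (rule push_eqI[OF compose_Bij[OF assms]])
    (use assms Bij_in[OF assms(2)] in \<open>auto simp: compose_def push_apply push_outside\<close>)

lemma push_id: "a \<in> fin_supp S \<Longrightarrow> push S (\<lambda>x\<in>S. x) a = a"
  by (rule push_eqI[OF id_Bij]) (auto simp: fin_supp_def)

lemma push_point_mass:
  assumes "g \<in> Bij S" "x \<in> S"
  shows "push S g (point_mass x) = point_mass (g x)"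
proof (rule push_eqI[OF assms(1)])
  have "inj_on g S" using assms(1) by (auto simp: Bij_def bij_betw_def)
  then show "point_mass (g x) (g y) = point_mass x y" if "y \<in> S" for y
    using that assms(2) by (auto simp: point_mass_def inj_on_def)
  show "point_mass (g x) y = 0" if "y \<notin> S" for y
    using that Bij_in[OF assms] by (auto simp: point_mass_def)
qed

lemma inv_Bij:
  assumes "g \<in> Bij S"
  shows "restrict (inv_into S g) S \<in> Bij S"
    "compose S (restrict (inv_into S g) S) g = (\<lambda>x\<in>S. x)"
    "compose S g (restrict (inv_into S g) S) = (\<lambda>x\<in>S. x)"
  using restrict_inv_into_Bij[OF assms] assms
  by (auto simp: Bij_def compose_inv_into_id)
    (auto simp: compose_def bij_betw_def fun_eq_iff f_inv_into_f)

text \<open>The pseudometric laws are imposed on the whole type, which a metric pulled back along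
  total functions satisfies; separation and the bound concern \<open>S\<close> only.\<close>

locale bounded_metric =
  fixes S :: "'a set" and d :: "'a \<Rightarrow> 'a \<Rightarrow> real" and M :: real
  assumes d_nonneg: "0 \<le> d x y"
    and d_sym: "d x y = d y x"
    and d_triangle: "d x z \<le> d x y + d y z"
    and d_self: "d x x = 0"
    and d_zero: "x \<in> S \<Longrightarrow> y \<in> S \<Longrightarrow> d x y = 0 \<Longrightarrow> x = y"
    and d_bound: "x \<in> S \<Longrightarrow> y \<in> S \<Longrightarrow> d x y \<le> M"
begin

lemma M_nonneg: "x \<in> S \<Longrightarrow> 0 \<le> M"
  using d_bound[of x x] d_self by simp

text \<open>The reciprocal of the modulus of continuity. The summand 2 keeps it above
  \<open>ln 2\<close>. For distance 0 the convention \<open>1 / 0 = 0\<close> yields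
  \<open>ln 2\<close>, which does no harm, as equal points give a zero difference in
  \<open>Lip\<close>.\<close>

definition q :: "'a \<Rightarrow> 'a \<Rightarrow> real" where
  "q x y = ln (2 + 1 / d x y)"

text \<open>The unit ball of test functions. The bound 1 keeps the supremum in \<open>nrm\<close>
  finite also for \<open>a\<close> of nonzero total mass; the modulus makes nearby point masses
  close in norm.\<close>

definition Lip :: "('a \<Rightarrow> real) set" where
  "Lip = {f. (\<forall>x\<in>S. \<bar>f x\<bar> \<le> 1) \<and> (\<forall>x\<in>S. \<forall>y\<in>S. \<bar>f x - f y\<bar> * q x y \<le> 1)}"

definition nrm :: "('a \<Rightarrow> real) \<Rightarrow> real" where
  "nrm a = (SUP f\<in>Lip. \<bar>pairing f a\<bar>)"

definition bilip :: "real \<Rightarrow> ('a \<Rightarrow> 'a) \<Rightarrow> bool" where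
  "bilip C g \<longleftrightarrow> 1 \<le> C \<and> g \<in> Bij S \<and>
     (\<forall>x\<in>S. \<forall>y\<in>S. d (g x) (g y) \<le> C * d x y \<and> d x y \<le> C * d (g x) (g y))"

lemma q_ge: "ln 2 \<le> q x y"
  unfolding q_def using d_nonneg[of x y] by (intro ln_mono) auto

lemma q_pos: "0 < q x y"
  using q_ge[of x y] ln_gt_zero[of 2] by linarith

lemma zero_Lip: "(\<lambda>x. 0) \<in> Lip"
  by (simp add: Lip_def)

lemma pairing_le_nrm:
  assumes "a \<in> fin_supp S" "f \<in> Lip"
  shows "\<bar>pairing f a\<bar> \<le> nrm a"
  unfolding nrm_def
proof (rule cSUP_upper[OF assms(2)], rule bdd_aboveI2)
  fix f assume f: "f \<in> Lip"
  have "\<bar>pairing f a\<bar> \<le> (\<Sum>x | a x \<noteq> 0. \<bar>a x * f x\<bar>)"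
    unfolding pairing_def by (rule sum_abs)
  also have "\<dots> \<le> (\<Sum>x | a x \<noteq> 0. \<bar>a x\<bar> * 1)"
    using assms(1) f unfolding abs_mult
    by (intro sum_mono mult_left_mono) (auto simp: Lip_def fin_supp_def)
  finally show "\<bar>pairing f a\<bar> \<le> (\<Sum>x | a x \<noteq> 0. \<bar>a x\<bar> * 1)" .
qed

lemma nrm_le: "(\<And>f. f \<in> Lip \<Longrightarrow> \<bar>pairing f a\<bar> \<le> B) \<Longrightarrow> nrm a \<le> B"
  unfolding nrm_def using zero_Lip by (intro cSUP_least) auto

lemma nrm_nonneg: "a \<in> fin_supp S \<Longrightarrow> 0 \<le> nrm a"
  using pairing_le_nrm[OF _ zero_Lip] by (meson abs_ge_zero order_trans)

lemma nrm_add: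
  assumes "a \<in> fin_supp S" "b \<in> fin_supp S"
  shows "nrm (\<lambda>x. a x + b x) \<le> nrm a + nrm b"
proof (rule nrm_le)
  fix f assume "f \<in> Lip"
  then show "\<bar>pairing f (\<lambda>x. a x + b x)\<bar> \<le> nrm a + nrm b"
    using fin_supp_add(2)[OF assms, of f] pairing_le_nrm[OF assms(1), of f]
      pairing_le_nrm[OF assms(2), of f] by linarith
qed

lemma nrm_minus_commute:
  assumes "a \<in> fin_supp S" "b \<in> fin_supp S"
  shows "nrm (\<lambda>x. a x - b x) = nrm (\<lambda>x. b x - a x)"
  unfolding nrm_def using fin_supp_diff(2)[OF assms] fin_supp_diff(2)[OF assms(2,1)]
  by (simp add: abs_minus_commute)

text \<open>A point of the support is detected by a small cone function around it that vanishes at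
  all other support points. Being Lipschitz, it satisfies the weaker logarithmic modulus after
  scaling.\<close>

lemma nrm_zero_iff:
  assumes "a \<in> fin_supp S"
  shows "nrm a = 0 \<longleftrightarrow> a = (\<lambda>x. 0)"
proof
  assume "a = (\<lambda>x. 0)"
  then show "nrm a = 0"
    using nrm_nonneg[OF assms] nrm_le[of a 0] by (auto simp: pairing_def)
next
  assume n: "nrm a = 0"
  show "a = (\<lambda>x. 0)"
  proof (rule ccontr)
    assume "a \<noteq> (\<lambda>x. 0)"
    then obtain x where x: "a x \<noteq> 0" by auto
    define F where "F = {y. a y \<noteq> 0}"
    have F: "finite F" "F \<subseteq> S" "x \<in> F" using assms x by (auto simp: F_def fin_supp_def)
    obtain \<eta> where \<eta>: "\<eta> > 0" "\<And>y. y \<in> F - {x} \<Longrightarrow> \<eta> \<le> d y x"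
    proof -
      \<comment> \<open>The element 1 keeps the set nonempty when \<open>x\<close> is the only
        support point.\<close>
      define \<eta> where "\<eta> = Min (insert 1 ((\<lambda>y. d y x) ` (F - {x})))"
      have "\<eta> > 0"
        unfolding \<eta>_def using F d_zero d_nonneg[of _ x]
        by (subst Min_gr_iff) (fastforce simp: order.strict_iff_order)+
      moreover have "\<eta> \<le> d y x" if "y \<in> F - {x}" for y
        using F that by (auto simp: \<eta>_def)
      ultimately show ?thesis using that by blast
    qed
    have M: "0 \<le> M" using M_nonneg F by blast
    \<comment> \<open>This scale meets both conditions of \<open>Lip\<close>: \<kappa> \<eta> \<le>
      1 bounds \<open>f\<close>, and \<kappa> (1 + M) \<le> 1 gives the modulus, because d q \<le> d
      + 1.\<close>
    define \<kappa> where "\<kappa> = 1 / (1 + M + \<eta>)"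
    have \<kappa>: "\<kappa> > 0" using M \<eta> by (simp add: \<kappa>_def)
    define f where "f = (\<lambda>y. \<kappa> * max 0 (\<eta> - d y x))"
    have "f \<in> Lip"
      unfolding Lip_def
    proof (intro CollectI conjI ballI)
      fix y z assume yz: "y \<in> S" "z \<in> S"
      have "\<bar>f y\<bar> \<le> \<kappa> * \<eta>"
        using \<kappa> \<eta>(1) d_nonneg[of y x] by (auto simp: f_def)
      also have "\<dots> \<le> 1" using M \<eta>(1) by (simp add: \<kappa>_def)
      finally show "\<bar>f y\<bar> \<le> 1" .
      show "\<bar>f y - f z\<bar> * q y z \<le> 1"
      proof (cases "y = z")
        case False
        then have dp: "d y z > 0" using d_zero yz d_nonneg[of y z] by (auto simp: order.strict_iff_order)
        have "\<bar>max 0 (\<eta> - d y x) - max 0 (\<eta> - d z x)\<bar> \<le> d y z"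
          using d_triangle[of y x z] d_triangle[of z x y] d_sym[of y z] by linarith
        then have "\<bar>f y - f z\<bar> \<le> \<kappa> * d y z"
          using \<kappa> by (simp add: f_def abs_mult flip: right_diff_distrib)
        moreover have "q y z \<le> 1 + 1 / d y z"
          using ln_le_minus_one[of "2 + 1 / d y z"] dp by (simp add: q_def add_pos_pos)
        ultimately have "\<bar>f y - f z\<bar> * q y z \<le> (\<kappa> * d y z) * (1 + 1 / d y z)"
          using q_pos[of y z] \<kappa> dp by (intro mult_mono) auto
        also have "\<dots> = \<kappa> * (1 + d y z)" using dp by (simp add: field_simps)
        also have "\<dots> \<le> \<kappa> * (1 + M + \<eta>)"
          using d_bound[OF yz] \<kappa> \<eta>(1) by (intro mult_left_mono) auto
        also have "\<dots> = 1" using M \<eta>(1) by (simp add: \<kappa>_def)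
        finally show ?thesis .
      qed simp
    qed
    moreover have "pairing f a = a x * (\<kappa> * \<eta>)"
    proof -
      have "pairing f a = (\<Sum>y\<in>{x}. a y * f y)"
        unfolding pairing_def F_def[symmetric]
        by (rule sum.mono_neutral_right) (use F \<eta>(2) in \<open>force simp: f_def\<close>)+
      then show ?thesis using \<eta>(1) by (simp add: f_def d_self)
    qed
    ultimately show False
      using pairing_le_nrm[OF assms, of f] n x \<kappa> \<eta>(1) by simp
  qed
qed

lemma bilip_inv:
  assumes "bilip C g"
  shows "bilip C (restrict (inv_into S g) S)"
proof -
  have g: "g \<in> Bij S" using assms by (simp add: bilip_def)
  have "d (inv_into S g x) (inv_into S g y) \<le> C * d x y \<and> d x y \<le> C * d (inv_into S g x) (inv_into S g y)"
    if xy: "x \<in> S" "y \<in> S" for x y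
  proof -
    obtain u where u: "u \<in> S" "x = g u" by (rule Bij_surjE[OF g xy(1)])
    obtain v where v: "v \<in> S" "y = g v" by (rule Bij_surjE[OF g xy(2)])
    note uv = u v
    then have "inv_into S g x = u" "inv_into S g y = v"
      using g by (auto simp: Bij_def bij_betw_def)
    then show ?thesis using assms uv by (simp add: bilip_def)
  qed
  then show ?thesis using assms inv_Bij(1)[OF g] by (simp add: bilip_def)
qed

lemma bilip_compose:
  assumes "bilip C g" "bilip D h"
  shows "bilip (C * D) (compose S g h)"
  unfolding bilip_def
proof (intro conjI ballI)
  have gh: "g \<in> Bij S" "h \<in> Bij S" "1 \<le> C" "1 \<le> D" using assms by (auto simp: bilip_def)
  show "1 \<le> C * D" using mult_mono[of 1 C 1 D] gh by simp
  show "compose S g h \<in> Bij S" by (rule compose_Bij[OF gh(1,2)])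
  fix x y assume xy: "x \<in> S" "y \<in> S"
  have h: "h x \<in> S" "h y \<in> S" using Bij_in[OF gh(2)] xy by auto
  have "d (g (h x)) (g (h y)) \<le> C * d (h x) (h y)" using assms(1) h by (simp add: bilip_def)
  also have "\<dots> \<le> C * (D * d x y)"
    using assms(2) xy gh by (intro mult_left_mono) (auto simp: bilip_def)
  finally show "d (compose S g h x) (compose S g h y) \<le> C * D * d x y"
    using xy by (simp add: compose_def mult.assoc)
  have "d x y \<le> D * d (h x) (h y)" using assms(2) xy by (simp add: bilip_def)
  also have "\<dots> \<le> D * (C * d (g (h x)) (g (h y)))"
    using assms(1) h gh by (intro mult_left_mono) (auto simp: bilip_def)
  finally show "d x y \<le> C * D * d (compose S g h x) (compose S g h y)"
    using xy by (simp add: compose_def mult_ac)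
qed

lemma bilip_id: "bilip 1 (\<lambda>x\<in>S. x)"
  using id_Bij by (auto simp: bilip_def)

text \<open>The logarithm in \<^term>\<open>q\<close> turns a Lipschitz constant into an additive error, which is negligible
  where \<^term>\<open>q\<close> is large, that is for close points; for other points it is uniform closeness to
  the identity that matters.\<close>

lemma q_distortion:
  assumes "1 \<le> C" "0 < \<epsilon>"
  obtains \<sigma> where "0 < \<sigma>" "\<And>x y x' y'. \<lbrakk>0 < d x y; 0 < d x' y'; d x' y' \<le> C * d x y;
     d x x' < \<sigma>; d y y' < \<sigma>\<rbrakk> \<Longrightarrow> q x y \<le> (1 + \<epsilon>) * q x' y'"
proof -
  have mono: "q x y \<le> ln K + q x' y'" if "0 < d x y" "0 < d x' y'" "d x' y' \<le> K * d x y" "1 \<le> K"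
    for x y x' y' K
  proof -
    have "1 / d x y \<le> K * (1 / d x' y')"
      using that by (simp add: field_simps)
    then have "2 + 1 / d x y \<le> K * (2 + 1 / d x' y')"
      using that by (simp add: algebra_simps)
    then have "q x y \<le> ln (K * (2 + 1 / d x' y'))"
      unfolding q_def using that by (intro ln_mono) (auto simp: add_pos_pos)
    also have "\<dots> = ln K + q x' y'"
      unfolding q_def using that add_pos_pos[of 2 "1 / d x' y'"] by (subst ln_mult) auto
    finally show ?thesis .
  qed
  \<comment> \<open>A distortion by the factor \<open>K\<close> costs \<epsilon> ln 2, which is at
    most \<epsilon> times any value of \<open>q\<close>.\<close>
  define K where "K = exp (\<epsilon> * ln 2)"
  have K: "K > 1" "ln K = \<epsilon> * ln 2" using assms by (auto simp: K_def)
  \<comment> \<open>The threshold below which \<open>q x' y'\<close> exceeds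
    \<open>ln C / \<epsilon>\<close>, so that the additive error \<open>ln C\<close> is at most an
    \<epsilon>-fraction of it.\<close>
  define \<eta> where "\<eta> = exp (- (ln C / \<epsilon>))"
  have \<eta>: "\<eta> > 0" by (simp add: \<eta>_def)
  \<comment> \<open>Moving both endpoints by less than \<sigma> changes a distance above \<eta> by
    at most the fraction 1 - 1/K of it, hence distorts it by at most the factor
    \<open>K\<close>.\<close>
  define \<sigma> where "\<sigma> = (1 - 1 / K) * \<eta> / 2"
  have \<sigma>: "\<sigma> > 0" using K \<eta> by (simp add: \<sigma>_def)
  show ?thesis
  proof (rule that[OF \<sigma>])
    fix x y x' y'
    assume *: "0 < d x y" "0 < d x' y'" "d x' y' \<le> C * d x y" "d x x' < \<sigma>" "d y y' < \<sigma>"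
    show "q x y \<le> (1 + \<epsilon>) * q x' y'"
    proof (cases "d x' y' \<le> \<eta>")
      case True
      have "ln C / \<epsilon> = ln (1 / \<eta>)" by (simp add: \<eta>_def ln_div)
      also have "\<dots> \<le> q x' y'"
        unfolding q_def using True *(2) \<eta>
        by (intro ln_mono) (auto simp: add_pos_pos intro!: add_increasing divide_left_mono)
      finally have "ln C \<le> \<epsilon> * q x' y'" using assms by (simp add: field_simps)
      then show ?thesis using mono[OF *(1-3) assms(1)] by (simp add: algebra_simps)
    next
      case False
      have "d x' y' \<le> d x y + 2 * \<sigma>"
        using d_triangle[of x' y' x] d_triangle[of x y' y] *(4,5) d_sym[of x x'] by linarith
      also have "2 * \<sigma> \<le> (1 - 1 / K) * d x' y'"
        using False K(1) unfolding \<sigma>_def by (simp add: mult_left_mono)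
      finally have "d x' y' \<le> K * d x y"
        using K(1) by (simp add: field_simps)
      from mono[OF *(1,2) this] K have "q x y \<le> \<epsilon> * ln 2 + q x' y'" by simp
      also have "\<epsilon> * ln 2 \<le> \<epsilon> * q x' y'" using q_ge assms(2) by simp
      finally show ?thesis by (simp add: algebra_simps)
    qed
  qed
qed

text \<open>By duality: pulling a test function back along \<open>u\<close> and dividing by 1 +
  \<epsilon> gives a test function again.\<close>

lemma nrm_push_le:
  assumes "0 < \<epsilon>" "u \<in> Bij S" "a \<in> fin_supp S"
    and "\<And>x y. x \<in> S \<Longrightarrow> y \<in> S \<Longrightarrow> x \<noteq> y \<Longrightarrow> q x y \<le> (1 + \<epsilon>) * q (u x) (u y)"
  shows "nrm (push S u a) \<le> (1 + \<epsilon>) * nrm a"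
proof (rule nrm_le)
  fix f assume f: "f \<in> Lip"
  define h where "h = (\<lambda>x. f (u x) / (1 + \<epsilon>))"
  have "h \<in> Lip"
    unfolding Lip_def
  proof (intro CollectI conjI ballI)
    fix x y assume xy: "x \<in> S" "y \<in> S"
    have u: "u x \<in> S" "u y \<in> S" using Bij_in[OF assms(2)] xy by auto
    show "\<bar>h x\<bar> \<le> 1"
      using f u assms(1) by (auto simp: Lip_def h_def field_simps intro: order_trans)
    show "\<bar>h x - h y\<bar> * q x y \<le> 1"
    proof (cases "x = y")
      case False
      have "\<bar>h x - h y\<bar> * q x y \<le> \<bar>h x - h y\<bar> * ((1 + \<epsilon>) * q (u x) (u y))"
        by (intro mult_left_mono assms(4) xy False) auto
      also have "\<dots> = \<bar>f (u x) - f (u y)\<bar> * q (u x) (u y)"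
        using assms(1) by (simp add: h_def abs_divide flip: diff_divide_distrib)
      also have "\<dots> \<le> 1" using f u by (simp add: Lip_def)
      finally show ?thesis .
    qed simp
  qed
  then have "\<bar>pairing h a\<bar> \<le> nrm a" by (rule pairing_le_nrm[OF assms(3)])
  moreover have "pairing f (push S u a) = (1 + \<epsilon>) * pairing h a"
    unfolding pairing_push[OF assms(2,3)]
    using assms(1) by (simp add: pairing_def h_def sum_distrib_left)
  ultimately show "\<bar>pairing f (push S u a)\<bar> \<le> (1 + \<epsilon>) * nrm a"
    using assms(1) by (simp add: abs_mult)
qed

text \<open>The order of quantifiers matters: \<sigma> depends on \<open>C\<close>, \<epsilon> and
  \<open>c\<close> but not on \<open>u\<close>, and the two-sided distortion bound holds for all
  \<open>a\<close> at once, whereas the small displacement is claimed for the one vector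
  \<open>c\<close>. The lower bound applies the distortion estimate to the inverse of
  \<open>u\<close>.\<close>

lemma nrm_push_close:
  assumes C: "1 \<le> C" and \<epsilon>: "0 < \<epsilon>" and c: "c \<in> fin_supp S"
  shows "\<exists>\<sigma>>0. \<forall>u. bilip C u \<longrightarrow> (\<forall>x\<in>S. d (u x) x < \<sigma>) \<longrightarrow>
     nrm (\<lambda>x. c x - push S u c x) \<le> \<epsilon> \<and>
     (\<forall>a\<in>fin_supp S. nrm (push S u a) \<le> (1 + \<epsilon>) * nrm a \<and> nrm a \<le> (1 + \<epsilon>) * nrm (push S u a))"
proof -
  obtain \<sigma>1 where \<sigma>1: "0 < \<sigma>1" "\<And>x y x' y'. \<lbrakk>0 < d x y; 0 < d x' y'; d x' y' \<le> C * d x y;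
     d x x' < \<sigma>1; d y y' < \<sigma>1\<rbrakk> \<Longrightarrow> q x y \<le> (1 + \<epsilon>) * q x' y'"
    using q_distortion[OF C \<epsilon>] by metis
  define W where "W = (\<Sum>x | c x \<noteq> 0. \<bar>c x\<bar>)"
  have W: "W \<ge> 0" by (simp add: W_def sum_nonneg)
  \<comment> \<open>A displacement below this value has \<open>q\<close> at least (W + 1) /
    \<epsilon>, so a test function changes by at most \<epsilon> / (W + 1) at each of the points
    carrying the total mass \<open>W\<close>; the 1 avoids division by zero.\<close>
  define \<sigma>2 where "\<sigma>2 = exp (- ((W + 1) / \<epsilon>))"
  have \<sigma>2: "\<sigma>2 > 0" by (simp add: \<sigma>2_def)
  show ?thesis
  proof (intro exI[of _ "min \<sigma>1 \<sigma>2"] conjI[of "0 < min \<sigma>1 \<sigma>2"] allI impI)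
    show "0 < min \<sigma>1 \<sigma>2" using \<sigma>1 \<sigma>2 by simp
    fix u assume u: "bilip C u" and cl: "\<forall>x\<in>S. d (u x) x < min \<sigma>1 \<sigma>2"
    have close: "d (u x) x < min \<sigma>1 \<sigma>2" if "x \<in> S" for x using cl that by blast
    have uB: "u \<in> Bij S" using u by (simp add: bilip_def)
    have pos: "0 < d x y" "0 < d (u x) (u y)" if "x \<in> S" "y \<in> S" "x \<noteq> y" for x y
    proof -
      show *: "0 < d x y" using that d_zero d_nonneg[of x y] by (auto simp: order.strict_iff_order)
      have "d x y \<le> C * d (u x) (u y)" using u that by (simp add: bilip_def)
      then show "0 < d (u x) (u y)"
        using * C d_nonneg[of "u x" "u y"] by (cases "d (u x) (u y) = 0") auto
    qed
    have q1: "q x y \<le> (1 + \<epsilon>) * q (u x) (u y)" "q (u x) (u y) \<le> (1 + \<epsilon>) * q x y"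
      if "x \<in> S" "y \<in> S" "x \<noteq> y" for x y
      using pos[OF that] close[of x] close[of y] u that
      by (auto intro!: \<sigma>1(2) simp: bilip_def d_sym)
    let ?v = "restrict (inv_into S u) S"
    have v: "?v \<in> Bij S" by (rule inv_Bij[OF uB])
    have qv: "q x y \<le> (1 + \<epsilon>) * q (?v x) (?v y)" if xyS: "x \<in> S" "y \<in> S" "x \<noteq> y" for x y
    proof -
      obtain x' where x': "x' \<in> S" "x = u x'" by (rule Bij_surjE[OF uB xyS(1)])
      obtain y' where y': "y' \<in> S" "y = u y'" by (rule Bij_surjE[OF uB xyS(2)])
      note xy = x' y'
      then have "?v x = x'" "?v y = y'" using uB by (auto simp: Bij_def bij_betw_def)
      then show ?thesis using q1(2)[of x' y'] xy xyS by auto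
    qed
    have n: "nrm (push S u a) \<le> (1 + \<epsilon>) * nrm a \<and> nrm a \<le> (1 + \<epsilon>) * nrm (push S u a)"
      if a: "a \<in> fin_supp S" for a
    proof
      show "nrm (push S u a) \<le> (1 + \<epsilon>) * nrm a"
        by (rule nrm_push_le[OF \<epsilon> uB a q1(1)])
      have eq: "push S ?v (push S u a) = a"
        using push_compose[OF v uB, of a] inv_Bij(2)[OF uB] push_id[OF a] by simp
      have "nrm (push S ?v (push S u a)) \<le> (1 + \<epsilon>) * nrm (push S u a)"
        by (rule nrm_push_le[OF \<epsilon> v fin_supp_push[OF uB a] qv])
      then show "nrm a \<le> (1 + \<epsilon>) * nrm (push S u a)"
        unfolding eq .
    qed
    have "nrm (\<lambda>x. c x - push S u c x) \<le> \<epsilon>"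
    proof (rule nrm_le)
      fix f assume f: "f \<in> Lip"
      have "pairing f (\<lambda>x. c x - push S u c x) = (\<Sum>x | c x \<noteq> 0. c x * (f x - f (u x)))"
        unfolding fin_supp_diff(2)[OF c fin_supp_push[OF uB c]] pairing_push[OF uB c]
        by (simp add: pairing_def sum_subtractf right_diff_distrib)
      also have "\<bar>\<dots>\<bar> \<le> (\<Sum>x | c x \<noteq> 0. \<bar>c x * (f x - f (u x))\<bar>)" by (rule sum_abs)
      also have "\<dots> \<le> (\<Sum>x | c x \<noteq> 0. \<bar>c x\<bar> * (\<epsilon> / (W + 1)))"
      proof (rule sum_mono)
        fix x assume x: "x \<in> {x. c x \<noteq> 0}"
        then have xS: "x \<in> S" "u x \<in> S" using c Bij_in[OF uB] by (auto simp: fin_supp_def)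
        have "\<bar>f x - f (u x)\<bar> \<le> \<epsilon> / (W + 1)"
        proof (cases "u x = x")
          case True
          then show ?thesis using \<epsilon> W by simp
        next
          case False
          then have dp: "0 < d x (u x)" using d_zero[of x "u x"] xS d_nonneg[of x "u x"]
            by (auto simp: order.strict_iff_order)
          have "exp ((W + 1) / \<epsilon>) = 1 / \<sigma>2" by (simp add: \<sigma>2_def exp_minus field_simps)
          also have "\<dots> \<le> 1 / d x (u x)"
            using close[OF xS(1)] dp by (intro divide_left_mono) (auto simp: d_sym)
          finally have "exp ((W + 1) / \<epsilon>) \<le> 2 + 1 / d x (u x)" by simp
          then have "ln (exp ((W + 1) / \<epsilon>)) \<le> q x (u x)"
            unfolding q_def by (intro ln_mono) (auto intro: add_pos_pos dp)
          then have "\<bar>f x - f (u x)\<bar> * ((W + 1) / \<epsilon>) \<le> \<bar>f x - f (u x)\<bar> * q x (u x)"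
            by (intro mult_left_mono) auto
          also have "\<dots> \<le> 1" using f xS by (simp add: Lip_def)
          finally show ?thesis using \<epsilon> W by (simp add: field_simps)
        qed
        then show "\<bar>c x * (f x - f (u x))\<bar> \<le> \<bar>c x\<bar> * (\<epsilon> / (W + 1))"
          unfolding abs_mult by (rule mult_left_mono) simp
      qed
      also have "\<dots> = W * (\<epsilon> / (W + 1))" by (simp only: sum_distrib_right[symmetric] W_def[symmetric])
      also have "\<dots> \<le> \<epsilon>" using W \<epsilon> by (simp add: field_simps)
      finally show "\<bar>pairing f (\<lambda>x. c x - push S u c x)\<bar> \<le> \<epsilon>" .
    qed
    then show "nrm (\<lambda>x. c x - push S u c x) \<le> \<epsilon> \<and>
      (\<forall>a\<in>fin_supp S. nrm (push S u a) \<le> (1 + \<epsilon>) * nrm a \<and> nrm a \<le> (1 + \<epsilon>) * nrm (push S u a))"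
      using n by blast
  qed
qed

end

section \<open>The group of affine maps and the cocycle of a point\<close>

context bounded_metric
begin

lemma nrm_uminus: "a \<in> fin_supp S \<Longrightarrow> nrm (\<lambda>x. - a x) = nrm a"
  using nrm_minus_commute[OF fin_supp_zero, of a] by simp

definition aff :: "('a \<Rightarrow> 'a) \<times> ('a \<Rightarrow> real) \<Rightarrow> ('a \<Rightarrow> real) \<Rightarrow> 'a \<Rightarrow> real" where
  "aff z v = (\<lambda>x. snd z x + push S (fst z) v x)"

text \<open>The pair \<open>(g, a)\<close> stands for the affine map sending \<open>v\<close> to
  \<open>a\<close> plus the push-forward of \<open>v\<close>; the product is composition of these
  maps, so its second component is the image of \<open>snd w\<close> under \<open>z\<close>.\<close>

definition affine_group :: "(('a \<Rightarrow> 'a) \<times> ('a \<Rightarrow> real)) monoid" where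
  "affine_group = \<lparr>carrier = {g. \<exists>C. bilip C g} \<times> fin_supp S,
     mult = (\<lambda>z w. (compose S (fst z) (fst w), aff z (snd w))), one = (\<lambda>x\<in>S. x, \<lambda>x. 0)\<rparr>"

definition log_nrm :: "('a \<Rightarrow> real) \<Rightarrow> real" where
  "log_nrm v = ln (1 + nrm v)"

lemma bilip_Bij: "bilip C g \<Longrightarrow> g \<in> Bij S"
  by (simp add: bilip_def)

lemma aff_closed: "g \<in> Bij S \<Longrightarrow> a \<in> fin_supp S \<Longrightarrow> v \<in> fin_supp S \<Longrightarrow> aff (g, a) v \<in> fin_supp S"
  unfolding aff_def by (simp add: fin_supp_add fin_supp_push)

lemma aff_aff:
  assumes "g \<in> Bij S" "h \<in> Bij S"
  shows "aff (compose S g h, aff (g, a) b) v = aff (g, a) (aff (h, b) v)"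
  unfolding aff_def by (simp add: push_add push_compose[OF assms] add.assoc)

lemma push_zero: "push S g (\<lambda>x. 0) = (\<lambda>x. 0)"
  by (auto simp: push_def)

lemma compose_assoc_Bij:
  "h \<in> Bij S \<Longrightarrow> k \<in> Bij S \<Longrightarrow> compose S (compose S g h) k = compose S g (compose S h k)"
  using Bij_in[of k S] by (auto simp: compose_def fun_eq_iff)

lemma compose_id_Bij: "g \<in> Bij S \<Longrightarrow> compose S (\<lambda>x\<in>S. x) g = g"
  using Bij_in[of g S] by (auto simp: compose_def Bij_def extensional_def fun_eq_iff)

lemma group_affine_group: "group affine_group"
proof (rule groupI)
  fix z w assume "z \<in> carrier affine_group" "w \<in> carrier affine_group"
  then show "z \<otimes>\<^bsub>affine_group\<^esub> w \<in> carrier affine_group"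
    using bilip_compose by (auto simp: affine_group_def intro: aff_closed bilip_Bij) blast
next
  show "\<one>\<^bsub>affine_group\<^esub> \<in> carrier affine_group"
    using bilip_id fin_supp_zero by (auto simp: affine_group_def)
next
  fix x y z assume "x \<in> carrier affine_group" "y \<in> carrier affine_group" "z \<in> carrier affine_group"
  then show "x \<otimes>\<^bsub>affine_group\<^esub> y \<otimes>\<^bsub>affine_group\<^esub> z = x \<otimes>\<^bsub>affine_group\<^esub> (y \<otimes>\<^bsub>affine_group\<^esub> z)"
    by (auto simp: affine_group_def compose_assoc_Bij bilip_Bij aff_aff)
next
  fix z assume "z \<in> carrier affine_group"
  then show "\<one>\<^bsub>affine_group\<^esub> \<otimes>\<^bsub>affine_group\<^esub> z = z"
    by (auto simp: affine_group_def compose_id_Bij bilip_Bij aff_def push_id)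
next
  fix z assume "z \<in> carrier affine_group"
  then obtain g a C where z: "z = (g, a)" "bilip C g" "a \<in> fin_supp S"
    by (auto simp: affine_group_def)
  let ?h = "restrict (inv_into S g) S"
  have h: "bilip C ?h" by (rule bilip_inv[OF z(2)])
  have hB: "?h \<in> Bij S" using h by (rule bilip_Bij)
  let ?b = "\<lambda>x. - 1 * push S ?h a x"
  have "(?h, ?b) \<in> carrier affine_group"
    using h fin_supp_scale(1)[OF fin_supp_push[OF hB z(3)], of "-1"]
    by (auto simp: affine_group_def)
  moreover have "(?h, ?b) \<otimes>\<^bsub>affine_group\<^esub> z = \<one>\<^bsub>affine_group\<^esub>"
    using inv_Bij(2)[OF bilip_Bij[OF z(2)]] by (simp add: affine_group_def z aff_def)
  ultimately show "\<exists>y\<in>carrier affine_group. y \<otimes>\<^bsub>affine_group\<^esub> z = \<one>\<^bsub>affine_group\<^esub>" by blast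
qed

sublocale action: function_on_action affine_group "fin_supp S" aff log_nrm
proof (rule function_on_action.intro[OF group_affine_group])
  fix z w v assume "z \<in> carrier affine_group" "w \<in> carrier affine_group" "v \<in> fin_supp S"
  then show "aff (z \<otimes>\<^bsub>affine_group\<^esub> w) v = aff z (aff w v)"
    by (auto simp: affine_group_def aff_aff bilip_Bij)
next
  fix z v assume "z \<in> carrier affine_group" "v \<in> fin_supp S"
  then show "aff z v \<in> fin_supp S"
    by (auto simp: affine_group_def intro: aff_closed bilip_Bij)
next
  fix v assume "v \<in> fin_supp S"
  then show "aff \<one>\<^bsub>affine_group\<^esub> v = v"
    by (simp add: affine_group_def aff_def push_id)
qed

text \<open>The value at 0 is the translation part, and point masses then reveal the bijection on
  \<open>S\<close>; outside \<open>S\<close> elements of \<open>Bij S\<close> agree by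
  extensionality.\<close>

lemma aff_faithful:
  assumes "z \<in> carrier affine_group" "w \<in> carrier affine_group" "\<And>v. v \<in> fin_supp S \<Longrightarrow> aff z v = aff w v"
  shows "z = w"
proof -
  obtain g a h b where zw: "z = (g, a)" "w = (h, b)" "g \<in> Bij S" "h \<in> Bij S"
    using assms(1,2) bilip_Bij by (force simp: affine_group_def)
  have ab: "a = b"
    using assms(3)[OF fin_supp_zero] by (simp add: aff_def zw push_zero)
  have "g x = h x" if "x \<in> S" for x
  proof -
    have "push S g (point_mass x) = push S h (point_mass x)"
      using assms(3)[OF fin_supp_point_mass[OF that]] by (simp add: aff_def zw ab fun_eq_iff)
    then have "point_mass (g x) (g x) = point_mass (h x) (g x)"
      using zw that by (simp add: push_point_mass)
    then show ?thesis by (simp add: point_mass_def split: if_splits)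
  qed
  then have "g = h"
    using zw by (intro extensionalityI[of g S h]) (auto simp: Bij_def)
  then show ?thesis by (simp add: zw ab)
qed

text \<open>If \<open>z\<close> and \<open>w\<close> differ at \<open>v\<close>, the translation
  \<open>k\<close> by the negative of \<open>aff z v\<close> brings one image to 0 and leaves the
  other nonzero. Without it the two images might have equal norm.\<close>

lemma Hausdorff_group_affine_group: "Hausdorff_group affine_group action.action_topology"
proof (rule action.Hausdorff_group_action_topology)
  fix z w assume zw: "z \<in> carrier affine_group" "w \<in> carrier affine_group" "z \<noteq> w"
  then obtain v where v: "v \<in> fin_supp S" "aff z v \<noteq> aff w v" using aff_faithful by blast
  define k where "k = ((\<lambda>x\<in>S. x), \<lambda>x. - 1 * aff z v x)"
  have fz: "aff z v \<in> fin_supp S" and fw: "aff w v \<in> fin_supp S"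
    using action.act_closed zw v by auto
  have k: "k \<in> carrier affine_group"
    using bilip_id fin_supp_scale(1)[OF fz, of "-1"] by (auto simp: k_def affine_group_def)
  have kz: "aff (k \<otimes>\<^bsub>affine_group\<^esub> z) v = (\<lambda>x. 0)"
    using action.act_mult[OF k zw(1) v(1)] push_id[OF fz] by (simp add: k_def aff_def[of "(_, _)"])
  have kw: "aff (k \<otimes>\<^bsub>affine_group\<^esub> w) v = (\<lambda>x. aff w v x - aff z v x)"
    using action.act_mult[OF k zw(2) v(1)] push_id[OF fw] by (simp add: k_def aff_def[of "(_, _)"])
  have "nrm (\<lambda>x. aff w v x - aff z v x) \<noteq> 0"
    using nrm_zero_iff[OF fin_supp_diff(1)[OF fw fz]] v(2) by (auto simp: fun_eq_iff)
  then have "nrm (\<lambda>x. aff w v x - aff z v x) > 0"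
    using nrm_nonneg[OF fin_supp_diff(1)[OF fw fz]] by linarith
  moreover have "nrm (\<lambda>x. 0) = 0" using nrm_zero_iff[OF fin_supp_zero] by simp
  ultimately have "log_nrm (aff (k \<otimes>\<^bsub>affine_group\<^esub> z) v) \<noteq> log_nrm (aff (k \<otimes>\<^bsub>affine_group\<^esub> w) v)"
    unfolding kz kw log_nrm_def by simp
  then show "\<exists>k\<in>carrier affine_group. \<exists>v\<in>fin_supp S.
      log_nrm (aff (k \<otimes>\<^bsub>affine_group\<^esub> z) v) \<noteq> log_nrm (aff (k \<otimes>\<^bsub>affine_group\<^esub> w) v)"
    using k v(1) by blast
qed

text \<open>Adding 1 to the norms converts the additive error \<epsilon> into another factor 1 +
  \<epsilon>, and ln (1 + \<epsilon>) \<le> \<epsilon>. The upper estimate needs one such factor;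
  the lower one passes through \<open>y\<close> and needs two, whence
  \<open>2 * \<epsilon>\<close>.\<close>

lemma log_nrm_close:
  assumes "0 < \<epsilon>" "x \<in> fin_supp S" "y \<in> fin_supp S" "e \<in> fin_supp S"
    and "nrm e \<le> \<epsilon>" "nrm y \<le> (1 + \<epsilon>) * nrm x" "nrm x \<le> (1 + \<epsilon>) * nrm y"
  shows "\<bar>log_nrm (\<lambda>s. y s + e s) - log_nrm x\<bar> \<le> 2 * \<epsilon>"
proof -
  define X Y Z where "X = nrm x" and "Y = nrm y" and "Z = nrm (\<lambda>s. y s + e s)"
  have ye: "(\<lambda>s. y s + e s) \<in> fin_supp S" by (rule fin_supp_add(1)[OF assms(3,4)])
  have nn: "X \<ge> 0" "Y \<ge> 0" "Z \<ge> 0"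
    unfolding X_def Y_def Z_def using assms ye by (auto intro: nrm_nonneg)
  have "Z \<le> Y + \<epsilon>" using nrm_add[OF assms(3,4)] assms(5) by (simp add: Z_def Y_def)
  moreover have "Y \<le> Z + \<epsilon>"
    using nrm_add[OF ye fin_supp_scale(1)[OF assms(4), of "-1"]] nrm_uminus[OF assms(4)] assms(5)
    by (simp add: Z_def Y_def)
  ultimately have 1: "1 + Z \<le> (1 + \<epsilon>) * (1 + X)" "1 + X \<le> (1 + \<epsilon>) * (1 + Y)" "1 + Y \<le> (1 + \<epsilon>) * (1 + Z)"
    using assms(1,6,7) nn by (auto simp: X_def[symmetric] Y_def[symmetric] algebra_simps)
      (smt (verit) mult_nonneg_nonneg)+
  have ln: "ln (1 + a) \<le> \<epsilon> + ln (1 + b)" if "1 + a \<le> (1 + \<epsilon>) * (1 + b)" "a \<ge> 0" "b \<ge> 0" for a b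
  proof -
    have "ln (1 + a) \<le> ln ((1 + \<epsilon>) * (1 + b))" using that assms(1) by (intro ln_mono) auto
    also have "\<dots> = ln (1 + \<epsilon>) + ln (1 + b)" using that assms(1) by (subst ln_mult) auto
    also have "\<dots> \<le> \<epsilon> + ln (1 + b)" using ln_add_one_self_le_self[of \<epsilon>] assms(1) by simp
    finally show ?thesis .
  qed
  show ?thesis
    using ln[OF 1(1)] ln[OF 1(2)] ln[OF 1(3)] nn assms(1)
    unfolding log_nrm_def X_def[symmetric] Z_def[symmetric] by linarith
qed

text \<open>The scalar \<open>t\<close> lets one continuity proof serve both homomorphisms:
  \<open>t = 0\<close> is the plain embedding, \<open>t = 1\<close> the twisted one.\<close>

definition cocycle :: "'a \<Rightarrow> real \<Rightarrow> ('a \<Rightarrow> 'a) \<Rightarrow> 'a \<Rightarrow> real" where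
  "cocycle p t g = (\<lambda>x. t * (point_mass (g p) x - point_mass p x))"

lemma cocycle_fin_supp: "p \<in> S \<Longrightarrow> g \<in> Bij S \<Longrightarrow> cocycle p t g \<in> fin_supp S"
  unfolding cocycle_def
  by (intro fin_supp_scale(1) fin_supp_diff(1) fin_supp_point_mass) (auto intro: Bij_in)

lemma push_cocycle:
  "p \<in> S \<Longrightarrow> h \<in> Bij S \<Longrightarrow> g \<in> Bij S \<Longrightarrow>
    push S h (cocycle p t g) = (\<lambda>x. t * (point_mass (h (g p)) x - point_mass (h p) x))"
  unfolding cocycle_def by (simp add: push_scale push_diff push_point_mass Bij_in)

text \<open>The sum telescopes: pushing the cocycle of \<open>h\<close> by \<open>g\<close>
  contributes the point masses at \<open>g (h p)\<close> and, negatively, at \<open>g p\<close>, and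
  the latter cancels against the cocycle of \<open>g\<close>.\<close>

lemma cocycle_mult:
  assumes "p \<in> S" "bilip C g" "bilip D h"
  shows "(g, cocycle p t g) \<otimes>\<^bsub>affine_group\<^esub> (h, cocycle p t h) =
    (compose S g h, cocycle p t (compose S g h))"
  using assms(1) push_cocycle[OF assms(1) bilip_Bij[OF assms(2)] bilip_Bij[OF assms(3)], of t]
  by (auto simp: affine_group_def aff_def cocycle_def compose_def fun_eq_iff algebra_simps)

text \<open>Only two features of the topology enter: a locally uniform bi-Lipschitz constant, and
  uniform closeness of neighbouring maps.\<close>

lemma continuous_map_cocycle:
  assumes p: "p \<in> S"
    and lip: "\<And>g0. g0 \<in> topspace T \<Longrightarrow> \<exists>U C. openin T U \<and> g0 \<in> U \<and> (\<forall>g\<in>U. bilip C g)"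
    and close: "\<And>g0 \<epsilon>. g0 \<in> topspace T \<Longrightarrow> 0 < \<epsilon> \<Longrightarrow>
      \<exists>U. openin T U \<and> g0 \<in> U \<and> (\<forall>g\<in>U. \<forall>x\<in>S. d (g x) (g0 x) < \<epsilon>)"
  shows "continuous_map T action.action_topology (\<lambda>g. (g, cocycle p t g))"
proof (rule action.continuous_map_into_action_topology)
  show "(\<lambda>g. (g, cocycle p t g)) \<in> topspace T \<rightarrow> carrier affine_group"
  proof
    fix g assume "g \<in> topspace T"
    then obtain C where "bilip C g" using lip by blast
    then show "(g, cocycle p t g) \<in> carrier affine_group"
      using cocycle_fin_supp[OF p bilip_Bij] by (auto simp: affine_group_def)
  qed
next
  fix g0 k and \<epsilon> :: real
  assume g0: "g0 \<in> topspace T" and k: "k \<in> carrier affine_group" and \<epsilon>: "0 < \<epsilon>"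
  obtain h c D where hc: "k = (h, c)" "bilip D h" "c \<in> fin_supp S"
    using k by (auto simp: affine_group_def)
  obtain U1 C where U1: "openin T U1" "g0 \<in> U1" "\<And>g. g \<in> U1 \<Longrightarrow> bilip C g"
    using lip[OF g0] by blast
  have hB: "h \<in> Bij S" and g0B: "g0 \<in> Bij S" using bilip_Bij hc U1 by auto
  have D: "D \<ge> 1" and C: "C \<ge> 1" using hc U1 by (auto simp: bilip_def)
  let ?g0' = "restrict (inv_into S g0) S" and ?h' = "restrict (inv_into S h) S"
  \<comment> \<open>The constant of the map \<open>u\<close> below, composed of \<open>h\<close>,
    \<open>g\<close> and the inverses of \<open>g0\<close> and \<open>h\<close>; an inverse has the
    constant of the map itself.\<close>
  let ?e = "D * (C * (C * D))"
  have e1: "1 \<le> ?e"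
    using bilip_compose[OF hc(2) bilip_compose[OF U1(3)[OF U1(2)] bilip_compose[OF U1(3)[OF U1(2)] hc(2)]]]
    by (simp add: bilip_def)
  \<comment> \<open>The part of the image vector that depends neither on the group element nor on
    \<open>v\<close>. The other terms, the point mass at \<open>h (g0 p)\<close> and the
    push-forward of \<open>v\<close>, are carried by \<open>u\<close> exactly to those for
    \<open>g\<close>, so the whole error is \<open>c1\<close> minus its push-forward.\<close>
  define c1 where "c1 = (\<lambda>x. c x - t * point_mass (h p) x)"
  have c1: "c1 \<in> fin_supp S"
    unfolding c1_def by (intro fin_supp_diff(1) hc fin_supp_scale(1) fin_supp_point_mass Bij_in[OF hB] p)
  have "\<epsilon> / 2 > 0" using \<epsilon> by simp
  from nrm_push_close[OF e1 this c1] obtain \<sigma> where \<sigma>: "\<sigma> > 0"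
    "\<forall>u. bilip ?e u \<longrightarrow> (\<forall>x\<in>S. d (u x) x < \<sigma>) \<longrightarrow>
     nrm (\<lambda>x. c1 x - push S u c1 x) \<le> \<epsilon> / 2 \<and>
     (\<forall>a\<in>fin_supp S. nrm (push S u a) \<le> (1 + \<epsilon> / 2) * nrm a \<and> nrm a \<le> (1 + \<epsilon> / 2) * nrm (push S u a))"
    by auto
  \<comment> \<open>Division by \<open>D\<close> compensates for the stretching by \<open>h\<close>,
    which turns closeness of \<open>g\<close> to \<open>g0\<close> into closeness of
    \<open>u\<close> to the identity.\<close>
  obtain U2 where U2: "openin T U2" "g0 \<in> U2" "\<And>g x. g \<in> U2 \<Longrightarrow> x \<in> S \<Longrightarrow> d (g x) (g0 x) < \<sigma> / D"
    using close[OF g0, of "\<sigma> / D"] \<sigma>(1) D by auto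
  show "\<exists>U. openin T U \<and> g0 \<in> U \<and> (\<forall>g\<in>U. \<forall>v\<in>fin_supp S.
      \<bar>log_nrm (aff (k \<otimes>\<^bsub>affine_group\<^esub> (g, cocycle p t g)) v) -
       log_nrm (aff (k \<otimes>\<^bsub>affine_group\<^esub> (g0, cocycle p t g0)) v)\<bar> \<le> \<epsilon>)"
  proof (intro exI[of _ "U1 \<inter> U2"] conjI ballI)
    show "openin T (U1 \<inter> U2)" "g0 \<in> U1 \<inter> U2" using U1 U2 by auto
    fix g v assume g: "g \<in> U1 \<inter> U2" and v: "v \<in> fin_supp S"
    have gB: "g \<in> Bij S" using g bilip_Bij U1 by blast
    \<comment> \<open>\<open>u\<close> takes the image of \<open>v\<close> under \<open>k \<cdot> (g0, cocycle)\<close> to that under \<open>k \<cdot> (g, cocycle)\<close>, up to the small error \<open>e\<close>.\<close>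
    define u where "u = compose S h (compose S g (compose S ?g0' ?h'))"
    have u: "bilip ?e u"
      unfolding u_def using g U1 hc by (intro bilip_compose bilip_inv) auto
    have uB: "u \<in> Bij S" using u by (rule bilip_Bij)
    have uhg: "u (h (g0 z)) = h (g z)" if "z \<in> S" for z
    proof -
      have "inj_on h S" "inj_on g0 S" using hB g0B by (auto simp: Bij_def bij_betw_def)
      then show ?thesis
        using that Bij_in[OF hB] Bij_in[OF g0B] by (simp add: u_def compose_def inv_into_f_f)
    qed
    have "d (u x) x < \<sigma>" if x: "x \<in> S" for x
    proof -
      obtain y where y: "y \<in> S" "x = h y" by (rule Bij_surjE[OF hB x])
      obtain z where z: "z \<in> S" "y = g0 z" by (rule Bij_surjE[OF g0B y(1)])
      have "d (u x) x = d (h (g z)) (h (g0 z))" using uhg y z by simp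
      also have "\<dots> \<le> D * d (g z) (g0 z)"
        using hc(2) z Bij_in[OF gB] Bij_in[OF g0B] by (simp add: bilip_def)
      also have "\<dots> < D * (\<sigma> / D)"
        using U2(3)[of g z] g z D by (intro mult_strict_left_mono) auto
      finally show ?thesis using D by simp
    qed
    then have est: "nrm (\<lambda>x. c1 x - push S u c1 x) \<le> \<epsilon> / 2 \<and>
      (\<forall>a\<in>fin_supp S. nrm (push S u a) \<le> (1 + \<epsilon> / 2) * nrm a \<and> nrm a \<le> (1 + \<epsilon> / 2) * nrm (push S u a))"
      using \<sigma>(2) u by blast
    define x where "x = aff (k \<otimes>\<^bsub>affine_group\<^esub> (g0, cocycle p t g0)) v"
    define e where "e = (\<lambda>s. c1 s - push S u c1 s)"
    have form: "aff (k \<otimes>\<^bsub>affine_group\<^esub> (f, cocycle p t f)) v =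
        (\<lambda>s. c s + t * (point_mass (h (f p)) s - point_mass (h p) s) + push S (compose S h f) v s)"
      if "f \<in> Bij S" for f
      by (simp add: affine_group_def hc(1) aff_def push_cocycle[OF p hB that])
    have "compose S u (compose S h g0) = compose S h g"
      using uhg by (auto simp: compose_def fun_eq_iff)
    then have "push S u (push S (compose S h g0) v) = push S (compose S h g) v"
      using push_compose[OF uB compose_Bij[OF hB g0B], of v] by simp
    then have "push S u x = (\<lambda>s. push S u c s + t * (point_mass (h (g p)) s - push S u (point_mass (h p)) s)
        + push S (compose S h g) v s)"
      unfolding x_def form[OF g0B]
      using push_point_mass[OF uB Bij_in[OF hB Bij_in[OF g0B p]]] uhg[OF p]
      by (simp add: push_add push_diff push_scale)
    then have eq: "aff (k \<otimes>\<^bsub>affine_group\<^esub> (g, cocycle p t g)) v = (\<lambda>s. push S u x s + e s)"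
      unfolding form[OF gB] e_def c1_def by (simp add: push_diff push_scale algebra_simps)
    have "(g0, cocycle p t g0) \<in> carrier affine_group"
      using U1(3)[OF U1(2)] cocycle_fin_supp[OF p g0B] by (auto simp: affine_group_def)
    then have x: "x \<in> fin_supp S"
      unfolding x_def
      by (intro action.act_closed[OF monoid.m_closed[OF group.is_monoid[OF group_affine_group] k]] v)
    have e: "e \<in> fin_supp S" unfolding e_def by (intro fin_supp_diff(1) c1 fin_supp_push uB)
    have "\<bar>log_nrm (\<lambda>s. push S u x s + e s) - log_nrm x\<bar> \<le> 2 * (\<epsilon> / 2)"
      using est x by (intro log_nrm_close fin_supp_push uB e) (auto simp: e_def \<epsilon>)
    then show "\<bar>log_nrm (aff (k \<otimes>\<^bsub>affine_group\<^esub> (g, cocycle p t g)) v) -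
       log_nrm (aff (k \<otimes>\<^bsub>affine_group\<^esub> (g0, cocycle p t g0)) v)\<bar> \<le> \<epsilon>"
      unfolding eq x_def[symmetric] by simp
  qed
qed

end

section \<open>Charts\<close>

locale compact_manifold =
  fixes X :: "'a topology" and \<A> :: "('a, 'e::euclidean_space) chart set"
  assumes mfd: "smooth_manifold X \<A>" and cpt: "compact_space X"
begin

lemma Hausdorff: "Hausdorff_space X"
  using mfd by (simp add: smooth_manifold_def)

lemma chartD:
  assumes "(U, \<phi>) \<in> \<A>"
  shows "openin X U" "open (\<phi> ` U)" "homeomorphic_map (subtopology X U) (top_of_set (\<phi> ` U)) \<phi>"
    "U \<subseteq> topspace X" "inj_on \<phi> U"
proof -
  have "(U, \<phi>) \<in> charts_of X" using mfd assms by (auto simp: smooth_manifold_def)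
  then show *: "openin X U" "open (\<phi> ` U)" "homeomorphic_map (subtopology X U) (top_of_set (\<phi> ` U)) \<phi>"
    by (auto simp: charts_of_def)
  show U: "U \<subseteq> topspace X" by (rule openin_subset[OF *(1)])
  show "inj_on \<phi> U"
    using homeomorphic_imp_injective_map[OF *(3)] U by (simp add: Int_absorb1)
qed

lemma chart_at:
  assumes "x \<in> topspace X"
  obtains U \<phi> where "(U, \<phi>) \<in> \<A>" "x \<in> U"
proof -
  have "x \<in> (\<Union>(U, \<phi>)\<in>\<A>. U)" using mfd assms by (simp add: smooth_manifold_def)
  then show ?thesis using that by auto
qed

lemma chart_inv [simp]: "(U, \<phi>) \<in> \<A> \<Longrightarrow> x \<in> U \<Longrightarrow> inv_into U \<phi> (\<phi> x) = x"
  by (simp add: chartD(5))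

lemma transition_smooth:
  assumes "(U, \<phi>) \<in> \<A>" "(V, \<psi>) \<in> \<A>"
  shows "smooth_on (\<phi> ` (U \<inter> V)) (\<psi> \<circ> inv_into U \<phi>)"
proof -
  have "smoothly_compatible (U, \<phi>) (V, \<psi>)"
    using mfd assms unfolding smooth_manifold_def by blast
  then show ?thesis by (simp add: smoothly_compatible_def)
qed

lemma chart_open_image:
  assumes "(U, \<phi>) \<in> \<A>" "openin X W" "W \<subseteq> U"
  shows "open (\<phi> ` W)"
proof -
  have "openin (subtopology X U) W"
    using assms(2,3) by (auto simp: openin_subtopology)
  then have "openin (top_of_set (\<phi> ` U)) (\<phi> ` W)"
    using homeomorphic_imp_open_map[OF chartD(3)[OF assms(1)]] by (simp add: open_map_def)
  then show ?thesis
    using chartD(2)[OF assms(1)] openin_open_eq by blast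
qed

lemma chart_open_preimage:
  assumes "(U, \<phi>) \<in> \<A>" "open B"
  shows "openin X {x \<in> U. \<phi> x \<in> B}"
proof -
  have "continuous_map (subtopology X U) euclidean \<phi>"
    using homeomorphic_imp_continuous_map[OF chartD(3)[OF assms(1)]]
    by (simp add: continuous_map_in_subtopology)
  then have "openin (subtopology X U) {x \<in> topspace (subtopology X U). \<phi> x \<in> B}"
    using openin_continuous_map_preimage assms(2) open_openin by blast
  moreover have "topspace (subtopology X U) = U"
    using chartD(4)[OF assms(1)] by (simp add: Int_absorb1)
  ultimately show ?thesis
    using openin_trans_full[OF _ chartD(1)[OF assms(1)]] by (simp only:)
qed

lemma chart_compact:
  assumes "(U, \<phi>) \<in> \<A>" "compact K" "K \<subseteq> \<phi> ` U"
  shows "compactin X (inv_into U \<phi> ` K)"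
proof -
  have tU: "topspace (subtopology X U) = U"
    using chartD(4)[OF assms(1)] by (simp add: Int_absorb1)
  obtain g where g: "homeomorphic_maps (subtopology X U) (top_of_set (\<phi> ` U)) \<phi> g"
    using chartD(3)[OF assms(1)] homeomorphic_map_maps by blast
  then have gU: "g (\<phi> x) = x" if "x \<in> U" for x
    using that chartD(4)[OF assms(1)] by (auto simp: homeomorphic_maps_def)
  have "continuous_map (top_of_set (\<phi> ` U)) X g"
    using g by (simp add: homeomorphic_maps_def continuous_map_in_subtopology)
  then have "continuous_map (top_of_set (\<phi> ` U)) X (inv_into U \<phi>)"
    by (rule continuous_map_eq) (use gU assms(1) in auto)
  then show ?thesis
    by (rule image_compactin[rotated]) (use assms in \<open>simp add: compactin_subtopology\<close>)
qed

lemma chart_ball_preimage: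
  assumes "(U, \<phi>) \<in> \<A>" "openin X W" "W \<subseteq> U" "x \<in> W"
  obtains r where "r > 0" "cball (\<phi> x) r \<subseteq> \<phi> ` W"
  using open_contains_cball chart_open_image[OF assms(1-3)] assms(4) by blast

lemma local_lipschitz:
  fixes F :: "'e \<Rightarrow> 'c::euclidean_space"
  assumes "(U, \<phi>) \<in> \<A>" "openin X W" "W \<subseteq> U" "x \<in> W" "smooth_on (\<phi> ` W) F"
  obtains W' L where "openin X W'" "x \<in> W'" "W' \<subseteq> W" "L > 0"
    "\<And>y z. y \<in> W' \<Longrightarrow> z \<in> W' \<Longrightarrow> norm (F (\<phi> y) - F (\<phi> z)) \<le> L * norm (\<phi> y - \<phi> z)"
proof -
  obtain r L where rL: "r > 0" "L > 0" "cball (\<phi> x) r \<subseteq> \<phi> ` W"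
    "\<And>y z. y \<in> cball (\<phi> x) r \<Longrightarrow> z \<in> cball (\<phi> x) r \<Longrightarrow> norm (F y - F z) \<le> L * norm (y - z)"
    using smooth_on_locally_lipschitz[OF chart_open_image[OF assms(1-3)] assms(5), of "\<phi> x"] assms(4)
    by blast
  show ?thesis
  proof (rule that[of "W \<inter> {y \<in> U. \<phi> y \<in> ball (\<phi> x) r}" L])
    show "openin X (W \<inter> {y \<in> U. \<phi> y \<in> ball (\<phi> x) r})"
      by (intro openin_Int assms(2) chart_open_preimage[OF assms(1)]) simp
  qed (use rL assms in auto)
qed

lemma transition_lipschitz:
  assumes "(U, \<phi>) \<in> \<A>" "(V, \<psi>) \<in> \<A>" "x \<in> U" "x \<in> V"
  obtains W L where "openin X W" "x \<in> W" "W \<subseteq> U \<inter> V" "L > 0"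
    "\<And>y z. y \<in> W \<Longrightarrow> z \<in> W \<Longrightarrow> norm (\<psi> y - \<psi> z) \<le> L * norm (\<phi> y - \<phi> z)"
proof -
  have "openin X (U \<inter> V)" using chartD(1) assms by blast
  from local_lipschitz[OF assms(1) this _ _ transition_smooth[OF assms(1,2)], of x]
  obtain W L where W: "openin X W" "x \<in> W" "W \<subseteq> U \<inter> V" "L > 0"
    "\<And>y z. y \<in> W \<Longrightarrow> z \<in> W \<Longrightarrow>
      norm ((\<psi> \<circ> inv_into U \<phi>) (\<phi> y) - (\<psi> \<circ> inv_into U \<phi>) (\<phi> z)) \<le> L * norm (\<phi> y - \<phi> z)"
    using assms by blast
  show ?thesis
    by (rule that[OF W(1-4)]) (use W(3,5) assms(1) in \<open>auto simp: subset_iff\<close>)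
qed

section \<open>A metric that is locally bi-Lipschitz to the charts\<close>

definition tent_data :: "('a set \<times> ('a \<Rightarrow> 'e)) \<times> 'e \<times> real \<Rightarrow> bool" where
  "tent_data = (\<lambda>((U, \<phi>), c, r). (U, \<phi>) \<in> \<A> \<and> r > 0 \<and> cball c r \<subseteq> \<phi> ` U)"

definition tent :: "('a set \<times> ('a \<Rightarrow> 'e)) \<times> 'e \<times> real \<Rightarrow> 'a \<Rightarrow> real" where
  "tent = (\<lambda>((U, \<phi>), c, r) y. if y \<in> U then max 0 (r - norm (\<phi> y - c)) else 0)"

text \<open>The device that embeds a compact manifold in a Euclidean space: a cutoff paired with
  cutoff times coordinates. Where the cutoff is positive the coordinates are a quotient; outside the
  chart domain their irrelevant values are multiplied by 0.\<close>

definition tent_map :: "('a set \<times> ('a \<Rightarrow> 'e)) \<times> 'e \<times> real \<Rightarrow> 'a \<Rightarrow> real \<times> 'e" where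
  "tent_map i y = (tent i y, tent i y *\<^sub>R snd (fst i) y)"

lemma dist_tent_map_le:
  "dist (tent_map i y) (tent_map i z) \<le>
    \<bar>tent i y - tent i z\<bar> + norm (tent i y *\<^sub>R snd (fst i) y - tent i z *\<^sub>R snd (fst i) z)"
  by (simp add: tent_map_def dist_prod_def dist_norm sqrt_sum_squares_le_sum_abs[THEN order_trans])

lemma dist_tent_map_ge:
  "\<bar>tent i y - tent i z\<bar> \<le> dist (tent_map i y) (tent_map i z)"
  "norm (tent i y *\<^sub>R snd (fst i) y - tent i z *\<^sub>R snd (fst i) z) \<le> dist (tent_map i y) (tent_map i z)"
  using dist_fst_le[of "tent_map i y" "tent_map i z"] dist_snd_le[of "tent_map i y" "tent_map i z"]
  by (simp_all add: tent_map_def dist_norm)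

lemma tent_map_bound:
  assumes "tent_data i"
  obtains B where "\<And>y. norm (tent_map i y) \<le> B"
proof -
  obtain U \<phi> c r where i: "i = ((U, \<phi>), c, r)" by (metis prod.exhaust)
  have r: "r > 0" using assms by (simp add: i tent_data_def)
  have "norm (tent_map i y) \<le> r + r * (norm c + r)" for y
  proof -
    have t: "\<bar>tent i y\<bar> \<le> r" using r by (simp add: i tent_def)
    have "norm (tent i y *\<^sub>R \<phi> y) \<le> r * (norm c + r)"
    proof (cases "tent i y = 0")
      case True
      then show ?thesis using r by simp
    next
      case False
      then have "norm (\<phi> y - c) < r" by (auto simp: i tent_def split: if_splits)
      then have "norm (\<phi> y) \<le> norm c + r" using norm_triangle_sub[of "\<phi> y" c] by simp
      then show ?thesis using t r by (simp add: mult_mono)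
    qed
    then show ?thesis
      using t norm_Pair_le[of "tent i y" "tent i y *\<^sub>R \<phi> y"] by (simp add: tent_map_def i)
  qed
  then show ?thesis using that by blast
qed

lemma tent_map_upper:
  assumes i: "tent_data i" and V: "(V, \<psi>) \<in> \<A>" and x: "x \<in> V"
  obtains W L where "openin X W" "x \<in> W" "W \<subseteq> V" "L > 0"
    "\<And>y z. y \<in> W \<Longrightarrow> z \<in> W \<Longrightarrow> dist (tent_map i y) (tent_map i z) \<le> L * norm (\<psi> y - \<psi> z)"
proof -
  obtain U \<phi> c r where ieq: "i = ((U, \<phi>), c, r)" by (metis prod.exhaust)
  have U: "(U, \<phi>) \<in> \<A>" and r: "r > 0" "cball c r \<subseteq> \<phi> ` U"
    using i by (auto simp: ieq tent_data_def)
  show ?thesis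
  proof (cases "x \<in> U")
    case True
    obtain W L where W: "openin X W" "x \<in> W" "W \<subseteq> V \<inter> U" "L > 0"
      "\<And>y z. y \<in> W \<Longrightarrow> z \<in> W \<Longrightarrow> norm (\<phi> y - \<phi> z) \<le> L * norm (\<psi> y - \<psi> z)"
      using transition_lipschitz[OF V U x True] by blast
    let ?B = "norm (\<phi> x) + 1"
    let ?W = "W \<inter> {y \<in> U. \<phi> y \<in> ball (\<phi> x) 1}"
    show ?thesis
    \<comment> \<open>The cutoff is 1-Lipschitz in the coordinates; the product rule adds the bound
      of the coordinates on \<open>?W\<close> and the height \<open>r\<close> of the cutoff, and
      \<open>L\<close> is the price of changing charts.\<close>
    proof (rule that[of ?W "(1 + ?B + r) * L"])
      show "openin X ?W" by (intro openin_Int W(1) chart_open_preimage[OF U]) simp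
      show "x \<in> ?W" "?W \<subseteq> V" using W True by auto
      have "1 + ?B + r > 0" using r(1) norm_ge_zero[of "\<phi> x"] by linarith
      then show "(1 + ?B + r) * L > 0" using W(4) by simp
      fix y z assume yz: "y \<in> ?W" "z \<in> ?W"
      have t: "\<bar>tent i y - tent i z\<bar> \<le> norm (\<phi> y - \<phi> z)"
        using yz norm_triangle_ineq3[of "\<phi> y - c" "\<phi> z - c"] by (simp add: ieq tent_def)
      have B: "norm (\<phi> y) \<le> ?B"
        using yz norm_triangle_sub[of "\<phi> y" "\<phi> x"] by (simp add: dist_norm norm_minus_commute)
      have "tent i y *\<^sub>R \<phi> y - tent i z *\<^sub>R \<phi> z = (tent i y - tent i z) *\<^sub>R \<phi> y + tent i z *\<^sub>R (\<phi> y - \<phi> z)"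
        by (simp add: algebra_simps)
      then have "norm (tent i y *\<^sub>R \<phi> y - tent i z *\<^sub>R \<phi> z) \<le>
          \<bar>tent i y - tent i z\<bar> * norm (\<phi> y) + \<bar>tent i z\<bar> * norm (\<phi> y - \<phi> z)"
        using norm_triangle_ineq[of "(tent i y - tent i z) *\<^sub>R \<phi> y" "tent i z *\<^sub>R (\<phi> y - \<phi> z)"] by simp
      also have "\<dots> \<le> norm (\<phi> y - \<phi> z) * ?B + r * norm (\<phi> y - \<phi> z)"
        using t B r(1) by (intro add_mono mult_mono) (auto simp: ieq tent_def)
      finally have "dist (tent_map i y) (tent_map i z) \<le> (1 + ?B + r) * norm (\<phi> y - \<phi> z)"
        using dist_tent_map_le[of i y z] t by (simp add: ieq algebra_simps)
      also have "\<dots> \<le> (1 + ?B + r) * (L * norm (\<psi> y - \<psi> z))"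
        using W(5) yz r(1) by (intro mult_left_mono) auto
      finally show "dist (tent_map i y) (tent_map i z) \<le> (1 + ?B + r) * L * norm (\<psi> y - \<psi> z)"
        by (simp add: mult.assoc)
    qed
  next
    case False
    \<comment> \<open>The tent lives on this compact set, which is closed because \<open>X\<close>
      is Hausdorff; a point outside \<open>U\<close> has a neighbourhood missing it, where the tent
      map is constantly 0.\<close>
    define K where "K = inv_into U \<phi> ` cball c r"
    have K: "closedin X K" "K \<subseteq> U"
      using compactin_imp_closedin[OF Hausdorff chart_compact[OF U _ r(2)]] r(2)
      by (auto simp: K_def intro: inv_into_into)
    have z: "tent_map i y = 0" if "y \<notin> K" for y
    proof -
      have "tent i y = 0"
      proof (cases "y \<in> U")
        case True
        then have "\<phi> y \<notin> cball c r" using that chart_inv[OF U True] by (force simp: K_def)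
        then show ?thesis by (simp add: ieq tent_def dist_norm norm_minus_commute)
      qed (simp add: ieq tent_def)
      then show ?thesis by (simp add: tent_map_def zero_prod_def)
    qed
    show ?thesis
      by (rule that[of "V - K" 1]) (use z K False x chartD(1)[OF V] in \<open>auto intro: openin_diff\<close>)
  qed
qed

text \<open>The coordinate difference, multiplied by the cutoff, is the difference of the second
  components minus the cutoff difference times bounded coordinates; a positive lower bound of the
  cutoff near \<open>x\<close> allows division.\<close>

lemma tent_map_lower:
  assumes i: "tent_data i" and V: "(V, \<psi>) \<in> \<A>" and x: "x \<in> V" and pos: "tent i x > 0"
  obtains W L where "openin X W" "x \<in> W" "W \<subseteq> V" "L > 0"
    "\<And>y z. y \<in> W \<Longrightarrow> z \<in> W \<Longrightarrow> norm (\<psi> y - \<psi> z) \<le> L * dist (tent_map i y) (tent_map i z)"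
proof -
  obtain U \<phi> c r where ieq: "i = ((U, \<phi>), c, r)" by (metis prod.exhaust)
  have U: "(U, \<phi>) \<in> \<A>" and r: "r > 0" "cball c r \<subseteq> \<phi> ` U"
    using i by (auto simp: ieq tent_data_def)
  have xU: "x \<in> U" "norm (\<phi> x - c) < r" using pos by (auto simp: ieq tent_def split: if_splits)
  obtain W L where W: "openin X W" "x \<in> W" "W \<subseteq> U \<inter> V" "L > 0"
    "\<And>y z. y \<in> W \<Longrightarrow> z \<in> W \<Longrightarrow> norm (\<psi> y - \<psi> z) \<le> L * norm (\<phi> y - \<phi> z)"
    using transition_lipschitz[OF U V xU(1) x] by blast
  \<comment> \<open>Half the height of the tent at \<open>x\<close>, hence a lower bound for it on a
    neighbourhood.\<close>
  define m where "m = (r - norm (\<phi> x - c)) / 2"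
  have m: "m > 0" using xU by (simp add: m_def)
  let ?B = "norm c + r"
  let ?W = "W \<inter> {y \<in> U. \<phi> y \<in> ball c (r - m)}"
  show ?thesis
  proof (rule that[of ?W "L * ((1 + ?B) / m)"])
    show "openin X ?W" by (intro openin_Int W(1) chart_open_preimage[OF U]) simp
    have "norm (\<phi> x - c) < r - m" using xU(2) by (simp add: m_def field_simps)
    then show "x \<in> ?W" using W xU by (simp add: dist_norm norm_minus_commute)
    show "?W \<subseteq> V" using W by auto
    have "1 + ?B > 0" using r(1) norm_ge_zero[of c] by linarith
    then show "0 < L * ((1 + ?B) / m)" using W(4) m by simp
    fix y z assume yz: "y \<in> ?W" "z \<in> ?W"
    let ?D = "dist (tent_map i y) (tent_map i z)"
    have t: "m \<le> tent i y" using yz m by (auto simp: ieq tent_def dist_norm norm_minus_commute)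
    have "norm (\<phi> z - c) < r - m" using yz by (simp add: dist_norm norm_minus_commute)
    then have B: "norm (\<phi> z) \<le> ?B" using norm_triangle_sub[of "\<phi> z" c] m by linarith
    have "tent i y *\<^sub>R (\<phi> y - \<phi> z) = (tent i y *\<^sub>R \<phi> y - tent i z *\<^sub>R \<phi> z) - (tent i y - tent i z) *\<^sub>R \<phi> z"
      by (simp add: algebra_simps)
    then have "tent i y * norm (\<phi> y - \<phi> z) \<le>
        norm (tent i y *\<^sub>R \<phi> y - tent i z *\<^sub>R \<phi> z) + \<bar>tent i y - tent i z\<bar> * norm (\<phi> z)"
      using t m norm_triangle_ineq4[of "tent i y *\<^sub>R \<phi> y - tent i z *\<^sub>R \<phi> z" "(tent i y - tent i z) *\<^sub>R \<phi> z"]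
        norm_scaleR[of "tent i y" "\<phi> y - \<phi> z"] by simp
    also have "\<dots> \<le> ?D + ?D * ?B"
      using dist_tent_map_ge[of i y z] B by (intro add_mono mult_mono) (auto simp: ieq)
    finally have "m * norm (\<phi> y - \<phi> z) \<le> (1 + ?B) * ?D"
      using mult_right_mono[OF t, of "norm (\<phi> y - \<phi> z)"] by (simp add: algebra_simps)
    then have "norm (\<phi> y - \<phi> z) \<le> (1 + ?B) / m * ?D"
      using m by (simp add: field_simps)
    then have "L * norm (\<phi> y - \<phi> z) \<le> L * ((1 + ?B) / m * ?D)"
      using W(4) by (intro mult_left_mono) auto
    then show "norm (\<psi> y - \<psi> z) \<le> L * ((1 + ?B) / m) * ?D"
      using W(5)[of y z] yz by (simp add: mult.assoc)
  qed
qed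

lemma finite_tents:
  obtains I where "finite I" "\<And>i. i \<in> I \<Longrightarrow> tent_data i"
    "\<And>x. x \<in> topspace X \<Longrightarrow> \<exists>i\<in>I. tent i x > 0"
proof -
  define \<C> where "\<C> = (\<lambda>i. {x \<in> topspace X. tent i x > 0}) ` {i. tent_data i}"
  have "openin X C" if C: "C \<in> \<C>" for C
  proof -
    obtain i where i': "tent_data i" "C = {x \<in> topspace X. tent i x > 0}"
      using C unfolding \<C>_def by blast
    obtain U \<phi> c r where "i = ((U, \<phi>), c, r)" by (metis prod.exhaust)
    with i' have i: "tent_data ((U, \<phi>), c, r)" "C = {x \<in> topspace X. tent ((U, \<phi>), c, r) x > 0}"
      by auto
    then have U: "(U, \<phi>) \<in> \<A>" by (simp add: tent_data_def)
    have "C = {x \<in> U. \<phi> x \<in> ball c r}"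
      using chartD(4)[OF U] by (auto simp: i(2) tent_def dist_norm norm_minus_commute split: if_splits)
    then show ?thesis using chart_open_preimage[OF U open_ball] by simp
  qed
  moreover have "topspace X \<subseteq> \<Union>\<C>"
  proof
    fix x assume x: "x \<in> topspace X"
    then obtain U \<phi> where U: "(U, \<phi>) \<in> \<A>" "x \<in> U" using chart_at by blast
    obtain r where "r > 0" "cball (\<phi> x) r \<subseteq> \<phi> ` U"
      using chart_ball_preimage[OF U(1) chartD(1)[OF U(1)] order_refl U(2)] .
    then have "tent_data ((U, \<phi>), \<phi> x, r)" "tent ((U, \<phi>), \<phi> x, r) x > 0"
      using U by (auto simp: tent_data_def tent_def)
    then show "x \<in> \<Union>\<C>" using x unfolding \<C>_def by blast
  qed
  ultimately have "Ball \<C> (openin X) \<and> topspace X \<subseteq> \<Union>\<C>" by blast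
  from cpt[unfolded compact_space_alt, THEN spec, THEN mp, OF this]
  obtain \<F> where \<F>: "finite \<F>" "\<F> \<subseteq> \<C>" "topspace X \<subseteq> \<Union>\<F>" by blast
  from finite_subset_image[OF \<F>(1) \<F>(2)[unfolded \<C>_def]]
  obtain I where I: "finite I" "I \<subseteq> {i. tent_data i}" "\<F> = (\<lambda>i. {x \<in> topspace X. tent i x > 0}) ` I"
    by blast
  show ?thesis
  proof (rule that[OF I(1)])
    show "tent_data i" if "i \<in> I" for i using I(2) that by blast
    show "\<exists>i\<in>I. tent i x > 0" if "x \<in> topspace X" for x
      using subsetD[OF \<F>(3) that] unfolding I(3) by blast
  qed
qed

lemma finite_tent_upper:
  assumes "finite I" "\<And>i. i \<in> I \<Longrightarrow> tent_data i" "(V, \<psi>) \<in> \<A>" "x \<in> V"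
  shows "\<exists>W L. openin X W \<and> x \<in> W \<and> W \<subseteq> V \<and> 0 < L \<and>
    (\<forall>y\<in>W. \<forall>z\<in>W. (\<Sum>i\<in>I. dist (tent_map i y) (tent_map i z)) \<le> L * norm (\<psi> y - \<psi> z))"
  using assms(1,2)
proof (induction I)
  case empty
  show ?case
    by (rule exI[of _ V], rule exI[of _ 1]) (use assms(4) chartD(1)[OF assms(3)] in auto)
next
  case (insert i I)
  obtain W L where W: "openin X W" "x \<in> W" "W \<subseteq> V" "0 < L"
    "\<And>y z. y \<in> W \<Longrightarrow> z \<in> W \<Longrightarrow> (\<Sum>i\<in>I. dist (tent_map i y) (tent_map i z)) \<le> L * norm (\<psi> y - \<psi> z)"
    using insert.IH insert.prems by auto
  obtain W' L' where W': "openin X W'" "x \<in> W'" "W' \<subseteq> V" "0 < L'"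
    "\<And>y z. y \<in> W' \<Longrightarrow> z \<in> W' \<Longrightarrow> dist (tent_map i y) (tent_map i z) \<le> L' * norm (\<psi> y - \<psi> z)"
    using tent_map_upper[OF _ assms(3,4), of i] insert.prems by auto
  show ?case
    by (rule exI[of _ "W \<inter> W'"], rule exI[of _ "L' + L"])
      (use W W' insert.hyps in \<open>auto simp: distrib_right intro: add_mono\<close>)
qed

end

locale manifold_metric = compact_manifold X \<A> + bounded_metric "topspace X" d M
  for X :: "'a topology" and \<A> :: "('a, 'e::euclidean_space) chart set" and d M +
  assumes chart_upper: "(V, \<psi>) \<in> \<A> \<Longrightarrow> x \<in> V \<Longrightarrow> \<exists>W L. openin X W \<and> x \<in> W \<and> W \<subseteq> V \<and> 0 < L \<and>
      (\<forall>y\<in>W. \<forall>z\<in>W. d y z \<le> L * norm (\<psi> y - \<psi> z))"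
    and chart_lower: "(V, \<psi>) \<in> \<A> \<Longrightarrow> x \<in> V \<Longrightarrow> \<exists>W L. openin X W \<and> x \<in> W \<and> W \<subseteq> V \<and> 0 < L \<and>
      (\<forall>y\<in>W. \<forall>z\<in>W. norm (\<psi> y - \<psi> z) \<le> L * d y z)"

text \<open>The metric is the sum of the distances of finitely many tent maps. Separation and the
  lower chart bound use a single tent positive at the point; the upper bound uses all of them, hence
  finiteness.\<close>

lemma (in compact_manifold) ex_manifold_metric: "\<exists>d M. manifold_metric X \<A> d M"
proof -
  obtain I where I: "finite I" "\<And>i. i \<in> I \<Longrightarrow> tent_data i"
    "\<And>x. x \<in> topspace X \<Longrightarrow> \<exists>i\<in>I. tent i x > 0"
    using finite_tents by blast
  define d where "d = (\<lambda>x y. \<Sum>i\<in>I. dist (tent_map i x) (tent_map i y))"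
  have "\<forall>i\<in>I. \<exists>B. \<forall>y. norm (tent_map i y) \<le> B"
    using tent_map_bound I(2) by meson
  then obtain B where B: "\<And>i y. i \<in> I \<Longrightarrow> norm (tent_map i y) \<le> B i" by metis
  have le_d: "dist (tent_map i x) (tent_map i y) \<le> d x y" if "i \<in> I" for i x y
    unfolding d_def using that I(1) by (intro member_le_sum) auto
  have "manifold_metric X \<A> d (\<Sum>i\<in>I. B i + B i)"
  proof
    show "0 \<le> d x y" "d x y = d y x" "d x x = 0" for x y
      by (auto simp: d_def sum_nonneg dist_commute)
    show "d x z \<le> d x y + d y z" for x y z
      unfolding d_def sum.distrib[symmetric] by (intro sum_mono dist_triangle)
    show "d x y \<le> (\<Sum>i\<in>I. B i + B i)" for x y
      unfolding d_def
    proof (rule sum_mono)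
      fix i assume i: "i \<in> I"
      show "dist (tent_map i x) (tent_map i y) \<le> B i + B i"
        using norm_triangle_ineq4[of "tent_map i x" "tent_map i y"] B[OF i, of x] B[OF i, of y]
        unfolding dist_norm by linarith
    qed
    show "x = y" if xy: "x \<in> topspace X" "y \<in> topspace X" "d x y = 0" for x y
    proof -
      obtain i where i: "i \<in> I" "tent i x > 0" using I(3) xy by blast
      obtain U \<phi> c r where ieq: "i = ((U, \<phi>), c, r)" by (metis prod.exhaust)
      have U: "(U, \<phi>) \<in> \<A>" using I(2)[OF i(1)] by (simp add: ieq tent_data_def)
      have "tent_map i x = tent_map i y" using le_d[OF i(1), of x y] xy(3) by simp
      then have "tent i y = tent i x" "\<phi> x = \<phi> y" using i(2) by (auto simp: tent_map_def ieq)
      moreover from this have "x \<in> U" "y \<in> U" using i(2) by (auto simp: ieq tent_def split: if_splits)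
      ultimately show ?thesis using chartD(5)[OF U] by (auto simp: inj_on_def)
    qed
    show "\<exists>W L. openin X W \<and> x \<in> W \<and> W \<subseteq> V \<and> 0 < L \<and> (\<forall>y\<in>W. \<forall>z\<in>W. d y z \<le> L * norm (\<psi> y - \<psi> z))"
      if "(V, \<psi>) \<in> \<A>" "x \<in> V" for V \<psi> x
      unfolding d_def by (rule finite_tent_upper[OF I(1,2) that])
    show "\<exists>W L. openin X W \<and> x \<in> W \<and> W \<subseteq> V \<and> 0 < L \<and> (\<forall>y\<in>W. \<forall>z\<in>W. norm (\<psi> y - \<psi> z) \<le> L * d y z)"
      if V: "(V, \<psi>) \<in> \<A>" "x \<in> V" for V \<psi> x
    proof -
      obtain i where i: "i \<in> I" "tent i x > 0" using I(3) chartD(4)[OF V(1)] V(2) by blast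
      obtain W L where W: "openin X W" "x \<in> W" "W \<subseteq> V" "L > 0"
        "\<And>y z. y \<in> W \<Longrightarrow> z \<in> W \<Longrightarrow> norm (\<psi> y - \<psi> z) \<le> L * dist (tent_map i y) (tent_map i z)"
        using tent_map_lower[OF I(2)[OF i(1)] V i(2)] by blast
      have "norm (\<psi> y - \<psi> z) \<le> L * d y z" if "y \<in> W" "z \<in> W" for y z
        using W(5)[OF that] mult_left_mono[OF le_d[OF i(1), of y z], of L] W(4) by linarith
      then show ?thesis using W(1-4) by blast
    qed
  qed
  then show ?thesis by blast
qed

section \<open>Diffeomorphisms near a given one\<close>

text \<open>Passage from local to global. It is applied to properties saying that some neighbourhood
  of \<open>g0\<close> and some constant work for all points of a set; the union step intersects two
  neighbourhoods.\<close>

lemma compact_space_induct: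
  assumes "compact_space Y" "P {}" "\<And>A B. P A \<Longrightarrow> P B \<Longrightarrow> P (A \<union> B)"
    and "\<And>x. x \<in> topspace Y \<Longrightarrow> \<exists>O'. openin Y O' \<and> x \<in> O' \<and> P O'"
  shows "P (topspace Y)"
proof -
  have "Ball {O'. openin Y O' \<and> P O'} (openin Y) \<and> topspace Y \<subseteq> \<Union>{O'. openin Y O' \<and> P O'}"
    using assms(4) by blast
  from assms(1)[unfolded compact_space_alt, THEN spec, THEN mp, OF this]
  obtain \<F> where \<F>: "finite \<F>" "\<F> \<subseteq> {O'. openin Y O' \<and> P O'}" "topspace Y \<subseteq> \<Union>\<F>"
    by blast
  have "P (\<Union>\<F>)"
    using \<F>(1,2) by (induction \<F>) (auto simp: assms(2,3))
  moreover have "\<Union>\<F> = topspace Y"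
    using \<F>(2,3) openin_subset by blast
  ultimately show ?thesis by simp
qed

context compact_manifold
begin

abbreviation "TC \<equiv> Cinf_topology X \<A>"

lemma diffeoD:
  assumes "f \<in> diffeos X \<A>"
  shows "f \<in> Bij (topspace X)" "continuous_map X X f" "continuous_map X X (inv_into (topspace X) f)"
    "(U, \<phi>) \<in> \<A> \<Longrightarrow> (V, \<psi>) \<in> \<A> \<Longrightarrow> smooth_on (\<phi> ` (U \<inter> f -` V)) (\<psi> \<circ> f \<circ> inv_into U \<phi>)"
    "(U, \<phi>) \<in> \<A> \<Longrightarrow> (V, \<psi>) \<in> \<A> \<Longrightarrow>
      smooth_on (\<phi> ` (U \<inter> inv_into (topspace X) f -` V)) (\<psi> \<circ> inv_into (topspace X) f \<circ> inv_into U \<phi>)"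
proof -
  have *: "f \<in> Bij (topspace X)" "smooth_map X \<A> X \<A> f" "smooth_map X \<A> X \<A> (inv_into (topspace X) f)"
    using assms by (auto simp: diffeos_def)
  show "f \<in> Bij (topspace X)" by (rule *(1))
  show "continuous_map X X f" "continuous_map X X (inv_into (topspace X) f)"
    using *(2,3) by (simp_all add: smooth_map_def)
  show "smooth_on (\<phi> ` (U \<inter> f -` V)) (\<psi> \<circ> f \<circ> inv_into U \<phi>)"
    "smooth_on (\<phi> ` (U \<inter> inv_into (topspace X) f -` V)) (\<psi> \<circ> inv_into (topspace X) f \<circ> inv_into U \<phi>)"
    if "(U, \<phi>) \<in> \<A>" "(V, \<psi>) \<in> \<A>"
    using *(2,3) that unfolding smooth_map_def by fast+
qed

lemma openin_preimage:
  assumes "(U, \<phi>) \<in> \<A>" "continuous_map X X f" "openin X V"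
  shows "openin X (U \<inter> f -` V)"
proof -
  have "openin X (U \<inter> {x \<in> topspace X. f x \<in> V})"
    using chartD(1)[OF assms(1)] openin_continuous_map_preimage[OF assms(2,3)] by blast
  moreover have "U \<inter> {x \<in> topspace X. f x \<in> V} = U \<inter> f -` V"
    using chartD(4)[OF assms(1)] by auto
  ultimately show ?thesis by simp
qed

lemma openin_Cinf_nbhd:
  "f \<in> diffeos X \<A> \<Longrightarrow> c \<in> \<A> \<Longrightarrow> d \<in> \<A> \<Longrightarrow> compactin X K \<Longrightarrow> K \<subseteq> fst c \<Longrightarrow> f ` K \<subseteq> fst d \<Longrightarrow> 0 < \<epsilon> \<Longrightarrow>
    openin TC (Cinf_nbhd X \<A> f c d K vs \<epsilon>)"
  unfolding Cinf_topology_def by (rule topology_generated_by_Basis) blast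

lemma Cinf_nbhd_self:
  "f \<in> diffeos X \<A> \<Longrightarrow> f ` K \<subseteq> fst d \<Longrightarrow> 0 < \<epsilon> \<Longrightarrow> f \<in> Cinf_nbhd X \<A> f c d K vs \<epsilon>"
  by (cases c; cases d) (simp add: Cinf_nbhd_def)

lemma topspace_Cinf:
  assumes "topspace X \<noteq> {}"
  shows "topspace TC = diffeos X \<A>"
proof
  show "topspace TC \<subseteq> diffeos X \<A>"
    unfolding Cinf_topology_def topology_generated_by_topspace Cinf_nbhd_def by auto
  obtain x where "x \<in> topspace X" using assms by blast
  then obtain U \<phi> where U: "(U, \<phi>) \<in> \<A>" using chart_at by metis
  show "diffeos X \<A> \<subseteq> topspace TC"
  proof
    fix f assume f: "f \<in> diffeos X \<A>"
    have "openin TC (Cinf_nbhd X \<A> f (U, \<phi>) (U, \<phi>) {} [] 1)"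
      by (rule openin_Cinf_nbhd) (use f U in auto)
    moreover have "f \<in> Cinf_nbhd X \<A> f (U, \<phi>) (U, \<phi>) {} [] 1"
      by (rule Cinf_nbhd_self) (use f in auto)
    ultimately show "f \<in> topspace TC" using openin_subset by blast
  qed
qed

text \<open>Closeness of the values and of the derivatives along basis vectors gives
  \<open>g - g0\<close>, read in charts, a small Lipschitz constant, by the mean value inequality on
  a coordinate ball.\<close>

lemma Cinf_local:
  assumes g0: "g0 \<in> diffeos X \<A>" and U: "(U, \<phi>) \<in> \<A>" and V: "(V, \<psi>) \<in> \<A>"
    and x: "x \<in> U" and W': "openin X W'" "g0 x \<in> W'" "W' \<subseteq> V" and \<epsilon>: "0 < \<epsilon>"
  shows "\<exists>N W. openin TC N \<and> g0 \<in> N \<and> openin X W \<and> x \<in> W \<and> W \<subseteq> U \<and>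
    (\<forall>g\<in>N. g \<in> diffeos X \<A> \<and> (\<forall>y\<in>W. g y \<in> W' \<and> norm (\<psi> (g y) - \<psi> (g0 y)) < \<epsilon>) \<and>
      (\<forall>y\<in>W. \<forall>z\<in>W. norm ((\<psi> (g y) - \<psi> (g0 y)) - (\<psi> (g z) - \<psi> (g0 z))) \<le> \<epsilon> * norm (\<phi> y - \<phi> z)))"
proof -
  obtain s where s: "s > 0" "cball (\<psi> (g0 x)) s \<subseteq> \<psi> ` W'"
    using chart_ball_preimage[OF V W'(1,3,2)] by blast
  \<comment> \<open>Half of the radius is reserved for the values of \<open>g0\<close>, the other
    half for the difference of \<open>g\<close> and \<open>g0\<close>, so that \<open>g\<close>
    still maps into \<open>W'\<close>.\<close>
  let ?Q = "{v \<in> V. \<psi> v \<in> ball (\<psi> (g0 x)) (s / 2)}"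
  have Q: "openin X ?Q" by (rule chart_open_preimage[OF V]) simp
  have oQ: "openin X (U \<inter> g0 -` ?Q)" by (rule openin_preimage[OF U diffeoD(2)[OF g0] Q])
  have xQ: "x \<in> U \<inter> g0 -` ?Q" using x W'(2,3) s(1) by auto
  obtain r where r: "r > 0" "cball (\<phi> x) r \<subseteq> \<phi> ` (U \<inter> g0 -` ?Q)"
    by (rule chart_ball_preimage[OF U oQ Int_lower1 xQ])
  define K where "K = inv_into U \<phi> ` cball (\<phi> x) r"
  have Kc: "compactin X K"
    unfolding K_def by (rule chart_compact[OF U compact_cball order_trans[OF r(2) image_mono[OF Int_lower1]]])
  have K: "\<phi> k \<in> cball (\<phi> x) r" "k \<in> U" "g0 k \<in> ?Q" if kK: "k \<in> K" for k
  proof -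
    obtain w where w: "w \<in> cball (\<phi> x) r" "k = inv_into U \<phi> w" using kK unfolding K_def by blast
    then obtain u where u: "u \<in> U" "g0 u \<in> ?Q" "w = \<phi> u" using r(2) by blast
    then show "\<phi> k \<in> cball (\<phi> x) r" "k \<in> U" "g0 k \<in> ?Q" using w chart_inv[OF U u(1)] by auto
  qed
  have KI: "k \<in> K" if "k \<in> U" "\<phi> k \<in> cball (\<phi> x) r" for k
    using chart_inv[OF U that(1)] imageI[OF that(2), of "inv_into U \<phi>"] unfolding K_def by simp
  have KU: "K \<subseteq> fst (U, \<phi>)" and gK: "g0 ` K \<subseteq> fst (V, \<psi>)" using K by auto
  define \<delta> where "\<delta> = min \<epsilon> (s / 2)"
  have \<delta>: "\<delta> > 0" using \<epsilon> s by (simp add: \<delta>_def)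
  \<comment> \<open>Cancels the dimension factor in
    \<open>lipschitz_of_partial_bounds\<close>.\<close>
  define \<eta> where "\<eta> = \<epsilon> / DIM('e)"
  have \<eta>: "\<eta> > 0" using \<epsilon> by (simp add: \<eta>_def)
  define nb where "nb = (\<lambda>vs \<epsilon>. Cinf_nbhd X \<A> g0 (U, \<phi>) (V, \<psi>) K vs \<epsilon>)"
  have nb: "openin TC (nb vs e)" "g0 \<in> nb vs e" if "e > 0" for vs e
    using openin_Cinf_nbhd[OF g0 U V Kc KU gK that] Cinf_nbhd_self[OF g0 gK that] by (auto simp: nb_def)
  define N where "N = nb [] \<delta> \<inter> (\<Inter>b\<in>Basis. nb [b] \<eta>)"
  define W where "W = {y \<in> U. \<phi> y \<in> ball (\<phi> x) r}"
  have "openin TC N"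
    unfolding N_def by (intro openin_Int openin_INT2 nb \<delta> \<eta>) auto
  moreover have "g0 \<in> N" unfolding N_def using nb \<delta> \<eta> by auto
  moreover have "openin X W" unfolding W_def by (rule chart_open_preimage[OF U open_ball])
  moreover have "x \<in> W" "W \<subseteq> U" using x r by (auto simp: W_def)
  moreover have "g \<in> diffeos X \<A> \<and> (\<forall>y\<in>W. g y \<in> W' \<and> norm (\<psi> (g y) - \<psi> (g0 y)) < \<epsilon>) \<and>
      (\<forall>y\<in>W. \<forall>z\<in>W. norm ((\<psi> (g y) - \<psi> (g0 y)) - (\<psi> (g z) - \<psi> (g0 z))) \<le> \<epsilon> * norm (\<phi> y - \<phi> z))"
    if g: "g \<in> N" for g
  proof -
    let ?F = "\<psi> \<circ> g \<circ> inv_into U \<phi>" and ?E = "\<psi> \<circ> g0 \<circ> inv_into U \<phi>"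
    have gd: "g \<in> diffeos X \<A>" and gV: "g ` K \<subseteq> V"
      using g by (auto simp: N_def nb_def Cinf_nbhd_def)
    have val: "?F (\<phi> y) = \<psi> (g y)" "?E (\<phi> y) = \<psi> (g0 y)" if "y \<in> U" for y
      using chart_inv[OF U that] by auto
    have c0: "norm (\<psi> (g y) - \<psi> (g0 y)) < \<delta>" if "y \<in> K" for y
      using g that val K(2)[OF that] by (auto simp: N_def nb_def Cinf_nbhd_def dist_norm)
    have c1: "norm (frechet_derivative ?F (at (\<phi> y)) b - frechet_derivative ?E (at (\<phi> y)) b) \<le> \<eta>"
      if "y \<in> K" "b \<in> Basis" for y b
    proof -
      have "g \<in> nb [b] \<eta>" using g that(2) by (simp add: N_def)
      then have "dist (iter_deriv [b] ?F (\<phi> y)) (iter_deriv [b] ?E (\<phi> y)) < \<eta>"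
        using that(1) by (simp add: nb_def Cinf_nbhd_def)
      then show ?thesis by (simp add: dist_norm)
    qed
    have WK: "W \<subseteq> K" using KI by (auto simp: W_def)
    have in_W': "g y \<in> W'" if y: "y \<in> K" for y
    proof -
      have "dist (\<psi> (g0 x)) (\<psi> (g y)) \<le> dist (\<psi> (g0 x)) (\<psi> (g0 y)) + dist (\<psi> (g0 y)) (\<psi> (g y))"
        by (rule dist_triangle)
      also have "\<dots> \<le> s / 2 + s / 2"
        using K(3)[OF y] c0[OF y] by (intro add_mono) (auto simp: dist_norm norm_minus_commute \<delta>_def)
      finally have "\<psi> (g y) \<in> \<psi> ` W'" using s(2) by auto
      then show ?thesis
        using chartD(5)[OF V] W'(3) gV y by (auto simp: inj_on_def)
    qed
    have lip: "norm ((?F v - ?E v) - (?F w - ?E w)) \<le> DIM('e) * \<eta> * norm (v - w)"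
      if vw: "v \<in> cball (\<phi> x) r" "w \<in> cball (\<phi> x) r" for v w
    proof (rule lipschitz_of_partial_bounds[of "cball (\<phi> x) r" "\<lambda>v. ?F v - ?E v", OF convex_cball _ _ vw])
      fix v assume v: "v \<in> cball (\<phi> x) r"
      then obtain y where y: "y \<in> U" "v = \<phi> y" using r(2) by blast
      then have yK: "y \<in> K" using KI v by blast
      have *: "v \<in> \<phi> ` (U \<inter> g -` V)" "v \<in> \<phi> ` (U \<inter> g0 -` V)"
        using y yK gV K(3)[OF yK] by auto
      have diff: "?F differentiable at v" "?E differentiable at v"
        using diffeoD(4)[OF gd U V, unfolded smooth_on_def, THEN spec, THEN bspec, OF *(1), of "[]"]
          diffeoD(4)[OF g0 U V, unfolded smooth_on_def, THEN spec, THEN bspec, OF *(2), of "[]"]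
        unfolding iter_deriv.simps .
      then have D: "((\<lambda>v. ?F v - ?E v) has_derivative
          (\<lambda>h. frechet_derivative ?F (at v) h - frechet_derivative ?E (at v) h)) (at v)"
        unfolding frechet_derivative_works by (rule has_derivative_diff)
      then show "(\<lambda>v. ?F v - ?E v) differentiable at v" by (rule differentiableI)
      show "norm (frechet_derivative (\<lambda>v. ?F v - ?E v) (at v) b) \<le> \<eta>" if "b \<in> Basis" for b
        unfolding frechet_derivative_eqI[OF D] using c1[OF yK that] y(2) by simp
    qed
    have "norm ((\<psi> (g y) - \<psi> (g0 y)) - (\<psi> (g z) - \<psi> (g0 z))) \<le> \<epsilon> * norm (\<phi> y - \<phi> z)"
      if yz: "y \<in> W" "z \<in> W" for y z
    proof -
      have yzU: "y \<in> U" "z \<in> U" using yz \<open>W \<subseteq> U\<close> by blast+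
      have "\<phi> y \<in> cball (\<phi> x) r" "\<phi> z \<in> cball (\<phi> x) r"
        using K(1) WK yz by blast+
      moreover have "DIM('e) * \<eta> = \<epsilon>" by (simp add: \<eta>_def)
      ultimately show ?thesis
        using lip[of "\<phi> y" "\<phi> z"] unfolding val[OF yzU(1)] val[OF yzU(2)] by simp
    qed
    then show ?thesis using gd in_W' c0 WK by (auto simp: \<delta>_def)
  qed
  ultimately show ?thesis by (intro exI[of _ N] exI[of _ W] conjI ballI) simp_all
qed

end

section \<open>Uniform closeness and common bi-Lipschitz constants near a diffeomorphism\<close>

context manifold_metric
begin

lemma metric_nbhd:
  assumes "x \<in> topspace X" "0 < \<epsilon>"
  obtains W where "openin X W" "x \<in> W" "\<And>y. y \<in> W \<Longrightarrow> d y x < \<epsilon>"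
proof -
  obtain U \<phi> where U: "(U, \<phi>) \<in> \<A>" "x \<in> U" using chart_at assms(1) by blast
  obtain W L where W: "openin X W" "x \<in> W" "W \<subseteq> U" "0 < L"
    "\<And>y z. y \<in> W \<Longrightarrow> z \<in> W \<Longrightarrow> d y z \<le> L * norm (\<phi> y - \<phi> z)"
    using chart_upper[OF U] by blast
  show ?thesis
  proof (rule that[of "W \<inter> {y \<in> U. \<phi> y \<in> ball (\<phi> x) (\<epsilon> / L)}"])
    show "openin X (W \<inter> {y \<in> U. \<phi> y \<in> ball (\<phi> x) (\<epsilon> / L)})"
      by (intro openin_Int W(1) chart_open_preimage[OF U(1)]) simp
    show "x \<in> W \<inter> {y \<in> U. \<phi> y \<in> ball (\<phi> x) (\<epsilon> / L)}" using W U assms by simp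
    show "d y x < \<epsilon>" if "y \<in> W \<inter> {y \<in> U. \<phi> y \<in> ball (\<phi> x) (\<epsilon> / L)}" for y
    proof -
      have "norm (\<phi> y - \<phi> x) < \<epsilon> / L" using that by (simp add: dist_norm norm_minus_commute)
      then have "L * norm (\<phi> y - \<phi> x) < \<epsilon>" using W(4) by (simp add: field_simps)
      then show ?thesis using W(5)[of y x] W(2) that by simp
    qed
  qed
qed

lemma uniformly_close_nbhd:
  assumes ne: "topspace X \<noteq> {}" and g0: "g0 \<in> diffeos X \<A>" and \<epsilon>: "0 < \<epsilon>"
  shows "\<exists>N. openin TC N \<and> g0 \<in> N \<and> (\<forall>g\<in>N. \<forall>x\<in>topspace X. d (g x) (g0 x) < \<epsilon>)"
proof (rule compact_space_induct[OF cpt])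
  show "\<exists>N. openin TC N \<and> g0 \<in> N \<and> (\<forall>g\<in>N. \<forall>x\<in>{}. d (g x) (g0 x) < \<epsilon>)"
    using openin_topspace[of TC] topspace_Cinf[OF ne] g0 by blast
next
  fix A B
  assume A: "\<exists>N. openin TC N \<and> g0 \<in> N \<and> (\<forall>g\<in>N. \<forall>x\<in>A. d (g x) (g0 x) < \<epsilon>)"
    and B: "\<exists>N. openin TC N \<and> g0 \<in> N \<and> (\<forall>g\<in>N. \<forall>x\<in>B. d (g x) (g0 x) < \<epsilon>)"
  obtain N where N: "openin TC N" "g0 \<in> N" "\<forall>g\<in>N. \<forall>x\<in>A. d (g x) (g0 x) < \<epsilon>" using A by blast
  obtain N' where N': "openin TC N'" "g0 \<in> N'" "\<forall>g\<in>N'. \<forall>x\<in>B. d (g x) (g0 x) < \<epsilon>" using B by blast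
  show "\<exists>N. openin TC N \<and> g0 \<in> N \<and> (\<forall>g\<in>N. \<forall>x\<in>A \<union> B. d (g x) (g0 x) < \<epsilon>)"
    using N N' by (intro exI[of _ "N \<inter> N'"]) auto
next
  fix x assume x: "x \<in> topspace X"
  have gx: "g0 x \<in> topspace X" using Bij_in[OF diffeoD(1)[OF g0] x] .
  obtain V \<psi> where V: "(V, \<psi>) \<in> \<A>" "g0 x \<in> V" using chart_at gx by blast
  obtain U \<phi> where U: "(U, \<phi>) \<in> \<A>" "x \<in> U" using chart_at x by blast
  obtain W' L where W': "openin X W'" "g0 x \<in> W'" "W' \<subseteq> V" "0 < L"
    "\<And>y z. y \<in> W' \<Longrightarrow> z \<in> W' \<Longrightarrow> d y z \<le> L * norm (\<psi> y - \<psi> z)"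
    using chart_upper[OF V] by blast
  have "\<epsilon> / L > 0" using \<epsilon> W'(4) by simp
  from Cinf_local[OF g0 U(1) V(1) U(2) W'(1-3) this]
  obtain N W where NW: "openin TC N" "g0 \<in> N" "openin X W" "x \<in> W"
    "\<And>g y. g \<in> N \<Longrightarrow> y \<in> W \<Longrightarrow> g y \<in> W' \<and> norm (\<psi> (g y) - \<psi> (g0 y)) < \<epsilon> / L"
    by auto
  have "d (g y) (g0 y) < \<epsilon>" if "g \<in> N" "y \<in> W" for g y
  proof -
    have "L * norm (\<psi> (g y) - \<psi> (g0 y)) < \<epsilon>" using NW(5)[OF that] W'(4) by (simp add: field_simps)
    then show ?thesis using W'(5)[of "g y" "g0 y"] NW(5)[OF that] NW(5)[OF NW(2) that(2)] by linarith
  qed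
  then show "\<exists>W. openin X W \<and> x \<in> W \<and>
      (\<exists>N. openin TC N \<and> g0 \<in> N \<and> (\<forall>g\<in>N. \<forall>x\<in>W. d (g x) (g0 x) < \<epsilon>))"
    using NW by blast
qed

text \<open>Bounds on small pieces of \<open>X\<close> say nothing about points in different pieces.
  Estimating on sets of pairs makes compactness of the product of \<open>X\<close> with itself
  applicable.\<close>

definition bilip_pairs :: "('a \<Rightarrow> 'a) \<Rightarrow> ('a \<times> 'a) set \<Rightarrow> bool" where
  "bilip_pairs g0 R \<longleftrightarrow> (\<exists>N C. openin TC N \<and> g0 \<in> N \<and> 0 < C \<and>
    (\<forall>g\<in>N. \<forall>(x, y)\<in>R. d (g x) (g y) \<le> C * d x y \<and> d x y \<le> C * d (g x) (g y)))"

lemma bilip_pairsI: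
  assumes "openin TC N" "g0 \<in> N" "0 < C" "0 < D"
    and "\<And>g x y. g \<in> N \<Longrightarrow> (x, y) \<in> R \<Longrightarrow> d (g x) (g y) \<le> C * d x y \<and> d x y \<le> D * d (g x) (g y)"
  shows "bilip_pairs g0 R"
  unfolding bilip_pairs_def
proof (intro exI conjI ballI)
  show "openin TC N" "g0 \<in> N" "0 < max C D" using assms by auto
  fix g p assume "g \<in> N" "p \<in> R"
  moreover obtain x y where "p = (x, y)" by fastforce
  ultimately have *: "p = (x, y)" "d (g x) (g y) \<le> C * d x y" "d x y \<le> D * d (g x) (g y)"
    using assms(5) by auto
  have "C * d x y \<le> max C D * d x y" "D * d (g x) (g y) \<le> max C D * d (g x) (g y)"
    by (auto intro!: mult_right_mono d_nonneg)
  then show "case p of (x, y) \<Rightarrow> d (g x) (g y) \<le> max C D * d x y \<and> d x y \<le> max C D * d (g x) (g y)"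
    using * by auto
qed

text \<open>In charts \<open>g\<close> is \<open>g0\<close> plus a map of small Lipschitz constant,
  and both \<open>g0\<close> and its inverse are locally Lipschitz, being smooth; the two chart
  bounds of the metric translate the result to \<open>d\<close>.\<close>

lemma bilip_pairs_diagonal:
  assumes g0: "g0 \<in> diffeos X \<A>" and x: "x \<in> topspace X"
  shows "\<exists>W. openin X W \<and> x \<in> W \<and> bilip_pairs g0 (W \<times> W)"
proof -
  let ?S = "topspace X"
  have gx: "g0 x \<in> ?S" using Bij_in[OF diffeoD(1)[OF g0] x] .
  obtain V \<psi> where V: "(V, \<psi>) \<in> \<A>" "g0 x \<in> V" using chart_at gx by blast
  obtain U \<phi> where U: "(U, \<phi>) \<in> \<A>" "x \<in> U" using chart_at x by blast
  obtain W1 L1 where W1: "openin X W1" "x \<in> W1" "0 < L1"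
    "\<And>y z. y \<in> W1 \<Longrightarrow> z \<in> W1 \<Longrightarrow> d y z \<le> L1 * norm (\<phi> y - \<phi> z)"
    using chart_upper[OF U] by blast
  obtain W2 L2 where W2: "openin X W2" "x \<in> W2" "0 < L2"
    "\<And>y z. y \<in> W2 \<Longrightarrow> z \<in> W2 \<Longrightarrow> norm (\<phi> y - \<phi> z) \<le> L2 * d y z"
    using chart_lower[OF U] by blast
  obtain W3 L3 where W3: "openin X W3" "g0 x \<in> W3" "W3 \<subseteq> V" "0 < L3"
    "\<And>y z. y \<in> W3 \<Longrightarrow> z \<in> W3 \<Longrightarrow> d y z \<le> L3 * norm (\<psi> y - \<psi> z)"
    using chart_upper[OF V] by blast
  obtain W4 L4 where W4: "openin X W4" "g0 x \<in> W4" "W4 \<subseteq> V" "0 < L4"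
    "\<And>y z. y \<in> W4 \<Longrightarrow> z \<in> W4 \<Longrightarrow> norm (\<psi> y - \<psi> z) \<le> L4 * d y z"
    using chart_lower[OF V] by blast
  have o5: "openin X (U \<inter> g0 -` V)"
    by (rule openin_preimage[OF U(1) diffeoD(2)[OF g0] chartD(1)[OF V(1)]])
  obtain W5 L5 where W5: "openin X W5" "x \<in> W5" "W5 \<subseteq> U \<inter> g0 -` V" "0 < L5"
    "\<And>y z. y \<in> W5 \<Longrightarrow> z \<in> W5 \<Longrightarrow> norm ((\<psi> \<circ> g0 \<circ> inv_into U \<phi>) (\<phi> y) - (\<psi> \<circ> g0 \<circ> inv_into U \<phi>) (\<phi> z))
        \<le> L5 * norm (\<phi> y - \<phi> z)"
    using local_lipschitz[OF U(1) o5 _ _ diffeoD(4)[OF g0 U(1) V(1)], of x] U(2) V(2) by blast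
  let ?k = "inv_into ?S g0"
  have kg: "?k (g0 y) = y" if "y \<in> ?S" for y
    using diffeoD(1)[OF g0] that by (auto simp: Bij_def bij_betw_def)
  have o6: "openin X (V \<inter> ?k -` U)"
    by (rule openin_preimage[OF V(1) diffeoD(3)[OF g0] chartD(1)[OF U(1)]])
  obtain W6 L6 where W6: "openin X W6" "g0 x \<in> W6" "W6 \<subseteq> V \<inter> ?k -` U" "0 < L6"
    "\<And>y z. y \<in> W6 \<Longrightarrow> z \<in> W6 \<Longrightarrow> norm ((\<phi> \<circ> ?k \<circ> inv_into V \<psi>) (\<psi> y) - (\<phi> \<circ> ?k \<circ> inv_into V \<psi>) (\<psi> z))
        \<le> L6 * norm (\<psi> y - \<psi> z)"
    using local_lipschitz[OF V(1) o6 _ _ diffeoD(5)[OF g0 V(1) U(1)], of "g0 x"] U(2) V(2) kg[OF x] by auto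
  let ?W' = "W3 \<inter> W4 \<inter> W6"
  \<comment> \<open>Chosen so that in the lower estimate a \<le> L6 b + L6 \<epsilon> a the last
    term is a / 2 and can be absorbed on the left.\<close>
  define \<epsilon> where "\<epsilon> = 1 / (2 * L6)"
  have \<epsilon>: "\<epsilon> > 0" using W6(4) by (simp add: \<epsilon>_def)
  have "openin X ?W'" "g0 x \<in> ?W'" "?W' \<subseteq> V" using W3 W4 W6 by auto
  from Cinf_local[OF g0 U(1) V(1) U(2) this \<epsilon>]
  obtain N W0 where NW: "openin TC N" "g0 \<in> N" "openin X W0" "x \<in> W0" "W0 \<subseteq> U"
    "\<And>g y. g \<in> N \<Longrightarrow> y \<in> W0 \<Longrightarrow> g y \<in> ?W'"
    "\<And>g y z. g \<in> N \<Longrightarrow> y \<in> W0 \<Longrightarrow> z \<in> W0 \<Longrightarrow>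
      norm ((\<psi> (g y) - \<psi> (g0 y)) - (\<psi> (g z) - \<psi> (g0 z))) \<le> \<epsilon> * norm (\<phi> y - \<phi> z)"
    by auto
  let ?W = "W0 \<inter> W1 \<inter> W2 \<inter> W5"
  have "bilip_pairs g0 (?W \<times> ?W)"
  proof (rule bilip_pairsI[OF NW(1,2)])
    show "0 < L3 * ((L5 + \<epsilon>) * L2)" "0 < L1 * (2 * L6 * L4)"
      using W1 W2 W3 W4 W5 W6 \<epsilon> by (auto intro!: mult_pos_pos add_pos_pos)
    fix g y z assume g: "g \<in> N" and yz: "(y, z) \<in> ?W \<times> ?W"
    have U': "y \<in> U" "z \<in> U" using yz NW(5) by auto
    have S': "y \<in> ?S" "z \<in> ?S" using U' chartD(4)[OF U(1)] by auto
    have V': "g0 y \<in> V" "g0 z \<in> V" using yz W5(3) by auto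
    have gW: "g y \<in> ?W'" "g z \<in> ?W'" "g0 y \<in> ?W'" "g0 z \<in> ?W'"
      using NW(6)[OF g] NW(6)[OF NW(2)] yz by auto
    define a where "a = norm (\<phi> y - \<phi> z)"
    define b where "b = norm (\<psi> (g y) - \<psi> (g z))"
    define b0 where "b0 = norm (\<psi> (g0 y) - \<psi> (g0 z))"
    have 1: "b0 \<le> L5 * a" using W5(5)[of y z] yz U' U(1) by (simp add: a_def b0_def)
    have 2: "a \<le> L6 * b0"
      using W6(5)[of "g0 y" "g0 z"] gW V' V(1) kg S' by (simp add: a_def b0_def)
    have e: "norm ((\<psi> (g y) - \<psi> (g z)) - (\<psi> (g0 y) - \<psi> (g0 z))) \<le> \<epsilon> * a"
      using NW(7)[OF g, of y z] yz by (simp add: a_def algebra_simps)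
    have 3: "b \<le> b0 + \<epsilon> * a" "b0 \<le> b + \<epsilon> * a"
      using e norm_triangle_sub[of "\<psi> (g y) - \<psi> (g z)" "\<psi> (g0 y) - \<psi> (g0 z)"]
        norm_triangle_sub[of "\<psi> (g0 y) - \<psi> (g0 z)" "\<psi> (g y) - \<psi> (g z)"]
      unfolding b_def b0_def by (auto simp: norm_minus_commute)
    have u: "b \<le> (L5 + \<epsilon>) * a" using 1 3 by (simp add: algebra_simps)
    have "L6 * (\<epsilon> * a) = a / 2" using W6(4) by (simp add: \<epsilon>_def)
    moreover have "L6 * b0 \<le> L6 * b + L6 * (\<epsilon> * a)"
      using mult_left_mono[OF 3(2), of L6] W6(4) by (simp add: distrib_left)
    ultimately have l: "a \<le> 2 * L6 * b" using 2 by linarith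
    have "d (g y) (g z) \<le> L3 * b" using W3(5)[of "g y" "g z"] gW by (simp add: b_def)
    also have "\<dots> \<le> L3 * ((L5 + \<epsilon>) * a)" using u W3(4) by simp
    also have "\<dots> \<le> L3 * ((L5 + \<epsilon>) * (L2 * d y z))"
      using W2(4)[of y z] yz W3(4) W5(4) \<epsilon> by (intro mult_left_mono) (auto simp: a_def)
    finally have A: "d (g y) (g z) \<le> L3 * ((L5 + \<epsilon>) * L2) * d y z" by (simp add: mult_ac)
    have "d y z \<le> L1 * a" using W1(4)[of y z] yz by (simp add: a_def)
    also have "\<dots> \<le> L1 * (2 * L6 * b)" using l W1(3) by simp
    also have "\<dots> \<le> L1 * (2 * L6 * (L4 * d (g y) (g z)))"
      using W4(5)[of "g y" "g z"] gW W1(3) W6(4) by (intro mult_left_mono) (auto simp: b_def)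
    finally show "d (g y) (g z) \<le> L3 * ((L5 + \<epsilon>) * L2) * d y z \<and>
        d y z \<le> L1 * (2 * L6 * L4) * d (g y) (g z)"
      using A by (simp add: mult_ac)
  qed
  moreover have "openin X ?W" "x \<in> ?W" using NW W1 W2 W5 by auto
  ultimately show ?thesis by blast
qed

text \<open>Away from the diagonal no derivative is involved: the distances of the points and of
  their images stay above positive constants and below \<open>M\<close>, so their ratios are
  bounded.\<close>

lemma bilip_pairs_off_diagonal:
  assumes g0: "g0 \<in> diffeos X \<A>" and xy: "x \<in> topspace X" "y \<in> topspace X" "x \<noteq> y"
  shows "\<exists>A B. openin X A \<and> openin X B \<and> x \<in> A \<and> y \<in> B \<and> bilip_pairs g0 (A \<times> B)"
proof -
  let ?S = "topspace X"
  have gB: "g0 \<in> Bij ?S" by (rule diffeoD(1)[OF g0])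
  have gxy: "g0 x \<in> ?S" "g0 y \<in> ?S" "g0 x \<noteq> g0 y"
    using Bij_in[OF gB] xy gB by (auto simp: Bij_def bij_betw_def inj_on_def)
  \<comment> \<open>A third, because both endpoints move by less than \<eta> and \<eta> must remain.
    For the images a fifth: each endpoint moves once within its neighbourhood and once from
    \<open>g0\<close> to \<open>g\<close>.\<close>
  define \<eta> where "\<eta> = d x y / 3"
  define \<theta> where "\<theta> = d (g0 x) (g0 y) / 5"
  have "d x y \<noteq> 0" "d (g0 x) (g0 y) \<noteq> 0" using d_zero xy gxy by blast+
  then have \<eta>: "\<eta> > 0" and \<theta>: "\<theta> > 0"
    using d_nonneg[of x y] d_nonneg[of "g0 x" "g0 y"] by (auto simp: \<eta>_def \<theta>_def)
  obtain A1 where A1: "openin X A1" "x \<in> A1" "\<And>u. u \<in> A1 \<Longrightarrow> d u x < \<eta>"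
    using metric_nbhd[OF xy(1) \<eta>] by blast
  obtain B1 where B1: "openin X B1" "y \<in> B1" "\<And>u. u \<in> B1 \<Longrightarrow> d u y < \<eta>"
    using metric_nbhd[OF xy(2) \<eta>] by blast
  obtain A2 where A2: "openin X A2" "g0 x \<in> A2" "\<And>u. u \<in> A2 \<Longrightarrow> d u (g0 x) < \<theta>"
    using metric_nbhd[OF gxy(1) \<theta>] by blast
  obtain B2 where B2: "openin X B2" "g0 y \<in> B2" "\<And>u. u \<in> B2 \<Longrightarrow> d u (g0 y) < \<theta>"
    using metric_nbhd[OF gxy(2) \<theta>] by blast
  obtain N where N: "openin TC N" "g0 \<in> N" "\<And>g x. g \<in> N \<Longrightarrow> x \<in> ?S \<Longrightarrow> d (g x) (g0 x) < \<theta>"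
    using uniformly_close_nbhd[OF _ g0 \<theta>] xy(1) by blast
  have Nd: "g \<in> diffeos X \<A>" if "g \<in> N" for g
    using that openin_subset[OF N(1)] topspace_Cinf xy(1) by blast
  let ?A = "A1 \<inter> {u \<in> ?S. g0 u \<in> A2}" and ?B = "B1 \<inter> {u \<in> ?S. g0 u \<in> B2}"
  have "M > 0" using d_bound[OF xy(1,2)] \<eta> by (simp add: \<eta>_def)
  have "bilip_pairs g0 (?A \<times> ?B)"
  proof (rule bilip_pairsI[OF N(1,2)])
    show "0 < M / \<eta>" "0 < M / \<theta>" using \<open>M > 0\<close> \<eta> \<theta> by auto
    fix g u v assume g: "g \<in> N" and uv: "(u, v) \<in> ?A \<times> ?B"
    have S: "u \<in> ?S" "v \<in> ?S" "g u \<in> ?S" "g v \<in> ?S"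
      using uv Bij_in[OF diffeoD(1)[OF Nd[OF g]]] by auto
    have "d x y \<le> d u x + d u v + d v y"
      using d_triangle[of x y u] d_triangle[of u y v] d_sym[of x u] by linarith
    then have 1: "\<eta> \<le> d u v" using A1(3)[of u] B1(3)[of v] uv by (simp add: \<eta>_def)
    have "d (g0 x) (g0 y) \<le> d (g0 u) (g0 x) + (d (g u) (g0 u) + d (g u) (g v) + d (g v) (g0 v)) + d (g0 v) (g0 y)"
      using d_triangle[of "g0 x" "g0 y" "g0 u"] d_triangle[of "g0 u" "g0 y" "g u"]
        d_triangle[of "g u" "g0 y" "g v"] d_triangle[of "g v" "g0 y" "g0 v"]
        d_sym[of "g0 x" "g0 u"] d_sym[of "g0 u" "g u"] by linarith
    then have 2: "\<theta> \<le> d (g u) (g v)"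
      using A2(3)[of "g0 u"] B2(3)[of "g0 v"] uv N(3)[OF g S(1)] N(3)[OF g S(2)] by (simp add: \<theta>_def)
    have "d (g u) (g v) \<le> M" "d u v \<le> M" using d_bound S by auto
    moreover have "M \<le> M / \<eta> * d u v" "M \<le> M / \<theta> * d (g u) (g v)"
      using 1 2 \<eta> \<theta> \<open>M > 0\<close> by (simp_all add: field_simps)
    ultimately show "d (g u) (g v) \<le> M / \<eta> * d u v \<and> d u v \<le> M / \<theta> * d (g u) (g v)" by linarith
  qed
  moreover have "openin X ?A" "openin X ?B" "x \<in> ?A" "y \<in> ?B"
    using A1 B1 A2 B2 xy openin_continuous_map_preimage[OF diffeoD(2)[OF g0]] by auto
  ultimately show ?thesis by blast
qed

lemma bilip_nbhd:
  assumes g0: "g0 \<in> diffeos X \<A>" and ne: "topspace X \<noteq> {}"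
  shows "\<exists>N C. openin TC N \<and> g0 \<in> N \<and> (\<forall>g\<in>N. bilip C g)"
proof -
  have "bilip_pairs g0 (topspace (prod_topology X X))"
  proof (rule compact_space_induct)
    show "compact_space (prod_topology X X)" using cpt by (simp add: compact_space_prod_topology)
    have "g0 \<in> topspace TC" using g0 topspace_Cinf[OF ne] by simp
    then show "bilip_pairs g0 {}"
      by (intro bilip_pairsI[OF openin_topspace _ zero_less_one zero_less_one]) auto
    show "bilip_pairs g0 (A \<union> B)" if AB: "bilip_pairs g0 A" "bilip_pairs g0 B" for A B
    proof -
      obtain N C where N: "openin TC N" "g0 \<in> N" "0 < C"
        "\<And>g x y. g \<in> N \<Longrightarrow> (x, y) \<in> A \<Longrightarrow> d (g x) (g y) \<le> C * d x y \<and> d x y \<le> C * d (g x) (g y)"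
        using AB(1) unfolding bilip_pairs_def by blast
      obtain N' C' where N': "openin TC N'" "g0 \<in> N'" "0 < C'"
        "\<And>g x y. g \<in> N' \<Longrightarrow> (x, y) \<in> B \<Longrightarrow> d (g x) (g y) \<le> C' * d x y \<and> d x y \<le> C' * d (g x) (g y)"
        using AB(2) unfolding bilip_pairs_def by blast
      show ?thesis
      proof (rule bilip_pairsI[of "N \<inter> N'" _ "max C C'" "max C C'"])
        fix g x y assume g: "g \<in> N \<inter> N'" and xy: "(x, y) \<in> A \<union> B"
        have "C * d x y \<le> max C C' * d x y" "C' * d x y \<le> max C C' * d x y"
          "C * d (g x) (g y) \<le> max C C' * d (g x) (g y)" "C' * d (g x) (g y) \<le> max C C' * d (g x) (g y)"
          by (auto intro!: mult_right_mono d_nonneg)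
        then show "d (g x) (g y) \<le> max C C' * d x y \<and> d x y \<le> max C C' * d (g x) (g y)"
          using N(4)[of g x y] N'(4)[of g x y] g xy by fastforce
      qed (use N N' in auto)
    qed
    fix p assume "p \<in> topspace (prod_topology X X)"
    then obtain x y where p: "p = (x, y)" "x \<in> topspace X" "y \<in> topspace X" by auto
    have "\<exists>A B. openin X A \<and> openin X B \<and> x \<in> A \<and> y \<in> B \<and> bilip_pairs g0 (A \<times> B)"
      using bilip_pairs_diagonal[OF g0 p(2)] bilip_pairs_off_diagonal[OF g0 p(2,3)] by (cases "x = y") blast+
    then obtain A B where "openin X A" "openin X B" "x \<in> A" "y \<in> B" "bilip_pairs g0 (A \<times> B)" by blast
    then show "\<exists>O'. openin (prod_topology X X) O' \<and> p \<in> O' \<and> bilip_pairs g0 O'"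
      by (intro exI[of _ "A \<times> B"]) (auto simp: p openin_prod_Times_iff)
  qed
  then obtain N C where N: "openin TC N" "g0 \<in> N" "0 < C"
    "\<And>g x y. g \<in> N \<Longrightarrow> x \<in> topspace X \<Longrightarrow> y \<in> topspace X \<Longrightarrow>
      d (g x) (g y) \<le> C * d x y \<and> d x y \<le> C * d (g x) (g y)"
    unfolding bilip_pairs_def by fastforce
  have "bilip (max 1 C) g" if g: "g \<in> N" for g
  proof -
    have "g \<in> diffeos X \<A>" using g openin_subset[OF N(1)] topspace_Cinf[OF ne] by blast
    moreover have "C * d x y \<le> max 1 C * d x y" for x y
      by (intro mult_right_mono d_nonneg) auto
    ultimately show ?thesis
      using N(4)[OF g] unfolding bilip_def by (meson diffeoD(1) max.cobounded1 order_trans)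
  qed
  then show ?thesis using N by blast
qed

end

section \<open>A diffeomorphism moving a given point\<close>

context compact_manifold
begin

text \<open>The map \<open>G\<close> transported through the chart and continued by the identity;
  \<open>restrict\<close> provides the extensional form that \<open>Bij\<close> demands.\<close>

definition chart_map :: "('a, 'e) chart \<Rightarrow> ('e \<Rightarrow> 'e) \<Rightarrow> 'a \<Rightarrow> 'a" where
  "chart_map = (\<lambda>(U, \<phi>) G. \<lambda>x\<in>topspace X. if x \<in> U then inv_into U \<phi> (G (\<phi> x)) else x)"

lemma chart_map_in_out:
  assumes U: "(U, \<phi>) \<in> \<A>" and GU: "G ` \<phi> ` U \<subseteq> \<phi> ` U"
  shows "x \<in> U \<Longrightarrow> chart_map (U, \<phi>) G x \<in> U" "x \<in> U \<Longrightarrow> \<phi> (chart_map (U, \<phi>) G x) = G (\<phi> x)"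
    "x \<in> topspace X \<Longrightarrow> x \<notin> U \<Longrightarrow> chart_map (U, \<phi>) G x = x"
proof -
  have *: "chart_map (U, \<phi>) G x = inv_into U \<phi> (G (\<phi> x))" "G (\<phi> x) \<in> \<phi> ` U" if "x \<in> U"
    using that chartD(4)[OF U] GU by (auto simp: chart_map_def)
  show "x \<in> U \<Longrightarrow> chart_map (U, \<phi>) G x \<in> U" "x \<in> U \<Longrightarrow> \<phi> (chart_map (U, \<phi>) G x) = G (\<phi> x)"
    using * by (simp_all add: inv_into_into f_inv_into_f)
qed (simp add: chart_map_def)

text \<open>Two open sets cover the space: on \<open>U\<close> the map is \<open>G\<close> in
  coordinates, and off the preimage \<open>C\<close> of the closed ball it is the identity.
  \<open>C\<close> is compact, hence closed.\<close>

lemma smooth_map_chart_map: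
  assumes U: "(U, \<phi>) \<in> \<A>" and K: "cball c r \<subseteq> \<phi> ` U" and GU: "G ` \<phi> ` U \<subseteq> \<phi> ` U"
    and G: "smooth_on UNIV G" "\<And>x. r \<le> dist x c \<Longrightarrow> G x = x"
  shows "smooth_map X \<A> X \<A> (chart_map (U, \<phi>) G)"
proof -
  let ?f = "chart_map (U, \<phi>) G"
  note f = chart_map_in_out[OF U GU]
  define C where "C = inv_into U \<phi> ` cball c r"
  have C: "closedin X C" "C \<subseteq> U"
    using compactin_imp_closedin[OF Hausdorff chart_compact[OF U _ K]] K
    by (auto simp: C_def intro: inv_into_into)
  have idC: "?f x = x" if "x \<in> topspace X" "x \<notin> C" for x
  proof (cases "x \<in> U")
    case True
    have "\<phi> x \<notin> cball c r"
    proof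
      assume "\<phi> x \<in> cball c r"
      from imageI[OF this, of "inv_into U \<phi>"] show False
        using that(2) chart_inv[OF U True] by (simp add: C_def)
    qed
    then have "G (\<phi> x) = \<phi> x" by (intro G(2)) (simp add: dist_commute)
    then have "\<phi> (?f x) = \<phi> x" using f(2)[OF True] by simp
    then show ?thesis using inj_onD[OF chartD(5)[OF U] _ f(1)[OF True] True] by simp
  qed (use f(3) that in auto)
  have "continuous_on UNIV G"
  proof -
    have "G differentiable at x" for x
      using G(1)[unfolded smooth_on_def, THEN spec, of "[]"] by simp
    then show ?thesis
      by (simp add: continuous_on_eq_continuous_at differentiable_imp_continuous_within)
  qed
  have op: "openin X {x \<in> topspace X. ?f x \<in> V}" if V: "openin X V" for V
  proof -
    have oV: "open (\<phi> ` (U \<inter> V))"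
      by (rule chart_open_image[OF U openin_Int[OF chartD(1)[OF U] V] Int_lower1])
    have "open (G -` \<phi> ` (U \<inter> V))"
      using \<open>continuous_on UNIV G\<close> oV by (simp add: continuous_on_open_vimage)
    then have "openin X ({x \<in> U. \<phi> x \<in> G -` \<phi> ` (U \<inter> V)} \<union> (V - C))"
      by (intro openin_Un chart_open_preimage[OF U] openin_diff V C)
    moreover have "{x \<in> topspace X. ?f x \<in> V} = {x \<in> U. \<phi> x \<in> G -` \<phi> ` (U \<inter> V)} \<union> (V - C)"
    proof (intro equalityI subsetI)
      fix x assume x: "x \<in> {x \<in> topspace X. ?f x \<in> V}"
      show "x \<in> {x \<in> U. \<phi> x \<in> G -` \<phi> ` (U \<inter> V)} \<union> (V - C)"
      proof (cases "x \<in> U")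
        case True
        then have "?f x \<in> U \<inter> V" using f(1) x by simp
        from imageI[OF this, of \<phi>] have "G (\<phi> x) \<in> \<phi> ` (U \<inter> V)" using f(2)[OF True] by simp
        then show ?thesis using True by simp
      next
        case False
        then show ?thesis using x f(3) C(2) by auto
      qed
    next
      fix x assume x: "x \<in> {x \<in> U. \<phi> x \<in> G -` \<phi> ` (U \<inter> V)} \<union> (V - C)"
      then consider "x \<in> U" "G (\<phi> x) \<in> \<phi> ` (U \<inter> V)" | "x \<in> V" "x \<notin> C" by auto
      then show "x \<in> {x \<in> topspace X. ?f x \<in> V}"
      proof cases
        case 1
        then obtain v where v: "v \<in> U" "v \<in> V" "\<phi> (?f x) = \<phi> v" using f(2) by auto
        then have "?f x = v" using inj_onD[OF chartD(5)[OF U] v(3) f(1)[OF 1(1)] v(1)] by simp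
        then show ?thesis using v 1 chartD(4)[OF U] by auto
      next
        case 2
        then show ?thesis using idC openin_subset[OF V] by auto
      qed
    qed
    ultimately show ?thesis by simp
  qed
  have cont: "continuous_map X X ?f"
    unfolding continuous_map_alt
  proof
    show "?f \<in> topspace X \<rightarrow> topspace X"
    proof
      fix x assume "x \<in> topspace X"
      then show "?f x \<in> topspace X"
        using f(1,3) chartD(4)[OF U] by (cases "x \<in> U") auto
    qed
    have "?f -` V \<inter> topspace X = {x \<in> topspace X. ?f x \<in> V}" for V by auto
    then show "\<forall>V. openin X V \<longrightarrow> openin X (?f -` V \<inter> topspace X)" using op by simp
  qed
  have "smooth_on (\<phi>1 ` (U1 \<inter> ?f -` V)) (\<psi> \<circ> ?f \<circ> inv_into U1 \<phi>1)"
    if U1: "(U1, \<phi>1) \<in> \<A>" and V: "(V, \<psi>) \<in> \<A>" for U1 \<phi>1 V \<psi>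
  proof (rule smooth_on_pointwise)
    fix w assume "w \<in> \<phi>1 ` (U1 \<inter> ?f -` V)"
    then obtain x where x: "w = \<phi>1 x" "x \<in> U1" "?f x \<in> V" by auto
    have oW: "openin X (U1 \<inter> ?f -` V)"
      by (rule openin_preimage[OF U1 cont chartD(1)[OF V]])
    show "\<exists>W. w \<in> W \<and> smooth_on W (\<psi> \<circ> ?f \<circ> inv_into U1 \<phi>1)"
    proof (cases "x \<in> U")
      case True
      define W where "W = U \<inter> (U1 \<inter> ?f -` V)"
      have W: "openin X W" unfolding W_def by (intro openin_Int chartD(1)[OF U] oW)
      have o: "open (\<phi>1 ` W)" by (rule chart_open_image[OF U1 W]) (auto simp: W_def)
      have s1: "smooth_on (\<phi>1 ` W) (\<phi> \<circ> inv_into U1 \<phi>1)"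
        by (rule smooth_on_subset[OF transition_smooth[OF U1 U]]) (auto simp: W_def)
      have s2: "smooth_on (\<phi>1 ` W) (G \<circ> (\<phi> \<circ> inv_into U1 \<phi>1))"
        by (rule smooth_on_compose[OF o _ G(1) s1]) simp
      have val: "(G \<circ> (\<phi> \<circ> inv_into U1 \<phi>1)) (\<phi>1 y) = \<phi> (?f y)" if "y \<in> W" for y
        using that chart_inv[OF U1, of y] f(2)[of y] by (simp add: W_def)
      have im: "(G \<circ> (\<phi> \<circ> inv_into U1 \<phi>1)) ` \<phi>1 ` W \<subseteq> \<phi> ` (U \<inter> V)"
        using val f(1) by (force simp: W_def)
      have s3: "smooth_on (\<phi>1 ` W) ((\<psi> \<circ> inv_into U \<phi>) \<circ> (G \<circ> (\<phi> \<circ> inv_into U1 \<phi>1)))"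
        by (rule smooth_on_compose[OF o im transition_smooth[OF U V] s2])
      have "((\<psi> \<circ> inv_into U \<phi>) \<circ> (G \<circ> (\<phi> \<circ> inv_into U1 \<phi>1))) w = (\<psi> \<circ> ?f \<circ> inv_into U1 \<phi>1) w"
        if "w \<in> \<phi>1 ` W" for w
      proof -
        obtain y where y: "y \<in> W" "w = \<phi>1 y" using \<open>w \<in> \<phi>1 ` W\<close> by blast
        then have "y \<in> U" "y \<in> U1" by (auto simp: W_def)
        then show ?thesis
          using val[OF y(1)] chart_inv[OF U1, of y] chart_inv[OF U f(1)[of y]] y(2) by simp
      qed
      from smooth_on_cong[OF o this s3]
      have "smooth_on (\<phi>1 ` W) (\<psi> \<circ> ?f \<circ> inv_into U1 \<phi>1)" .
      moreover have "w \<in> \<phi>1 ` W" using x True by (auto simp: W_def)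
      ultimately show ?thesis by blast
    next
      case False
      define W where "W = (U1 \<inter> V) - C"
      have W: "openin X W" unfolding W_def by (intro openin_diff openin_Int chartD(1)[OF U1] chartD(1)[OF V] C)
      have o: "open (\<phi>1 ` W)" by (rule chart_open_image[OF U1 W]) (auto simp: W_def)
      have s: "smooth_on (\<phi>1 ` W) (\<psi> \<circ> inv_into U1 \<phi>1)"
        by (rule smooth_on_subset[OF transition_smooth[OF U1 V]]) (auto simp: W_def)
      have "(\<psi> \<circ> inv_into U1 \<phi>1) w = (\<psi> \<circ> ?f \<circ> inv_into U1 \<phi>1) w" if w: "w \<in> \<phi>1 ` W" for w
      proof -
        obtain y where y: "y \<in> W" "w = \<phi>1 y" using w by blast
        then have "y \<in> U1" "y \<notin> C" by (auto simp: W_def)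
        then show ?thesis
          using chart_inv[OF U1, of y] idC[of y] chartD(4)[OF U1] y(2) by auto
      qed
      from smooth_on_cong[OF o this s]
      have "smooth_on (\<phi>1 ` W) (\<psi> \<circ> ?f \<circ> inv_into U1 \<phi>1)" .
      moreover have "?f x = x" using f(3) False chartD(4)[OF U1] x(2) by auto
      then have "w \<in> \<phi>1 ` W" using x False C(2) by (auto simp: W_def)
      ultimately show ?thesis by blast
    qed
  qed
  then show ?thesis unfolding smooth_map_def using cont by auto
qed

text \<open>Used for the inverse: \<open>diffeos\<close> speaks of
  \<open>inv_into (topspace X) f\<close>, which is identified with the explicit inverse on
  \<open>topspace X\<close> only.\<close>

lemma smooth_map_cong:
  assumes "smooth_map X \<A> X \<A> f" "\<And>x. x \<in> topspace X \<Longrightarrow> f x = g x"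
  shows "smooth_map X \<A> X \<A> g"
proof -
  have cf: "continuous_map X X f" using assms(1) by (simp add: smooth_map_def)
  have "smooth_on (\<phi> ` (U \<inter> g -` V)) (\<psi> \<circ> g \<circ> inv_into U \<phi>)"
    if U: "(U, \<phi>) \<in> \<A>" and V: "(V, \<psi>) \<in> \<A>" for U \<phi> V \<psi>
  proof -
    have eq: "U \<inter> g -` V = U \<inter> f -` V" using assms(2) chartD(4)[OF U] by auto
    have o: "open (\<phi> ` (U \<inter> f -` V))"
      by (rule chart_open_image[OF U openin_preimage[OF U cf chartD(1)[OF V]] Int_lower1])
    have s: "smooth_on (\<phi> ` (U \<inter> f -` V)) (\<psi> \<circ> f \<circ> inv_into U \<phi>)"
      using assms(1) U V by (auto simp: smooth_map_def)
    show ?thesis unfolding eq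
      by (rule smooth_on_cong[OF o _ s]) (use U chartD(4)[OF U] assms(2) in auto)
  qed
  moreover have "continuous_map X X g"
    by (rule continuous_map_eq[OF cf assms(2)])
  ultimately show ?thesis by (auto simp: smooth_map_def)
qed

lemma diffeo_moving_point:
  assumes p: "p \<in> topspace X"
  obtains f where "f \<in> diffeos X \<A>" "f p \<noteq> p"
proof -
  obtain U \<phi> where U: "(U, \<phi>) \<in> \<A>" "p \<in> U" using chart_at p by blast
  obtain r where r: "r > 0" "cball (\<phi> p) r \<subseteq> \<phi> ` U"
    using chart_ball_preimage[OF U(1) chartD(1)[OF U(1)] order_refl U(2)] .
  obtain G h :: "'e \<Rightarrow> 'e" where Gh: "smooth_on UNIV G" "smooth_on UNIV h"
    "\<And>x. h (G x) = x" "\<And>x. G (h x) = x" "\<And>x. r \<le> dist x (\<phi> p) \<Longrightarrow> G x = x" "G (\<phi> p) \<noteq> \<phi> p"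
    using ball_diffeo[OF r(1)] by metis
  have h: "h x = x" if "r \<le> dist x (\<phi> p)" for x
    using Gh(3)[of x] Gh(5)[OF that] by simp
  have GU: "G ` \<phi> ` U \<subseteq> \<phi> ` U"
  proof clarify
    fix x assume x: "x \<in> U"
    \<comment> \<open>The split is on the image: if it lies outside the ball, \<open>h\<close> fixes
      it, so it equals \<phi> x; otherwise it lies in the ball, which is contained in the chart
      image.\<close>
    show "G (\<phi> x) \<in> \<phi> ` U"
    proof (cases "r \<le> dist (G (\<phi> x)) (\<phi> p)")
      case True
      then have "G (\<phi> x) = \<phi> x" using h[OF True] Gh(3) by simp
      then show ?thesis using x by simp
    next
      case False
      then show ?thesis using r(2) by (auto simp: dist_commute)
    qed
  qed
  have hU: "h ` \<phi> ` U \<subseteq> \<phi> ` U"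
  proof clarify
    fix x assume x: "x \<in> U"
    show "h (\<phi> x) \<in> \<phi> ` U"
    proof (cases "r \<le> dist (h (\<phi> x)) (\<phi> p)")
      case True
      then have "h (\<phi> x) = \<phi> x" using Gh(5)[OF True] Gh(4) by simp
      then show ?thesis using x by simp
    next
      case False
      then show ?thesis using r(2) by (auto simp: dist_commute)
    qed
  qed
  let ?f = "chart_map (U, \<phi>) G" and ?k = "chart_map (U, \<phi>) h"
  note fG = chart_map_in_out[OF U(1) GU] and fh = chart_map_in_out[OF U(1) hU]
  have in_S: "?f x \<in> topspace X" "?k x \<in> topspace X" if "x \<in> topspace X" for x
    using that fG(1,3) fh(1,3) chartD(4)[OF U(1)] by (cases "x \<in> U"; auto)+
  have inv: "?k (?f x) = x" "?f (?k x) = x" if x: "x \<in> topspace X" for x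
  proof -
    show "?k (?f x) = x"
    proof (cases "x \<in> U")
      case True
      then show ?thesis
        using inj_onD[OF chartD(5)[OF U(1)], of "?k (?f x)" x] fG(1,2) fh(1,2) Gh(3) by simp
    qed (use x fG(3) fh(3) in simp)
    show "?f (?k x) = x"
    proof (cases "x \<in> U")
      case True
      then show ?thesis
        using inj_onD[OF chartD(5)[OF U(1)], of "?f (?k x)" x] fG(1,2) fh(1,2) Gh(4) by simp
    qed (use x fG(3) fh(3) in simp)
  qed
  have bij: "bij_betw ?f (topspace X) (topspace X)"
    by (rule bij_betw_byWitness[where f' = ?k]) (use inv in_S in auto)
  moreover have "?f \<in> extensional (topspace X)" by (simp add: chart_map_def)
  ultimately have "?f \<in> Bij (topspace X)" by (simp add: Bij_def)
  moreover have "smooth_map X \<A> X \<A> ?f"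
    by (rule smooth_map_chart_map[OF U(1) r(2) GU Gh(1,5)])
  moreover have "smooth_map X \<A> X \<A> (inv_into (topspace X) ?f)"
  proof (rule smooth_map_cong[OF smooth_map_chart_map[OF U(1) r(2) hU Gh(2) h]])
    fix x assume "x \<in> topspace X"
    then show "?k x = inv_into (topspace X) ?f x"
      using inv_into_f_eq[OF bij_betw_imp_inj_on[OF bij] in_S(2) inv(2)] by simp
  qed auto
  moreover have "?f p \<noteq> p" using fG(2)[OF U(2)] Gh(6) by auto
  ultimately show ?thesis using that[of ?f] by (auto simp: diffeos_def)
qed

end

section \<open>The plain and the twisted homomorphism of the diffeomorphism group\<close>

theorem mainTheorem2:
  fixes X :: "'a topology"
    and \<A> :: "('a, 'e::euclidean_space) chart set"
    and p :: 'a
  assumes "smooth_manifold X \<A>"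
    and "compact_space X"
    and "connected_space X"
    and "p \<in> topspace X"
  shows "continuous_hom
           (stabilizer X \<A> p) (subtopology (Cinf_topology X \<A>) (carrier (stabilizer X \<A> p)))
           (Diff X \<A>) (Cinf_topology X \<A>) (\<lambda>f. f) \<and>
         \<not> epimorphism TYPE(('a \<Rightarrow> 'a) \<times> ('a \<Rightarrow> real))
           (stabilizer X \<A> p) (Diff X \<A>) (Cinf_topology X \<A>) (\<lambda>f. f)"
proof
  show "continuous_hom
           (stabilizer X \<A> p) (subtopology (Cinf_topology X \<A>) (carrier (stabilizer X \<A> p)))
           (Diff X \<A>) (Cinf_topology X \<A>) (\<lambda>f. f)"
    by (auto simp: continuous_hom_def hom_def stabilizer_def Diff_def
        intro: continuous_map_from_subtopology)
next
  interpret compact_manifold X \<A>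
    by unfold_locales (fact assms)+
  obtain d M where "manifold_metric X \<A> d M" using ex_manifold_metric by blast
  then interpret manifold_metric X \<A> d M .
  let ?S = "topspace X"
  have ne: "?S \<noteq> {}" using assms(4) by blast
  note tT = topspace_Cinf[OF ne]
  have bilip: "\<exists>C. bilip C g" if "g \<in> diffeos X \<A>" for g
    using bilip_nbhd[OF that ne] by blast
  define \<psi> where "\<psi> = (\<lambda>t g. (g, cocycle p t g))"
  have hom: "continuous_hom (Diff X \<A>) TC affine_group action.action_topology (\<psi> t)" for t
    unfolding continuous_hom_def
  proof
    show "continuous_map TC action.action_topology (\<psi> t)"
      unfolding \<psi>_def
      by (rule continuous_map_cocycle[OF assms(4)])
        (use bilip_nbhd[OF _ ne] uniformly_close_nbhd[OF ne] tT in auto)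
    show "\<psi> t \<in> hom (Diff X \<A>) affine_group"
    proof (rule homI)
      fix g assume "g \<in> carrier (Diff X \<A>)"
      then have "g \<in> diffeos X \<A>" by (simp add: Diff_def)
      then show "\<psi> t g \<in> carrier affine_group"
        using bilip cocycle_fin_supp[OF assms(4) diffeoD(1)] by (auto simp: \<psi>_def affine_group_def)
    next
      fix g h assume "g \<in> carrier (Diff X \<A>)" "h \<in> carrier (Diff X \<A>)"
      then have gh: "g \<in> diffeos X \<A>" "h \<in> diffeos X \<A>" by (simp_all add: Diff_def)
      then have "g \<otimes>\<^bsub>Diff X \<A>\<^esub> h = compose ?S g h"
        using diffeoD(1) by (simp add: Diff_def BijGroup_def)
      then show "\<psi> t (g \<otimes>\<^bsub>Diff X \<A>\<^esub> h) = \<psi> t g \<otimes>\<^bsub>affine_group\<^esub> \<psi> t h"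
        using bilip[OF gh(1)] bilip[OF gh(2)] cocycle_mult[OF assms(4)] by (auto simp: \<psi>_def)
    qed
  qed
  \<comment> \<open>For \<open>g p = p\<close> the two point masses cancel, so the scalar
    \<open>t\<close> does not matter.\<close>
  have agree: "\<psi> 0 g = \<psi> 1 g" if "g \<in> carrier (stabilizer X \<A> p)" for g
    using that by (auto simp: \<psi>_def stabilizer_def cocycle_def)
  obtain f where f: "f \<in> diffeos X \<A>" "f p \<noteq> p" using diffeo_moving_point[OF assms(4)] by blast
  then have "\<psi> 0 f \<noteq> \<psi> 1 f"
    by (auto simp: \<psi>_def cocycle_def point_mass_def fun_eq_iff)
  moreover have "f \<in> carrier (Diff X \<A>)" using f(1) by (simp add: Diff_def)
  ultimately show "\<not> epimorphism TYPE(('a \<Rightarrow> 'a) \<times> ('a \<Rightarrow> real))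
           (stabilizer X \<A> p) (Diff X \<A>) TC (\<lambda>f. f)"
    unfolding epimorphism_def using hom[of 0] hom[of 1] agree Hausdorff_group_affine_group by blast
qed

end
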